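(* The union of the network classes $\mathcal{N}_{1},\mathcal{N}_{2},\mathcal{N}_{3},\mathcal{N}_{4}$, $\mathcal{N}_{6},\mathcal{N}_{7},\mathcal{N}_{8},\mathcal{N}_{9}$, $\mathcal{N}_{17}^{d}$, $\mathcal{N}_{18}^{d}$, $\mathcal{N}_{20}^{d},\mathcal{N}_{21}^{d},\ldots,\mathcal{N}_{27}^{d}$, $\mathcal{N}_{29}^{d}$, $\mathcal{N}_{30}^{d}$, $\mathcal{N}_{17}^{i}$, $\mathcal{N}_{18}^{i}$, $\mathcal{N}_{20}^{i},\mathcal{N}_{21}^{i},\ldots,\mathcal{N}_{27}^{i}$, $\mathcal{N}_{29}^{i}$ and $\mathcal{N}_{30}^{i}$ is a minimal generating set for $\mathcal{Z}_{2,1}$.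
   Context: **Networks.** One-port networks are built from resistors (impedance $R$), inductors (impedance $Ls$, $L>0$) and capacitors (impedance $1/(Cs)$, $C>0$). A single element is a series-parallel network, and a series or parallel connection of two series-parallel networks is a series-parallel network. A series connection of networks with impedances $Z_1,Z_2$ has impedance $Z_1+Z_2$; a parallel connection has impedance $Z$ with $1/Z=1/Z_1+1/Z_2$, written $Z_1\parallel Z_2$. Below, an expression built with $+$ and $\parallel$ describes the network with the corresponding series and parallel connections. A resistor with resistance $R=0$ is a short circuit, and a resistor with conductance $G=0$ (written $1/G$) is an open circuit; such resistors are regarded as removed and are not counted as elements. Energy storage elements are the inductors and capacitors. **Transformations.** For a series-parallel network $N$ with impedance $Z(s)$: $N^{i}$ is obtained by replacing inductors with impedance $Xs$ by capacitors with impedance $X/s$ and vice versa (impedance $Z(1/s)$); $N^{d}$ is obtained by interchanging series and parallel connections and inverting the impedance of each element (impedance $1/Z(s)$). For a class $\mathcal{N}$, $\mathcal{N}^{i}=\{N^{i}: N\in\mathcal{N}\}$ and $\mathcal{N}^{d}=\{N^{d}: N\in\mathcal{N}\}$. **Impedance sets and generating sets.** $\mathcal{Z}_{m,n}$ is the set of impedances of series-parallel networks containing at most $m$ capacitors and at most $n$ inductors. A set $\mathcal{G}$ is a generating set for $\mathcal{Z}_{m,n}$ if (i) $\mathcal{G}$ is a set of series-parallel networks, each containing at most $m+n$ energy storage elements, and (ii) for every $Z\in\mathcal{Z}_{m,n}$ there is a network in $\mathcal{G}$ whose impedance is $Z$. It is a minimal generating set if in addition it is a union of generic network classes. **Generic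 classes.** For a network class $\mathcal{N}$ whose networks contain $n$ energy storage elements, its realizability set is the set of coefficient vectors $(p_0,\ldots,p_n,q_0,\ldots,q_n)\in\mathbb{R}^{2n+2}$, with $p_n,q_n$ not both zero, such that $p/q$, with $p(s)=\sum_k p_ks^k$ and $q(s)=\sum_k q_ks^k$, is the impedance of a network in $\mathcal{N}$. The dimension of a semi-algebraic set $\mathcal{S}$ is the largest $d$ such that there is a one-to-one smooth map from $(-1,1)^d$ into $\mathcal{S}$. The class $\mathcal{N}$ is generic if every network in $\mathcal{N}$ contains strictly fewer elements than the dimension of the realizability set of $\mathcal{N}$. **Network classes.** $\mathcal{N}_k$ is the set of all networks of the form $N_k$ with parameters satisfying: all $R_j\ge 0$, all $G_j\ge 0$, all $C_j,L_j>0$, and additionally $R_2>0$ in $N_4$ and $N_{14}$. - $N_1$: $R_1$. - $N_2$: $R_1+\left(\frac1{G_2}\parallel\frac1{C_1s}\right)$. - $N_3$: $R_1+\left(\frac1{G_2}\parallel L_1s\right)$. - $N_4$: $R_1+\left(\frac1{C_2s}\parallel\left(R_2+\left(\frac1{G_3}\parallel\frac1{C_1s}\right)\right)\right)$. - $N_6$: $R_1+\left(L_1s\parallel\left(R_2+\left(\frac1{G_3}\parallel\frac1{C_1s}\right)\right)\right)$. - $N_7$: $R_1+\left(\frac1{C_1s}\parallel\left(R_2+\left(\frac1{G_3}\parallel L_1s\right)\right)\right)$. - $N_8$: $\frac1{G_1}\parallel\left(\frac1{C_1s}+\left(\frac1{G_2}\parallel(R_3+L_1s)\right)\right)$. - $N_9$: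 $\frac1{G_1}\parallel\left(L_1s+\left(\frac1{G_2}\parallel\left(R_3+\frac1{C_1s}\right)\right)\right)$. - $N_{10}$: $R_4+\left[(R_5+L_2s)\parallel\left(R_1+\left(L_1s\parallel\left(R_2+\left(\frac1{G_3}\parallel\frac1{C_1s}\right)\right)\right)\right)\right]$. - $N_{11}$: $R_4+\left[(R_5+L_2s)\parallel\left(R_1+\left(\frac1{C_1s}\parallel\left(R_2+\left(\frac1{G_3}\parallel L_1s\right)\right)\right)\right)\right]$. - $N_{12}$: $R_4+\left[(R_5+L_2s)\parallel\frac1{G_1}\parallel\left(\frac1{C_1s}+\left(\frac1{G_2}\parallel(R_3+L_1s)\right)\right)\right]$. - $N_{13}$: $R_4+\left[(R_5+L_2s)\parallel\frac1{G_1}\parallel\left(L_1s+\left(\frac1{G_2}\parallel\left(R_3+\frac1{C_1s}\right)\right)\right)\right]$. - $N_{14}$: $R_4+\left[\left(R_5+\frac1{C_1s}\right)\parallel\left(R_1+\left(L_2s\parallel\left(R_2+\left(\frac1{G_3}\parallel L_1s\right)\right)\right)\right)\right]$. The following are the subclasses obtained by removing one element (setting the indicated parameter to $0$): from $\mathcal{N}_{10}$: $\mathcal{N}_{17}$ ($G_3=0$), $\mathcal{N}_{18}$ ($R_5=0$); from $\mathcal{N}_{11}$: $\mathcal{N}_{20}$ ($G_3=0$), $\mathcal{N}_{21}$ ($R_5=0$); from $\mathcal{N}_{12}$: $\mathcal{N}_{22}$ ($G_1=0$), $\mathcal{N}_{23}$ ($R_3=0$), $\mathcal{N}_{24}$ ($R_5=0$);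 from $\mathcal{N}_{13}$: $\mathcal{N}_{25}$ ($G_1=0$), $\mathcal{N}_{26}$ ($R_3=0$), $\mathcal{N}_{27}$ ($R_5=0$); from $\mathcal{N}_{14}$: $\mathcal{N}_{29}$ ($G_3=0$), $\mathcal{N}_{30}$ ($R_5=0$). *)

theory Defs
  imports "HOL-Analysis.Analysis" "HOL-Computational_Algebra.Fraction_Field"
begin

text \<open>
  \<open>Short\<close> and \<open>Open\<close> are the degenerate resistors (zero resistance, zero conductance); element
  values are otherwise meant to be positive, which \<open>series_parallel\<close> below enforces.
\<close>

datatype network =
    Short
  | Open
  | Resistor real
  | Inductor real
  | Capacitor real
  | Series network network
  | Parallel network network

inductive series_parallel :: "network \<Rightarrow> bool" where
  "series_parallel Short"
| "series_parallel Open"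
| "R > 0 \<Longrightarrow> series_parallel (Resistor R)"
| "L > 0 \<Longrightarrow> series_parallel (Inductor L)"
| "C > 0 \<Longrightarrow> series_parallel (Capacitor C)"
| "series_parallel M \<Longrightarrow> series_parallel N \<Longrightarrow> series_parallel (Series M N)"
| "series_parallel M \<Longrightarrow> series_parallel N \<Longrightarrow> series_parallel (Parallel M N)"

primrec num_resistors :: "network \<Rightarrow> nat" where
  "num_resistors Short = 0"
| "num_resistors Open = 0"
| "num_resistors (Resistor R) = 1"
| "num_resistors (Inductor L) = 0"
| "num_resistors (Capacitor C) = 0"
| "num_resistors (Series M N) = num_resistors M + num_resistors N"
| "num_resistors (Parallel M N) = num_resistors M + num_resistors N"

primrec num_inductors :: "network \<Rightarrow> nat" where
  "num_inductors Short = 0"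
| "num_inductors Open = 0"
| "num_inductors (Resistor R) = 0"
| "num_inductors (Inductor L) = 1"
| "num_inductors (Capacitor C) = 0"
| "num_inductors (Series M N) = num_inductors M + num_inductors N"
| "num_inductors (Parallel M N) = num_inductors M + num_inductors N"

primrec num_capacitors :: "network \<Rightarrow> nat" where
  "num_capacitors Short = 0"
| "num_capacitors Open = 0"
| "num_capacitors (Resistor R) = 0"
| "num_capacitors (Inductor L) = 0"
| "num_capacitors (Capacitor C) = 1"
| "num_capacitors (Series M N) = num_capacitors M + num_capacitors N"
| "num_capacitors (Parallel M N) = num_capacitors M + num_capacitors N"

definition num_storage :: "network \<Rightarrow> nat" where
  "num_storage N = num_inductors N + num_capacitors N"

definition num_elements :: "network \<Rightarrow> nat" where
  "num_elements N = num_resistors N + num_storage N"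


text \<open>
  Impedances are real rational functions in \<open>s\<close>, extended by \<open>None\<close> for the infinite impedance of
  an open circuit, which is therefore not a member of \<open>Z_set\<close> below. \<open>imp_recip\<close> passes between impedance and admittance, so that the parallel rule
  \<open>1/Z = 1/Z\<^sub>1 + 1/Z\<^sub>2\<close> also covers the degenerate cases.
\<close>

fun imp_add :: "real poly fract option \<Rightarrow> real poly fract option \<Rightarrow> real poly fract option" where
  "imp_add (Some Z1) (Some Z2) = Some (Z1 + Z2)"
| "imp_add _ _ = None"

fun imp_recip :: "real poly fract option \<Rightarrow> real poly fract option" where
  "imp_recip None = Some 0"
| "imp_recip (Some Z) = (if Z = 0 then None else Some (inverse Z))"

primrec impedance :: "network \<Rightarrow> real poly fract option" where
  "impedance Short = Some 0"
| "impedance Open = None"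
| "impedance (Resistor R) = Some (Fract [:R:] 1)"
| "impedance (Inductor L) = Some (Fract [:0, L:] 1)"
| "impedance (Capacitor C) = Some (Fract 1 [:0, C:])"
| "impedance (Series M N) = imp_add (impedance M) (impedance N)"
| "impedance (Parallel M N) =
     imp_recip (imp_add (imp_recip (impedance M)) (imp_recip (impedance N)))"


text \<open>
  An inductor of impedance \<open>X s\<close> becomes a capacitor of impedance \<open>X / s\<close>, i.e. of capacitance
  \<open>1 / X\<close>, and vice versa.
\<close>

primrec inv_net :: "network \<Rightarrow> network" where
  "inv_net Short = Short"
| "inv_net Open = Open"
| "inv_net (Resistor R) = Resistor R"
| "inv_net (Inductor L) = Capacitor (1 / L)"
| "inv_net (Capacitor C) = Inductor (1 / C)"
| "inv_net (Series M N) = Series (inv_net M) (inv_net N)"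
| "inv_net (Parallel M N) = Parallel (inv_net M) (inv_net N)"

primrec dual_net :: "network \<Rightarrow> network" where
  "dual_net Short = Open"
| "dual_net Open = Short"
| "dual_net (Resistor R) = Resistor (1 / R)"
| "dual_net (Inductor L) = Capacitor L"
| "dual_net (Capacitor C) = Inductor C"
| "dual_net (Series M N) = Parallel (dual_net M) (dual_net N)"
| "dual_net (Parallel M N) = Series (dual_net M) (dual_net N)"


definition Z_set :: "nat \<Rightarrow> nat \<Rightarrow> real poly fract set" where
  "Z_set m n = {Z. \<exists>N. series_parallel N \<and> num_capacitors N \<le> m \<and> num_inductors N \<le> n
                     \<and> impedance N = Some Z}"

definition generating_set :: "nat \<Rightarrow> nat \<Rightarrow> network set \<Rightarrow> bool" where
  "generating_set m n \<G> \<longleftrightarrow>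
     (\<forall>N\<in>\<G>. series_parallel N \<and> num_storage N \<le> m + n) \<and>
     (\<forall>Z\<in>Z_set m n. \<exists>N\<in>\<G>. impedance N = Some Z)"


text \<open>
  The vector \<open>(p\<^sub>0, \<dots>, p\<^sub>n, q\<^sub>0, \<dots>, q\<^sub>n)\<close> is a function on the naturals vanishing from index
  \<open>2 n + 2\<close> on.
\<close>

definition realizability_set :: "nat \<Rightarrow> network set \<Rightarrow> (nat \<Rightarrow> real) set" where
  "realizability_set n \<N> =
     {v. (\<forall>k \<ge> 2 * n + 2. v k = 0) \<and> (v n \<noteq> 0 \<or> v (2 * n + 1) \<noteq> 0) \<and>
         (let p = (\<Sum>k\<le>n. monom (v k) k); q = (\<Sum>k\<le>n. monom (v (n + 1 + k)) k)
          in q \<noteq> 0 \<and> (\<exists>N\<in>\<N>. impedance N = Some (Fract p q)))}"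

text \<open>
  The cube \<open>(-1,1)\<^sup>d\<close>, again as functions vanishing from index \<open>d\<close> on; the product topology on
  \<open>nat \<Rightarrow> real\<close> induces the Euclidean topology on it.
\<close>

definition open_cube :: "nat \<Rightarrow> (nat \<Rightarrow> real) set" where
  "open_cube d = {x. (\<forall>i<d. -1 < x i \<and> x i < 1) \<and> (\<forall>i\<ge>d. x i = 0)}"

definition partial_deriv :: "nat \<Rightarrow> ((nat \<Rightarrow> real) \<Rightarrow> real) \<Rightarrow> (nat \<Rightarrow> real) \<Rightarrow> real" where
  "partial_deriv i f x = deriv (\<lambda>t. f (x(i := t))) (x i)"

text \<open>All iterated partial derivatives exist and are continuous.\<close>

definition smooth_on_cube :: "nat \<Rightarrow> ((nat \<Rightarrow> real) \<Rightarrow> real) \<Rightarrow> bool" where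
  "smooth_on_cube d f \<longleftrightarrow>
     (\<forall>is\<in>lists {..<d}.
        continuous_on (open_cube d) (foldr partial_deriv is f) \<and>
        (\<forall>i<d. \<forall>x\<in>open_cube d.
           (\<lambda>t. foldr partial_deriv is f (x(i := t))) differentiable (at (x i))))"

definition cube_embeds :: "nat \<Rightarrow> (nat \<Rightarrow> real) set \<Rightarrow> bool" where
  "cube_embeds d S \<longleftrightarrow>
     (\<exists>\<phi>. \<phi> ` open_cube d \<subseteq> S \<and> inj_on \<phi> (open_cube d) \<and>
          (\<forall>j. smooth_on_cube d (\<lambda>x. \<phi> x j)))"

definition has_dimension :: "(nat \<Rightarrow> real) set \<Rightarrow> nat \<Rightarrow> bool" where
  "has_dimension S d \<longleftrightarrow> cube_embeds d S \<and> (\<forall>e. cube_embeds e S \<longrightarrow> e \<le> d)"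

text \<open>
  A network class is a set of networks, all with the same number \<open>n\<close> of energy storage elements
  when genericity is at issue. \<open>has_dimension\<close> is relational so that no default dimension is ever
  used.
\<close>

definition generic :: "network set \<Rightarrow> bool" where
  "generic \<N> \<longleftrightarrow>
     (\<exists>n d. (\<forall>N\<in>\<N>. num_storage N = n) \<and> has_dimension (realizability_set n \<N>) d \<and>
            (\<forall>N\<in>\<N>. num_elements N < d))"

definition minimal_generating_set :: "nat \<Rightarrow> nat \<Rightarrow> network set \<Rightarrow> bool" where
  "minimal_generating_set m n \<G> \<longleftrightarrow>
     generating_set m n \<G> \<and> (\<exists>\<F>. (\<forall>\<N>\<in>\<F>. generic \<N>) \<and> \<G> = \<Union>\<F>)"


text \<open>
  Connections that drop a short circuit in series and an open circuit in parallel, so that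
  resistors with \<open>R = 0\<close> or \<open>G = 0\<close> really disappear from the networks below.
\<close>

definition ser :: "network \<Rightarrow> network \<Rightarrow> network" (infixr "\<oplus>" 65) where
  "M \<oplus> N = (if M = Short then N else if N = Short then M else Series M N)"

definition par :: "network \<Rightarrow> network \<Rightarrow> network" (infixr "\<parallel>" 70) where
  "M \<parallel> N = (if M = Open then N else if N = Open then M else Parallel M N)"

definition res :: "real \<Rightarrow> network" where
  "res R = (if R = 0 then Short else Resistor R)"

definition cond :: "real \<Rightarrow> network" where
  "cond G = (if G = 0 then Open else Resistor (1 / G))"

abbreviation ind :: "real \<Rightarrow> network" where "ind L \<equiv> Inductor L"

abbreviation cap :: "real \<Rightarrow> network" where "cap C \<equiv> Capacitor C"


definition N10 where
  "N10 R1 R2 G3 R4 R5 L1 L2 C1 =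
     res R4 \<oplus> ((res R5 \<oplus> ind L2) \<parallel> (res R1 \<oplus> (ind L1 \<parallel> (res R2 \<oplus> (cond G3 \<parallel> cap C1)))))"

definition N11 where
  "N11 R1 R2 G3 R4 R5 L1 L2 C1 =
     res R4 \<oplus> ((res R5 \<oplus> ind L2) \<parallel> (res R1 \<oplus> (cap C1 \<parallel> (res R2 \<oplus> (cond G3 \<parallel> ind L1)))))"

definition N12 where
  "N12 G1 G2 R3 R4 R5 L1 L2 C1 =
     res R4 \<oplus> ((res R5 \<oplus> ind L2) \<parallel> cond G1 \<parallel> (cap C1 \<oplus> (cond G2 \<parallel> (res R3 \<oplus> ind L1))))"

definition N13 where
  "N13 G1 G2 R3 R4 R5 L1 L2 C1 =
     res R4 \<oplus> ((res R5 \<oplus> ind L2) \<parallel> cond G1 \<parallel> (ind L1 \<oplus> (cond G2 \<parallel> (res R3 \<oplus> cap C1))))"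

definition N14 where
  "N14 R1 R2 G3 R4 R5 L1 L2 C1 =
     res R4 \<oplus> ((res R5 \<oplus> cap C1) \<parallel> (res R1 \<oplus> (ind L2 \<parallel> (res R2 \<oplus> (cond G3 \<parallel> ind L1)))))"


definition class1 :: "network set" where
  "class1 = {res R1 | R1. R1 \<ge> 0}"

definition class2 :: "network set" where
  "class2 = {res R1 \<oplus> (cond G2 \<parallel> cap C1) | R1 G2 C1. R1 \<ge> 0 \<and> G2 \<ge> 0 \<and> C1 > 0}"

definition class3 :: "network set" where
  "class3 = {res R1 \<oplus> (cond G2 \<parallel> ind L1) | R1 G2 L1. R1 \<ge> 0 \<and> G2 \<ge> 0 \<and> L1 > 0}"

definition class4 :: "network set" where
  "class4 = {res R1 \<oplus> (cap C2 \<parallel> (res R2 \<oplus> (cond G3 \<parallel> cap C1))) | R1 R2 G3 C1 C2.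
     R1 \<ge> 0 \<and> R2 > 0 \<and> G3 \<ge> 0 \<and> C1 > 0 \<and> C2 > 0}"

definition class6 :: "network set" where
  "class6 = {res R1 \<oplus> (ind L1 \<parallel> (res R2 \<oplus> (cond G3 \<parallel> cap C1))) | R1 R2 G3 L1 C1.
     R1 \<ge> 0 \<and> R2 \<ge> 0 \<and> G3 \<ge> 0 \<and> L1 > 0 \<and> C1 > 0}"

definition class7 :: "network set" where
  "class7 = {res R1 \<oplus> (cap C1 \<parallel> (res R2 \<oplus> (cond G3 \<parallel> ind L1))) | R1 R2 G3 L1 C1.
     R1 \<ge> 0 \<and> R2 \<ge> 0 \<and> G3 \<ge> 0 \<and> L1 > 0 \<and> C1 > 0}"

definition class8 :: "network set" where
  "class8 = {cond G1 \<parallel> (cap C1 \<oplus> (cond G2 \<parallel> (res R3 \<oplus> ind L1))) | G1 G2 R3 L1 C1.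
     G1 \<ge> 0 \<and> G2 \<ge> 0 \<and> R3 \<ge> 0 \<and> L1 > 0 \<and> C1 > 0}"

definition class9 :: "network set" where
  "class9 = {cond G1 \<parallel> (ind L1 \<oplus> (cond G2 \<parallel> (res R3 \<oplus> cap C1))) | G1 G2 R3 L1 C1.
     G1 \<ge> 0 \<and> G2 \<ge> 0 \<and> R3 \<ge> 0 \<and> L1 > 0 \<and> C1 > 0}"

definition class17 :: "network set" where
  "class17 = {N10 R1 R2 0 R4 R5 L1 L2 C1 | R1 R2 R4 R5 L1 L2 C1.
     R1 \<ge> 0 \<and> R2 \<ge> 0 \<and> R4 \<ge> 0 \<and> R5 \<ge> 0 \<and> L1 > 0 \<and> L2 > 0 \<and> C1 > 0}"

definition class18 :: "network set" where
  "class18 = {N10 R1 R2 G3 R4 0 L1 L2 C1 | R1 R2 G3 R4 L1 L2 C1.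
     R1 \<ge> 0 \<and> R2 \<ge> 0 \<and> G3 \<ge> 0 \<and> R4 \<ge> 0 \<and> L1 > 0 \<and> L2 > 0 \<and> C1 > 0}"

definition class20 :: "network set" where
  "class20 = {N11 R1 R2 0 R4 R5 L1 L2 C1 | R1 R2 R4 R5 L1 L2 C1.
     R1 \<ge> 0 \<and> R2 \<ge> 0 \<and> R4 \<ge> 0 \<and> R5 \<ge> 0 \<and> L1 > 0 \<and> L2 > 0 \<and> C1 > 0}"

definition class21 :: "network set" where
  "class21 = {N11 R1 R2 G3 R4 0 L1 L2 C1 | R1 R2 G3 R4 L1 L2 C1.
     R1 \<ge> 0 \<and> R2 \<ge> 0 \<and> G3 \<ge> 0 \<and> R4 \<ge> 0 \<and> L1 > 0 \<and> L2 > 0 \<and> C1 > 0}"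

definition class22 :: "network set" where
  "class22 = {N12 0 G2 R3 R4 R5 L1 L2 C1 | G2 R3 R4 R5 L1 L2 C1.
     G2 \<ge> 0 \<and> R3 \<ge> 0 \<and> R4 \<ge> 0 \<and> R5 \<ge> 0 \<and> L1 > 0 \<and> L2 > 0 \<and> C1 > 0}"

definition class23 :: "network set" where
  "class23 = {N12 G1 G2 0 R4 R5 L1 L2 C1 | G1 G2 R4 R5 L1 L2 C1.
     G1 \<ge> 0 \<and> G2 \<ge> 0 \<and> R4 \<ge> 0 \<and> R5 \<ge> 0 \<and> L1 > 0 \<and> L2 > 0 \<and> C1 > 0}"

definition class24 :: "network set" where
  "class24 = {N12 G1 G2 R3 R4 0 L1 L2 C1 | G1 G2 R3 R4 L1 L2 C1.
     G1 \<ge> 0 \<and> G2 \<ge> 0 \<and> R3 \<ge> 0 \<and> R4 \<ge> 0 \<and> L1 > 0 \<and> L2 > 0 \<and> C1 > 0}"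

definition class25 :: "network set" where
  "class25 = {N13 0 G2 R3 R4 R5 L1 L2 C1 | G2 R3 R4 R5 L1 L2 C1.
     G2 \<ge> 0 \<and> R3 \<ge> 0 \<and> R4 \<ge> 0 \<and> R5 \<ge> 0 \<and> L1 > 0 \<and> L2 > 0 \<and> C1 > 0}"

definition class26 :: "network set" where
  "class26 = {N13 G1 G2 0 R4 R5 L1 L2 C1 | G1 G2 R4 R5 L1 L2 C1.
     G1 \<ge> 0 \<and> G2 \<ge> 0 \<and> R4 \<ge> 0 \<and> R5 \<ge> 0 \<and> L1 > 0 \<and> L2 > 0 \<and> C1 > 0}"

definition class27 :: "network set" where
  "class27 = {N13 G1 G2 R3 R4 0 L1 L2 C1 | G1 G2 R3 R4 L1 L2 C1.
     G1 \<ge> 0 \<and> G2 \<ge> 0 \<and> R3 \<ge> 0 \<and> R4 \<ge> 0 \<and> L1 > 0 \<and> L2 > 0 \<and> C1 > 0}"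

definition class29 :: "network set" where
  "class29 = {N14 R1 R2 0 R4 R5 L1 L2 C1 | R1 R2 R4 R5 L1 L2 C1.
     R1 \<ge> 0 \<and> R2 > 0 \<and> R4 \<ge> 0 \<and> R5 \<ge> 0 \<and> L1 > 0 \<and> L2 > 0 \<and> C1 > 0}"

definition class30 :: "network set" where
  "class30 = {N14 R1 R2 G3 R4 0 L1 L2 C1 | R1 R2 G3 R4 L1 L2 C1.
     R1 \<ge> 0 \<and> R2 > 0 \<and> G3 \<ge> 0 \<and> R4 \<ge> 0 \<and> L1 > 0 \<and> L2 > 0 \<and> C1 > 0}"

definition base_classes :: "network set set" where
  "base_classes = {class1, class2, class3, class4, class6, class7, class8, class9}"

definition three_storage_classes :: "network set set" where
  "three_storage_classes =
     {class17, class18, class20, class21, class22, class23, class24, class25, class26, class27,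
      class29, class30}"

definition classes_2_1 :: "network set set" where
  "classes_2_1 = base_classes \<union> (`) dual_net ` three_storage_classes
                              \<union> (`) inv_net ` three_storage_classes"

end

theory Submission
  imports Defs
begin

text \<open>
  Evaluated at \<open>s > 0\<close>, an impedance is a function with values in \<open>[0, \<infinity>]\<close>, and series and parallel
  connections are continuous operations on such functions. With all element values ranging over
  \<open>[0, \<infinity>]\<close>, every network shape thus yields a compact set of functions, and identities need only be
  verified for generic element values.

  Up to resistors in series and in parallel, which collapse to a single series or parallel resistor, a
  network with two capacitors and one inductor is a connection of a one-element and a two-element
  network. By \<open>s \<mapsto> 1/s\<close> and \<open>Z \<mapsto> 1/Z\<close> it suffices to treat
  \<open>Z = R\<^sub>4 + [(R\<^sub>5 + L\<^sub>2 s) \<parallel> Y]\<close>, where \<open>Y\<close> is a two-element impedance from \<open>N\<^sub>6, \<dots>, N\<^sub>9\<close> or \<open>N\<^sub>4\<close>; this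
  network has one resistor too many. Among all realizations of \<open>Z\<close> of this kind take one with maximal
  \<open>R\<^sub>4\<close>. If no resistor could be removed, then moving the real zero \<open>-R\<^sub>5 / L\<^sub>2\<close> of \<open>Z - R\<^sub>4\<close> slightly
  towards \<open>0\<close> would change the coefficients of \<open>Y\<close> only slightly and increase \<open>R\<^sub>4\<close>. This needs \<open>Z\<close> to
  have degree three, and the remaining \<open>Z\<close> are limits of such.
\<close>


text \<open>Why moving the zero helps: near -x the branch L (s + x) is almost a short circuit, so Z
  - R4 equals L (s + x) to first order, and at a point -x' slightly to the right its value L (x -
  x') (1 + o(1)) is positive. Adding this value to R4 moves the zero to -x', and splitting off the
  new branch leaves a biquadratic with coefficients close to those of Y. Two obstacles shape the
  proof. The new biquadratic must be realizable again, but R2 = 0 lies on the boundary of what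
  \<open>N6\<close> alone realizes; the classes are therefore treated in pairs whose union has no
  boundary there, and only R1 = 0 and G3 = 0, or their dual counterparts, remain as faces. Moreover
  a maximum requires closed sets, which contain functions with element values 0 and infinity; these
  have to be recognized afterwards as networks with fewer storage elements. Genericity asks only for
  an open set of coefficient vectors: with n storage elements there are 2 n + 2 coefficients, and
  the networks have at most n + 1 resistors.\<close>

text \<open>
  Impedances are compared at \<open>s > 0\<close> only; replacing the other arguments by \<open>1\<close> turns this into
  equality of functions, and is compatible with \<open>s \<mapsto> 1 / s\<close>.
\<close>

definition pos :: "real \<Rightarrow> real" where "pos s = (if s > 0 then s else 1)"

lemma pos_pos[simp]: "pos s > 0" and pos_nonneg[simp]: "pos s \<ge> 0" and pos_neq[simp]: "pos s \<noteq> 0"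
  by (auto simp: pos_def)

lemma pos_inverse: "pos (1 / s) = 1 / pos s"
  by (auto simp: pos_def field_simps)

section \<open>Extended impedance values and sets of impedance functions\<close>

definition prl :: "ennreal \<Rightarrow> ennreal \<Rightarrow> ennreal" where
  "prl x y = inverse (inverse x + inverse y)"

lemma inverse_inverse_ennreal[simp]: "inverse (inverse (x::ennreal)) = x"
proof (cases x rule: ennreal_cases)
  case (real r)
  then show ?thesis by (cases "r = 0") (auto simp: inverse_ennreal)
qed simp

lemma prl_comm: "prl x y = prl y x" by (simp add: prl_def add.commute)
lemma prl_assoc: "prl (prl x y) z = prl x (prl y z)" by (simp add: prl_def add.assoc)
lemma inverse_prl: "inverse (prl x y) = inverse x + inverse y" by (simp add: prl_def)
lemma inverse_add_ennreal: "inverse (x + y) = prl (inverse x) (inverse y)" by (simp add: prl_def)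
lemma prl_top[simp]: "prl top x = x" "prl x top = x" by (simp_all add: prl_def)
lemma prl_0[simp]: "prl 0 x = 0" "prl x 0 = 0" by (simp_all add: prl_def)

type_synonym rfun = "real \<Rightarrow> ennreal"

text \<open>A single combinator for both connections, so that associativity, images, compactness and
  density are proved only once.\<close>

definition lift2 :: "(ennreal \<Rightarrow> ennreal \<Rightarrow> ennreal) \<Rightarrow> rfun set \<Rightarrow> rfun set \<Rightarrow> rfun set" where
  "lift2 h A B = (\<lambda>(f, g) s. h (f s) (g s)) ` (A \<times> B)"
lemma lift2_iff: "h \<in> lift2 p A B \<longleftrightarrow> (\<exists>f\<in>A. \<exists>g\<in>B. h = (\<lambda>s. p (f s) (g s)))"
  by (auto simp: lift2_def)
lemma lift2_comm:
  assumes "\<And>x y. h x y = h y x" shows "lift2 h A B = lift2 h B A"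
  unfolding set_eq_iff lift2_iff by (subst assms) blast
lemma lift2_cong_image: "lift2 h A B = {\<lambda>s. h (f s) (g s) | f g. f \<in> A \<and> g \<in> B}"
  by (auto simp: lift2_def)
lemma lift2_assoc:
  assumes "\<And>x y z. h (h x y) z = h x (h y z)"
  shows "lift2 h (lift2 h A B) C = lift2 h A (lift2 h B C)"
proof -
  have "lift2 h (lift2 h A B) C = {\<lambda>s. h (h (f s) (g s)) (k s) | f g k. f \<in> A \<and> g \<in> B \<and> k \<in> C}"
    unfolding lift2_cong_image[of h _ C] by (subst lift2_cong_image) fastforce
  also have "\<dots> = {\<lambda>s. h (f s) (h (g s) (k s)) | f g k. f \<in> A \<and> g \<in> B \<and> k \<in> C}"
    unfolding assms ..
  also have "\<dots> = lift2 h A (lift2 h B C)"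
    unfolding lift2_cong_image[of h A] by (subst lift2_cong_image) fastforce
  finally show ?thesis .
qed
lemma lift2_image:
  assumes "\<And>f g. u (\<lambda>s. h (f s) (g s)) = (\<lambda>s. h' (u f s) (u g s))"
  shows "u ` lift2 h A B = lift2 h' (u ` A) (u ` B)"
proof -
  have "u ` lift2 h A B = {u (\<lambda>s. h (f s) (g s)) | f g. f \<in> A \<and> g \<in> B}"
    unfolding lift2_cong_image by blast
  also have "\<dots> = lift2 h' (u ` A) (u ` B)"
    unfolding lift2_cong_image assms by blast
  finally show ?thesis .
qed

lemma lift2_mono: "A \<subseteq> A' \<Longrightarrow> B \<subseteq> B' \<Longrightarrow> lift2 h A B \<subseteq> lift2 h A' B'"
  by (auto simp: lift2_def)
lemma lift2_Un: "lift2 h (A \<union> B) C = lift2 h A C \<union> lift2 h B C" "lift2 h C (A \<union> B) = lift2 h C A \<union> lift2 h C B"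
  by (auto simp: lift2_def)
lemma continuous_lift2:
  assumes "\<And>f g. continuous_on (UNIV :: (rfun \<times> rfun) set) f \<Longrightarrow> continuous_on UNIV g \<Longrightarrow> continuous_on UNIV (\<lambda>x. h (f x) (g x))"
  shows "continuous_on UNIV (\<lambda>(f::rfun, g::rfun) s. h (f s) (g s))"
  unfolding case_prod_beta
  apply (intro continuous_on_coordinatewise_then_product assms)
   apply (rule continuous_on_product_then_coordinatewise[OF continuous_on_fst[OF continuous_on_id]])
  apply (rule continuous_on_product_then_coordinatewise[OF continuous_on_snd[OF continuous_on_id]])
  done

abbreviation fadd :: "rfun set \<Rightarrow> rfun set \<Rightarrow> rfun set" (infixr "\<boxplus>" 67) where
  "A \<boxplus> B \<equiv> lift2 (+) A B"
abbreviation fpar :: "rfun set \<Rightarrow> rfun set \<Rightarrow> rfun set" (infixr "\<boxtimes>" 70) where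
  "A \<boxtimes> B \<equiv> lift2 prl A B"
text \<open>
  Element values range over \<open>[0, \<infinity>]\<close>, which makes all sets of impedances below compact.
\<close>

definition RES :: "rfun set" where "RES = range (\<lambda>k s. k)"
definition IND :: "rfun set" where "IND = range (\<lambda>k s. k * ennreal (pos s))"
definition CAP :: "rfun set" where "CAP = range (\<lambda>k s. inverse (k * ennreal (pos s)))"

lemma RESI: "(\<lambda>s. k) \<in> RES" by (auto simp: RES_def)
lemma INDI: "(\<lambda>s. k * ennreal (pos s)) \<in> IND" by (auto simp: IND_def)
lemma CAPI: "(\<lambda>s. inverse (k * ennreal (pos s))) \<in> CAP" by (auto simp: CAP_def)


lemmas fadd_assoc = lift2_assoc[of "(+)", OF add.assoc]
lemmas fpar_assoc = lift2_assoc[of prl, OF prl_assoc]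
lemmas fadd_comm = lift2_comm[of "(+)", OF add.commute]
lemmas fpar_comm = lift2_comm[of prl, OF prl_comm]

lemma faddI: "f \<in> A \<Longrightarrow> g \<in> B \<Longrightarrow> (\<lambda>s. f s + g s) \<in> A \<boxplus> B" by (auto simp: lift2_def)
lemma fparI: "f \<in> A \<Longrightarrow> g \<in> B \<Longrightarrow> (\<lambda>s. prl (f s) (g s)) \<in> A \<boxtimes> B" by (auto simp: lift2_def)

lemma RES_add_RES: "RES \<boxplus> RES = RES"
proof
  show "RES \<boxplus> RES \<subseteq> RES" by (auto simp: lift2_def RES_def)
  show "RES \<subseteq> RES \<boxplus> RES" using faddI[OF RESI[of 0], of _ RES] by auto
qed
lemma RES_par_RES: "RES \<boxtimes> RES = RES"
proof
  show "RES \<boxtimes> RES \<subseteq> RES" by (auto simp: lift2_def RES_def)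
  show "RES \<subseteq> RES \<boxtimes> RES" using fparI[OF RESI[of top], of _ RES] by auto
qed

section \<open>The symmetries s -> 1/s and Z -> 1/Z\<close>

definition fi :: "rfun \<Rightarrow> rfun" where "fi f = (\<lambda>s. f (1 / s))"
definition fd :: "rfun \<Rightarrow> rfun" where "fd f = (\<lambda>s. inverse (f s))"

lemma fi_fi[simp]: "fi (fi f) = f" by (simp add: fi_def)
lemma fd_fd[simp]: "fd (fd f) = f" by (simp add: fd_def)
lemma fi_image_fi[simp]: "fi ` fi ` A = A" by (simp add: image_image)
lemma fd_image_fd[simp]: "fd ` fd ` A = A" by (simp add: image_image)
lemma fi_fd: "fi (fd f) = fd (fi f)" by (simp add: fi_def fd_def)

lemma fi_fadd: "fi ` (A \<boxplus> B) = fi ` A \<boxplus> fi ` B"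
  by (rule lift2_image) (simp add: fi_def)
lemma fi_fpar: "fi ` (A \<boxtimes> B) = fi ` A \<boxtimes> fi ` B"
  by (rule lift2_image) (simp add: fi_def)
lemma fd_fadd: "fd ` (A \<boxplus> B) = fd ` A \<boxtimes> fd ` B"
  by (rule lift2_image) (simp add: fd_def inverse_add_ennreal)
lemma fd_fpar: "fd ` (A \<boxtimes> B) = fd ` A \<boxplus> fd ` B"
  by (rule lift2_image) (simp add: fd_def inverse_prl)
lemma fi_RES: "fi ` RES = RES" by (auto simp: RES_def fi_def image_image)
lemma involution_image:
  assumes "h ` A \<subseteq> B" "h ` B \<subseteq> A" "\<And>f. h (h f) = f"
  shows "h ` A = B"
  using assms(1,2) image_mono[OF assms(2), of h] by (auto simp: image_image assms(3))
lemma fd_RES: "fd ` RES = RES"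
  by (rule involution_image) (auto simp: RES_def fd_def)
lemma fd_IND: "fd ` IND = CAP" by (auto simp: IND_def CAP_def fd_def image_image)
lemma fd_CAP: "fd ` CAP = IND" by (auto simp: IND_def CAP_def fd_def image_image)
lemma inverse_mult_pos: "t > 0 \<Longrightarrow> inverse (k * ennreal t) = inverse k * ennreal (1 / t)"
  by (subst ennreal_inverse_mult') (auto simp: inverse_ennreal inverse_eq_divide)
lemma fi_IND: "fi ` IND = CAP"
proof (rule involution_image)
  show "fi ` IND \<subseteq> CAP"
  proof
    fix f assume "f \<in> fi ` IND"
    then obtain k where "f = (\<lambda>s. k * ennreal (pos (1 / s)))" by (auto simp: IND_def fi_def)
    then have "f = (\<lambda>s. inverse (inverse k * ennreal (pos s)))" by (simp add: inverse_mult_pos pos_inverse)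
    then show "f \<in> CAP" by (simp only: CAPI)
  qed
  show "fi ` CAP \<subseteq> IND"
  proof
    fix f assume "f \<in> fi ` CAP"
    then obtain k where "f = (\<lambda>s. inverse (k * ennreal (pos (1 / s))))" by (auto simp: CAP_def fi_def)
    then have "f = (\<lambda>s. inverse k * ennreal (pos s))" by (simp add: inverse_mult_pos pos_inverse del: pos_nonneg)
    then show "f \<in> IND" by (simp only: INDI)
  qed
qed simp
lemma fi_CAP: "fi ` CAP = IND" using fi_image_fi[of IND] by (simp add: fi_IND)

lemmas fid = fi_fadd fi_fpar fd_fadd fd_fpar fi_RES fd_RES fd_IND fd_CAP fi_IND fi_CAP image_Un

lemma fi_fd_image: "fi ` fd ` A = fd ` fi ` A" by (simp add: image_image fi_fd)

section \<open>Compactness and density\<close>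

lemma continuous_prl: "continuous_on A f \<Longrightarrow> continuous_on A g \<Longrightarrow> continuous_on A (\<lambda>x. prl (f x) (g x))"
  unfolding prl_def by (intro continuous_on_inverse_ennreal continuous_on_add)

lemma continuous_fadd: "continuous_on UNIV (\<lambda>(f::rfun, g::rfun) s. f s + g s)"
  by (intro continuous_lift2 continuous_on_add)
lemma continuous_fpar: "continuous_on UNIV (\<lambda>(f::rfun, g::rfun) s. prl (f s) (g s))"
  by (intro continuous_lift2 continuous_prl)

lemma compact_lift2:
  assumes "continuous_on UNIV (\<lambda>(f::rfun, g::rfun) s. h (f s) (g s))" "compact A" "compact B"
  shows "compact (lift2 h A B)"
  unfolding lift2_def
  by (intro compact_continuous_image compact_Times continuous_on_subset[OF assms(1)] assms) auto
lemmas compact_fadd = compact_lift2[OF continuous_fadd]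
lemmas compact_fpar = compact_lift2[OF continuous_fpar]
lemma continuous_fd: "continuous_on UNIV fd"
  unfolding fd_def
  by (intro continuous_on_coordinatewise_then_product continuous_on_inverse_ennreal) simp
lemma compact_fd: "compact A \<Longrightarrow> compact (fd ` A)"
  by (intro compact_continuous_image continuous_on_subset[OF continuous_fd]) auto
lemma compact_fi: "compact A \<Longrightarrow> compact (fi ` A)"
  unfolding fi_def
  by (intro compact_continuous_image continuous_on_coordinatewise_then_product
      continuous_on_subset[OF continuous_on_product_coordinates subset_UNIV])
lemma compact_RES: "compact RES"
  unfolding RES_def
  by (intro compact_continuous_image compact_UNIV continuous_on_coordinatewise_then_product continuous_on_id)
lemma compact_IND: "compact IND"
proof -
  have "continuous_on UNIV (\<lambda>k s. k * ennreal (pos s))"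
    using ennreal_continuous_on_cmult[of "ennreal (pos _)" UNIV "\<lambda>x. x"]
    by (intro continuous_on_coordinatewise_then_product) (simp add: mult.commute continuous_on_id)
  then show ?thesis unfolding IND_def by (intro compact_continuous_image compact_UNIV)
qed
lemma compact_CAP: "compact CAP" using compact_fd[OF compact_IND] by (simp add: fd_IND)

lemmas compact_sets = compact_fadd compact_fpar compact_RES compact_IND compact_CAP compact_Un

text \<open>A product of copies of the Hausdorff space \<open>ennreal\<close> is Hausdorff, and
  compact subsets of Hausdorff spaces are closed.\<close>

lemma closed_compact: "compact (A::rfun set) \<Longrightarrow> closed A"
proof -
  have "Hausdorff_space (euclidean :: ennreal topology)"
    unfolding Hausdorff_space_def disjnt_def by (metis UNIV_I hausdorff open_openin)
  then have "Hausdorff_space (euclidean :: rfun topology)"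
    unfolding euclidean_product_topology[symmetric] Hausdorff_space_product_topology by simp
  then show "compact A \<Longrightarrow> closed A"
    using compactin_imp_closedin[of euclidean A] by simp
qed

text \<open>This reduces inclusions between sets of impedances to strictly positive, generic element values.\<close>

lemma lift2_closure:
  assumes "continuous_on UNIV (\<lambda>(f::rfun, g::rfun) s. h (f s) (g s))"
    and "closed T" "lift2 h A' B' \<subseteq> T" "A \<subseteq> closure A'" "B \<subseteq> closure B'"
  shows "lift2 h A B \<subseteq> T"
proof -
  have "(\<lambda>(f, g) s. h (f s) (g s)) ` closure (A' \<times> B') \<subseteq> T"
    using assms(3) by (intro image_closure_subset continuous_on_subset[OF assms(1) subset_UNIV] assms(2))
      (simp add: lift2_def)
  moreover have "A \<times> B \<subseteq> closure (A' \<times> B')" unfolding closure_Times using assms(4,5) by blast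
  ultimately show ?thesis unfolding lift2_def by (meson image_mono subset_trans)
qed
lemmas fadd_closure = lift2_closure[OF continuous_fadd]
lemmas fpar_closure = lift2_closure[OF continuous_fpar]

lemma fadd_closure': "A \<subseteq> closure A' \<Longrightarrow> B \<subseteq> closure B' \<Longrightarrow> A \<boxplus> B \<subseteq> closure (A' \<boxplus> B')"
  by (rule fadd_closure[OF closed_closure closure_subset])
lemma fpar_closure': "A \<subseteq> closure A' \<Longrightarrow> B \<subseteq> closure B' \<Longrightarrow> A \<boxtimes> B \<subseteq> closure (A' \<boxtimes> B')"
  by (rule fpar_closure[OF closed_closure closure_subset])

definition RESp :: "rfun set" where "RESp = {\<lambda>s. ennreal k | k. k > 0}"
definition INDp :: "rfun set" where "INDp = {\<lambda>s. ennreal (k * pos s) | k. k > 0}"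
definition CAPp :: "rfun set" where "CAPp = {\<lambda>s. ennreal (1 / (k * pos s)) | k. k > 0}"

lemma ennreal_dense_pos: "k \<in> closure {ennreal r | r. r > 0}"
proof -
  have "\<exists>u. (\<forall>n. u n > (0::real)) \<and> (\<lambda>n. ennreal (u n)) \<longlonglongrightarrow> k"
  proof (cases k rule: ennreal_cases)
    case (real r)
    have "(\<lambda>n. r + 1 / real (Suc n)) \<longlonglongrightarrow> r + 0"
      by (intro tendsto_add tendsto_const LIMSEQ_Suc[OF lim_1_over_n])
    then have "(\<lambda>n. ennreal (r + 1 / real (Suc n))) \<longlonglongrightarrow> ennreal r"
      by (intro tendsto_ennrealI) simp
    then show ?thesis using real by (intro exI[of _ "\<lambda>n. r + 1 / real (Suc n)"]) (auto simp: add_nonneg_pos)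
  next
    case top
    have "(\<lambda>n::nat. of_nat (Suc n) :: ennreal) \<longlonglongrightarrow> top" by (rule LIMSEQ_Suc[OF of_nat_tendsto_top_ennreal])
    then show ?thesis using top
      by (intro exI[of _ "\<lambda>n. real (Suc n)"]) (auto simp: ennreal_of_nat_eq_real_of_nat)
  qed
  then show ?thesis by (force simp: closure_sequential)
qed

text \<open>Finite positive values are dense in [0, infinity], and continuity in the element value
  carries this over to the functions of one element.\<close>

lemma closure_image_dense:
  assumes "continuous_on UNIV (f :: ennreal \<Rightarrow> rfun)"
  shows "range f \<subseteq> closure (f ` {ennreal r | r. r > 0})"
proof -
  have "f ` closure {ennreal r | r. r > 0} \<subseteq> closure (f ` {ennreal r | r. r > 0})"
    by (intro image_closure_subset continuous_on_subset[OF assms]) (simp_all add: closure_subset)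
  thus ?thesis using ennreal_dense_pos by blast
qed

lemma continuous_IND: "continuous_on UNIV (\<lambda>k s. k * ennreal (pos s))"
  using ennreal_continuous_on_cmult[of "ennreal (pos _)" UNIV "\<lambda>x. x"]
  by (intro continuous_on_coordinatewise_then_product) (simp add: mult.commute continuous_on_id)

lemma RES_dense: "RES \<subseteq> closure RESp"
proof -
  have "RESp = (\<lambda>k s. k) ` {ennreal r | r. r > 0}" by (auto simp: RESp_def)
  then show ?thesis unfolding RES_def
    using closure_image_dense[of "\<lambda>k s. k"] continuous_on_coordinatewise_then_product[of UNIV "\<lambda>k s. k"] by auto
qed
lemma IND_dense: "IND \<subseteq> closure INDp"
proof -
  have *: "INDp = (\<lambda>k s. k * ennreal (pos s)) ` ennreal ` {r. r > 0}"
    unfolding INDp_def setcompr_eq_image image_image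
    by (rule image_cong[OF refl]) (simp add: ennreal_mult less_imp_le)
  show ?thesis unfolding IND_def *
    by (rule closure_image_dense[OF continuous_IND, unfolded setcompr_eq_image])
qed
lemma CAP_dense: "CAP \<subseteq> closure CAPp"
proof -
  have *: "CAPp = (\<lambda>k s. inverse (k * ennreal (pos s))) ` ennreal ` {r. r > 0}"
    unfolding CAPp_def setcompr_eq_image image_image
    by (rule image_cong[OF refl]) (simp add: inverse_mult_pos inverse_ennreal inverse_eq_divide ennreal_mult[symmetric] less_imp_le)
  have c: "continuous_on UNIV (\<lambda>k s. inverse (k * ennreal (pos s)))"
    using continuous_on_compose2[OF continuous_fd continuous_IND] by (simp add: fd_def)
  show ?thesis unfolding CAP_def *
    by (rule closure_image_dense[OF c, unfolded setcompr_eq_image])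
qed

lemma prl_ennreal: "a > 0 \<Longrightarrow> b > 0 \<Longrightarrow> prl (ennreal a) (ennreal b) = ennreal (1 / (1 / a + 1 / b))"
  by (simp add: prl_def inverse_ennreal inverse_eq_divide ennreal_plus[symmetric] add_pos_pos del: ennreal_plus)

section \<open>Networks as functions\<close>

primrec val :: "network \<Rightarrow> rfun" where
  "val Short = (\<lambda>s. 0)"
| "val Open = (\<lambda>s. top)"
| "val (Resistor R) = (\<lambda>s. ennreal R)"
| "val (Inductor L) = (\<lambda>s. ennreal L * ennreal (pos s))"
| "val (Capacitor C) = (\<lambda>s. inverse (ennreal C * ennreal (pos s)))"
| "val (Series M N) = (\<lambda>s. val M s + val N s)"
| "val (Parallel M N) = (\<lambda>s. prl (val M s) (val N s))"

lemma val_ser: "val (M \<oplus> N) = (\<lambda>s. val M s + val N s)" by (auto simp: ser_def)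
lemma val_par: "val (M \<parallel> N) = (\<lambda>s. prl (val M s) (val N s))" by (auto simp: par_def)
lemma val_res: "val (res R) = (\<lambda>s. ennreal R)" by (auto simp: res_def)
lemma val_cond: "G \<ge> 0 \<Longrightarrow> val (cond G) = (\<lambda>s. inverse (ennreal G))"
  by (auto simp: cond_def inverse_ennreal inverse_eq_divide)

lemma sp_ser: "series_parallel M \<Longrightarrow> series_parallel N \<Longrightarrow> series_parallel (M \<oplus> N)"
  by (auto simp: ser_def intro: series_parallel.intros)
lemma sp_par: "series_parallel M \<Longrightarrow> series_parallel N \<Longrightarrow> series_parallel (M \<parallel> N)"
  by (auto simp: par_def intro: series_parallel.intros)
lemma sp_res: "R \<ge> 0 \<Longrightarrow> series_parallel (res R)"
  by (auto simp: res_def intro: series_parallel.intros)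
lemma sp_cond: "G \<ge> 0 \<Longrightarrow> series_parallel (cond G)"
  by (auto simp: cond_def intro: series_parallel.intros)
lemmas sp_intros = sp_ser sp_par sp_res sp_cond series_parallel.intros

lemma inv_ser: "inv_net (M \<oplus> N) = inv_net M \<oplus> inv_net N"
  by (cases M; cases N) (auto simp: ser_def)
lemma inv_par: "inv_net (M \<parallel> N) = inv_net M \<parallel> inv_net N"
  by (cases M; cases N) (auto simp: par_def)
lemma inv_res: "inv_net (res R) = res R" by (auto simp: res_def)
lemma inv_cond: "inv_net (cond R) = cond R" by (auto simp: cond_def)
lemma dual_ser: "dual_net (M \<oplus> N) = dual_net M \<parallel> dual_net N"
  by (cases M; cases N) (auto simp: ser_def par_def)
lemma dual_par: "dual_net (M \<parallel> N) = dual_net M \<oplus> dual_net N"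
  by (cases M; cases N) (auto simp: ser_def par_def)
lemma dual_res: "dual_net (res R) = cond R" by (auto simp: res_def cond_def)
lemma dual_cond: "dual_net (cond R) = res R" by (auto simp: res_def cond_def)

lemma val_inv: "series_parallel N \<Longrightarrow> val (inv_net N) = fi (val N)"
  by (induction rule: series_parallel.induct)
    (simp_all add: fi_def pos_inverse inverse_mult_pos inverse_ennreal inverse_eq_divide)
lemma val_dual: "series_parallel N \<Longrightarrow> val (dual_net N) = fd (val N)"
  by (induction rule: series_parallel.induct)
    (simp_all add: fd_def inverse_prl inverse_add_ennreal inverse_ennreal inverse_eq_divide)
lemma sp_inv: "series_parallel N \<Longrightarrow> series_parallel (inv_net N)"
  by (induction rule: series_parallel.induct) (auto intro: series_parallel.intros)
lemma sp_dual: "series_parallel N \<Longrightarrow> series_parallel (dual_net N)"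
  by (induction rule: series_parallel.induct) (auto intro: series_parallel.intros)

definition form2 where "form2 R G C = res R \<oplus> (cond G \<parallel> cap C)"
definition form4 where "form4 R1 R2 G3 C1 C2 = res R1 \<oplus> (cap C2 \<parallel> (res R2 \<oplus> (cond G3 \<parallel> cap C1)))"
definition form6 where "form6 R1 R2 G3 L1 C1 = res R1 \<oplus> (ind L1 \<parallel> (res R2 \<oplus> (cond G3 \<parallel> cap C1)))"
definition form7 where "form7 R1 R2 G3 L1 C1 = res R1 \<oplus> (cap C1 \<parallel> (res R2 \<oplus> (cond G3 \<parallel> ind L1)))"
text \<open>The slots of \<open>form8\<close> and \<open>form9\<close> match those of
  \<open>form6\<close> and \<open>form7\<close> under duality: what is a series resistance there is
  a parallel conductance here, with the same number, while inductance and capacitance are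
  exchanged.\<close>

definition form8 where "form8 G1 G2 R3 L1 C1 = cond G1 \<parallel> (cap C1 \<oplus> (cond G2 \<parallel> (res R3 \<oplus> ind L1)))"
definition form9 where "form9 G1 G2 R3 L1 C1 = cond G1 \<parallel> (ind L1 \<oplus> (cond G2 \<parallel> (res R3 \<oplus> cap C1)))"
lemmas form_defs = form2_def form4_def form6_def form7_def form8_def form9_def

lemma inv_form6: "inv_net (form6 R1 R2 G3 L1 C1) = form7 R1 R2 G3 (1 / C1) (1 / L1)"
  by (simp add: form6_def form7_def inv_ser inv_par inv_res inv_cond)
lemma dual_form6: "dual_net (form6 R1 R2 G3 L1 C1) = form8 R1 R2 G3 C1 L1"
  by (simp add: form6_def form8_def dual_ser dual_par dual_res dual_cond)
lemma dual_form7: "dual_net (form7 R1 R2 G3 L1 C1) = form9 R1 R2 G3 C1 L1"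
  by (simp add: form7_def form9_def dual_ser dual_par dual_res dual_cond)

lemma sp_form: 
  "R1 \<ge> 0 \<Longrightarrow> R2 \<ge> 0 \<Longrightarrow> G3 \<ge> 0 \<Longrightarrow> L1 > 0 \<Longrightarrow> C1 > 0 \<Longrightarrow> series_parallel (form6 R1 R2 G3 L1 C1)"
  "R1 \<ge> 0 \<Longrightarrow> R2 \<ge> 0 \<Longrightarrow> G3 \<ge> 0 \<Longrightarrow> L1 > 0 \<Longrightarrow> C1 > 0 \<Longrightarrow> series_parallel (form7 R1 R2 G3 L1 C1)"
  "R1 \<ge> 0 \<Longrightarrow> R2 \<ge> 0 \<Longrightarrow> G3 \<ge> 0 \<Longrightarrow> L1 > 0 \<Longrightarrow> C1 > 0 \<Longrightarrow> series_parallel (form8 R1 R2 G3 L1 C1)"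
  "R1 \<ge> 0 \<Longrightarrow> R2 \<ge> 0 \<Longrightarrow> G3 \<ge> 0 \<Longrightarrow> L1 > 0 \<Longrightarrow> C1 > 0 \<Longrightarrow> series_parallel (form9 R1 R2 G3 L1 C1)"
  "R1 \<ge> 0 \<Longrightarrow> R2 \<ge> 0 \<Longrightarrow> G3 \<ge> 0 \<Longrightarrow> L1 > 0 \<Longrightarrow> C1 > 0 \<Longrightarrow> series_parallel (form4 R1 R2 G3 L1 C1)"
  unfolding form_defs by (intro sp_intros; assumption)+

lemma val_form6: "G3 \<ge> 0 \<Longrightarrow> val (form6 R1 R2 G3 L1 C1) =
    (\<lambda>s. ennreal R1 + prl (ennreal L1 * ennreal (pos s)) (val (form2 R2 G3 C1) s))"
  by (simp add: form6_def form2_def val_ser val_par val_res val_cond)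
lemma val_form4: "G3 \<ge> 0 \<Longrightarrow> val (form4 R1 R2 G3 C1 C2) =
    (\<lambda>s. ennreal R1 + prl (inverse (ennreal C2 * ennreal (pos s))) (val (form2 R2 G3 C1) s))"
  by (simp add: form4_def form2_def val_ser val_par val_res val_cond)

lemma form2_val:
  assumes "R \<ge> 0" "G \<ge> 0" "C > 0"
  shows "val (form2 R G C) = (\<lambda>s. ennreal (R + 1 / (G + C * pos s)))"
proof
  fix s
  show "val (form2 R G C) s = ennreal (R + 1 / (G + C * pos s))"
    using assms by (simp add: form2_def val_ser val_par val_res val_cond prl_def inverse_ennreal inverse_eq_divide add_nonneg_pos
        flip: ennreal_plus ennreal_mult)
qed

lemma form6_val:
  assumes "R1 \<ge> 0" "R2 \<ge> 0" "G3 \<ge> 0" "L > 0" "C > 0"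
  shows "val (form6 R1 R2 G3 L C) = (\<lambda>s. ennreal (R1 + 1 / (1 / (L * pos s) + 1 / (R2 + 1 / (G3 + C * pos s)))))"
proof
  fix s
  have p: "R2 + 1 / (G3 + C * pos s) > 0" "L * pos s > 0"
    using assms by (auto intro!: add_nonneg_pos)
  have "prl (ennreal L * ennreal (pos s)) (ennreal (R2 + 1 / (G3 + C * pos s))) =
    ennreal (1 / (1 / (L * pos s) + 1 / (R2 + 1 / (G3 + C * pos s))))"
    using assms(4) by (subst ennreal_mult[symmetric]) (simp_all add: prl_ennreal p del: ennreal_plus)
  moreover have "1 / (1 / (L * pos s) + 1 / (R2 + 1 / (G3 + C * pos s))) \<ge> 0"
    using p by (simp add: zero_le_divide_iff add_nonneg_nonneg less_imp_le)
  ultimately show "val (form6 R1 R2 G3 L C) s = ennreal (R1 + 1 / (1 / (L * pos s) + 1 / (R2 + 1 / (G3 + C * pos s))))"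
    using assms(1) unfolding val_form6[OF assms(3)] form2_val[OF assms(2,3,5)] by (simp only: ennreal_plus)
qed

lemma form4_val:
  assumes "R1 \<ge> 0" "R2 \<ge> 0" "G3 \<ge> 0" "C1 > 0" "C2 > 0"
  shows "val (form4 R1 R2 G3 C1 C2) = (\<lambda>s. ennreal (R1 + 1 / (C2 * pos s + 1 / (R2 + 1 / (G3 + C1 * pos s)))))"
proof
  fix s
  have p: "R2 + 1 / (G3 + C1 * pos s) > 0" "C2 * pos s > 0"
    using assms by (auto intro!: add_nonneg_pos)
  have "prl (inverse (ennreal C2 * ennreal (pos s))) (ennreal (R2 + 1 / (G3 + C1 * pos s))) =
    ennreal (1 / (C2 * pos s + 1 / (R2 + 1 / (G3 + C1 * pos s))))"
    using assms(5) p by (subst ennreal_mult[symmetric]) (simp_all add: prl_def inverse_ennreal inverse_eq_divide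
      ennreal_plus[symmetric] add_pos_pos del: ennreal_plus)
  moreover have "1 / (C2 * pos s + 1 / (R2 + 1 / (G3 + C1 * pos s))) \<ge> 0"
    using p by (simp add: zero_le_divide_iff add_nonneg_nonneg less_imp_le)
  ultimately show "val (form4 R1 R2 G3 C1 C2) s = ennreal (R1 + 1 / (C2 * pos s + 1 / (R2 + 1 / (G3 + C1 * pos s))))"
    using assms(1) unfolding val_form4[OF assms(3)] form2_val[OF assms(2,3,4)] by (simp only: ennreal_plus)
qed

text \<open>Convergence in the product topology is pointwise convergence.\<close>

lemma closed_limit:
  assumes "closed (T :: rfun set)" "\<And>n. f n \<in> T" "\<And>s. (\<lambda>n. f n s) \<longlonglongrightarrow> g s"
  shows "g \<in> T"
proof -
  have "limitin (product_topology (\<lambda>_. euclidean) UNIV) f g sequentially"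
    using assms(3) by (simp add: limitin_componentwise)
  then have "f \<longlonglongrightarrow> g" by (simp add: euclidean_product_topology)
  then show ?thesis using assms(1,2) by (metis Lim_in_closed_set always_eventually trivial_limit_sequentially)
qed

section \<open>Closed sets of impedances with one or two storage elements\<close>

text \<open>The letters C and L list the storage elements. Each set is a network shape with element
  values in [0, infinity], so it also contains all degenerations of that shape; \<open>K6\<close> to
  \<open>K9\<close> belong to \<open>N6\<close> to \<open>N9\<close>.\<close>

definition KC :: "rfun set" where "KC = RES \<boxplus> (RES \<boxtimes> CAP)"
definition KL :: "rfun set" where "KL = RES \<boxplus> (RES \<boxtimes> IND)"
definition KCC :: "rfun set" where "KCC = RES \<boxplus> (CAP \<boxtimes> KC)"
definition KLL :: "rfun set" where "KLL = RES \<boxplus> (IND \<boxtimes> KL)"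
definition K6 :: "rfun set" where "K6 = RES \<boxplus> (IND \<boxtimes> KC)"
definition K7 :: "rfun set" where "K7 = RES \<boxplus> (CAP \<boxtimes> KL)"
definition K8 :: "rfun set" where "K8 = RES \<boxtimes> (CAP \<boxplus> KL)"
definition K9 :: "rfun set" where "K9 = RES \<boxtimes> (IND \<boxplus> KC)"
definition KCL :: "rfun set" where "KCL = K6 \<union> K7 \<union> K8 \<union> K9"

lemmas K_defs = KC_def KL_def KCC_def KLL_def K6_def K7_def K8_def K9_def KCL_def

lemma compact_K: "compact KC" "compact KL" "compact KCC" "compact KLL" "compact K6" "compact K7"
  "compact K8" "compact K9" "compact KCL"
  unfolding K_defs by (intro compact_sets)+

lemmas closed_K = compact_K[THEN closed_compact]

lemma KLI:
  assumes "R \<ge> 0" "G \<ge> 0" "L > 0" "\<And>t. t > 0 \<Longrightarrow> F t = R + 1 / (G + 1 / (L * t))"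
  shows "(\<lambda>s. ennreal (F (pos s))) \<in> KL"
proof -
  have "(\<lambda>s. ennreal (F (pos s))) = (\<lambda>s. ennreal R + prl (inverse (ennreal G)) (ennreal L * ennreal (pos s)))"
  proof
    fix s
    show "ennreal (F (pos s)) = ennreal R + prl (inverse (ennreal G)) (ennreal L * ennreal (pos s))"
      using assms(1-3) by (simp add: assms(4) prl_def inverse_ennreal inverse_eq_divide add_nonneg_pos
        flip: ennreal_plus ennreal_mult)
  qed
  then show ?thesis unfolding KL_def by (simp only:) (intro faddI fparI RESI INDI)
qed

text \<open>The two normal forms of an RL impedance. The series resistance is the value g R / (g +
  R) at s = 0, the parallel resistance g^2 / (g + R) is the rise from there to the value g at
  infinity, and the inductance is then determined.\<close>

lemma KL_alt_le: "RES \<boxtimes> (RES \<boxplus> IND) \<subseteq> KL"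
proof (rule fpar_closure[OF closed_K(2) _ RES_dense fadd_closure'[OF RES_dense IND_dense]])
  show "RESp \<boxtimes> (RESp \<boxplus> INDp) \<subseteq> KL"
  proof
    fix f assume "f \<in> RESp \<boxtimes> (RESp \<boxplus> INDp)"
    then obtain g R L where p: "g > 0" "R > 0" "L > 0"
      and f: "f = (\<lambda>s. prl (ennreal g) (ennreal R + ennreal (L * pos s)))"
      by (auto simp: lift2_def RESp_def INDp_def)
    have "f = (\<lambda>s. ennreal (1 / (1 / g + 1 / (R + L * pos s))))"
      unfolding f using p by (simp add: prl_ennreal add_pos_pos flip: ennreal_plus)
    moreover have "(\<lambda>s. ennreal (1 / (1 / g + 1 / (R + L * pos s)))) \<in> KL"
    proof (rule KLI)
      fix t :: real assume t: "t > 0"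
      have nz: "R + L * t > 0" "g + R + L * t > 0" "g + R > 0" using p t by (auto intro: add_pos_pos)
      have "1 / g + 1 / (R + L * t) = (g + R + L * t) / (g * (R + L * t))"
        using p nz by (simp add: field_simps)
      moreover have "(g + R) / g\<^sup>2 + 1 / (L * g\<^sup>2 / (g + R)\<^sup>2 * t) = (g + R) * (g + R + L * t) / (g\<^sup>2 * L * t)"
        using p t nz by (simp add: divide_simps power2_eq_square) (simp add: algebra_simps)
      ultimately show "1 / (1 / g + 1 / (R + L * t)) = g * R / (g + R) + 1 / ((g + R) / g\<^sup>2 + 1 / (L * g\<^sup>2 / (g + R)\<^sup>2 * t))"
        using p t nz by (simp add: divide_simps) (simp add: algebra_simps power2_eq_square)
    qed (use p in \<open>auto intro: add_nonneg_nonneg add_pos_pos\<close>)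
    ultimately show "f \<in> KL" by simp
  qed
qed

lemma fi_KL: "fi ` KL = KC" and fi_KC: "fi ` KC = KL"
  unfolding KL_def KC_def by (simp_all add: fid)

text \<open>The converse inclusion is the one just proved, transported by s -> 1/s and by Z ->
  1/Z.\<close>

lemma KL_alt: "KL = RES \<boxtimes> (RES \<boxplus> IND)"
proof
  have "RES \<boxtimes> (RES \<boxplus> CAP) \<subseteq> KC"
    using image_mono[OF KL_alt_le, of fi] by (simp add: fid fi_KL)
  moreover have "fd ` KL = RES \<boxtimes> (RES \<boxplus> CAP)" by (simp add: KL_def fid)
  ultimately have "fd ` fd ` KL \<subseteq> fd ` KC" by (simp add: image_mono)
  then show "KL \<subseteq> RES \<boxtimes> (RES \<boxplus> IND)" by (simp only: fd_image_fd) (simp add: KC_def fid)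
qed (rule KL_alt_le)

lemma KC_alt: "KC = RES \<boxtimes> (RES \<boxplus> CAP)"
  using arg_cong[OF KL_alt, of "image fi"] by (simp add: fid fi_KL)

lemma fd_KL: "fd ` KL = KC" unfolding KC_alt by (simp add: KL_def fid)
lemma fd_KC: "fd ` KC = KL" unfolding KL_alt by (simp add: KC_def fid)
lemma fi_K6: "fi ` K6 = K7" and fi_K7: "fi ` K7 = K6" and fd_K6: "fd ` K6 = K8" and fd_K7: "fd ` K7 = K9"
  and fd_K8: "fd ` K8 = K6" and fd_K9: "fd ` K9 = K7" and fi_K8: "fi ` K8 = K9" and fi_K9: "fi ` K9 = K8"
  and fi_KCC: "fi ` KCC = KLL" and fi_KLL: "fi ` KLL = KCC"
  unfolding K6_def K7_def K8_def K9_def KCC_def KLL_def by (simp_all add: fid fi_KL fi_KC fd_KL fd_KC)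
lemma fi_KCL: "fi ` KCL = KCL" and fd_KCL: "fd ` KCL = KCL"
  unfolding KCL_def by (auto simp: image_Un fi_K6 fi_K7 fi_K8 fi_K9 fd_K6 fd_K7 fd_K8 fd_K9)
lemmas fidK = fid fi_KL fi_KC fd_KL fd_KC fi_K6 fi_K7 fi_K8 fi_K9 fd_K6 fd_K7 fd_K8 fd_K9 fi_KCC fi_KLL fi_KCL fd_KCL

lemma fi_memI: "(\<lambda>s. f (1 / s)) \<in> A \<Longrightarrow> fi ` A = B \<Longrightarrow> f \<in> B"
  using imageI[of "fi f" A fi] by (simp add: fi_def)
lemma fd_memI: "(\<lambda>s. inverse (f s)) \<in> A \<Longrightarrow> fd ` A = B \<Longrightarrow> f \<in> B"
  using imageI[of "fd f" A fd] by (simp add: fd_def)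

lemma form2_KC: "G \<ge> 0 \<Longrightarrow> val (form2 R G C) \<in> KC"
  by (simp add: form2_def val_ser val_par val_res val_cond KC_def faddI fparI RESI CAPI)

section \<open>Biquadratic impedances and the shape \<open>N6\<close>\<close>

definition quad :: "real \<Rightarrow> real \<Rightarrow> real \<Rightarrow> real \<Rightarrow> real" where
  "quad a0 a1 a2 t = a0 + a1 * t + a2 * t\<^sup>2"

lemma quad_inverse: "t \<noteq> 0 \<Longrightarrow> quad a0 a1 a2 (1 / t) = quad a2 a1 a0 t / t\<^sup>2"
  by (simp add: quad_def field_simps power2_eq_square)

text \<open>Division with remainder at \<open>s = 0\<close>: the parameters of \<open>R\<^sub>1 + (L s \<parallel> (R\<^sub>2 + (1/G\<^sub>3 \<parallel> 1/(C s))))\<close>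
  in terms of the coefficients of the biquadratic.\<close>

lemma biquad_K6_eq:
  assumes b: "b0 > 0" "b2 > 0" "t > 0"
    and c1: "c1 = a1 * b0 - a0 * b1" "c1 > 0" and c2: "c2 = a2 * b0 - a0 * b2" "c2 \<ge> 0"
    and E: "E = b1 * c1 - b0 * c2" "E \<ge> 0" and H: "H = b2 * c1\<^sup>2 - c2 * E" "H > 0"
  shows "quad a0 a1 a2 t / quad b0 b1 b2 t = a0 / b0 + 1 / (1 / (c1 / b0\<^sup>2 * t) +
    1 / (c2 / (b0 * b2) + 1 / (b0 * b2 * E / H + b0 * b2\<^sup>2 * c1 / H * t)))"
proof -
  have "b1 * c1 \<ge> 0" using E c2 b by (smt (verit) mult_nonneg_nonneg)
  then have "b1 \<ge> 0" using c1 by (simp add: zero_le_mult_iff)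
  then have q: "quad b0 b1 b2 t > 0" unfolding quad_def using b by (intro add_pos_nonneg) auto
  have p: "b2 * c1 * t + E > 0" "c2 * t + c1 > 0" using b c1 c2 E by (auto intro: add_pos_nonneg add_nonneg_pos)
  have "1 / (b0 * b2 * E / H + b0 * b2\<^sup>2 * c1 / H * t) = H / (b0 * b2 * (b2 * c1 * t + E))"
    using b H by (simp add: field_simps power2_eq_square)
  moreover have "c2 / (b0 * b2) + H / (b0 * b2 * (b2 * c1 * t + E)) = c1 * (c2 * t + c1) / (b0 * (b2 * c1 * t + E))"
    using b p unfolding H(1) by (simp add: divide_simps) (simp add: algebra_simps power2_eq_square)
  ultimately have 1: "1 / (c2 / (b0 * b2) + 1 / (b0 * b2 * E / H + b0 * b2\<^sup>2 * c1 / H * t)) =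
     b0 * (b2 * c1 * t + E) / (c1 * (c2 * t + c1))" by simp
  have "1 / (c1 / b0\<^sup>2 * t) + b0 * (b2 * c1 * t + E) / (c1 * (c2 * t + c1)) =
     b0 * (b0 * (c2 * t + c1) + t * (b2 * c1 * t + E)) / (c1 * t * (c2 * t + c1))"
    using b p c1(2) by (simp add: divide_simps) (simp add: algebra_simps power2_eq_square)
  also have "b0 * (c2 * t + c1) + t * (b2 * c1 * t + E) = c1 * quad b0 b1 b2 t"
    unfolding E(1) quad_def by (simp add: algebra_simps power2_eq_square)
  finally have 2: "1 / (c1 / b0\<^sup>2 * t) + b0 * (b2 * c1 * t + E) / (c1 * (c2 * t + c1)) = b0 * quad b0 b1 b2 t / (t * (c2 * t + c1))"
    using c1(2) by simp
  have "a0 / b0 + t * (c2 * t + c1) / (b0 * quad b0 b1 b2 t) = (a0 * quad b0 b1 b2 t + t * (c2 * t + c1)) / (b0 * quad b0 b1 b2 t)"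
    using q b by (simp add: divide_simps)
  also have "a0 * quad b0 b1 b2 t + t * (c2 * t + c1) = b0 * quad a0 a1 a2 t"
    unfolding c1(1) c2(1) quad_def by (simp add: algebra_simps power2_eq_square)
  finally show ?thesis unfolding 1 2 using b by simp
qed

text \<open>The signs that make the five parameters of \<open>biquad_K6_eq\<close> admissible. The
  last expression is b0 times the resultant of the two quadratics.\<close>

definition crit6 :: "real \<Rightarrow> real \<Rightarrow> real \<Rightarrow> real \<Rightarrow> real \<Rightarrow> real \<Rightarrow> bool" where
  "crit6 a0 a1 a2 b0 b1 b2 \<longleftrightarrow> a0 \<ge> 0 \<and> b0 > 0 \<and> b2 > 0 \<and> a1 * b0 - a0 * b1 > 0 \<and> a2 * b0 - a0 * b2 \<ge> 0 \<and>
     b1 * (a1 * b0 - a0 * b1) - b0 * (a2 * b0 - a0 * b2) \<ge> 0 \<and>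
     b2 * (a1 * b0 - a0 * b1)\<^sup>2 - (a2 * b0 - a0 * b2) * (b1 * (a1 * b0 - a0 * b1) - b0 * (a2 * b0 - a0 * b2)) > 0"

lemma crit6_form6:
  assumes "crit6 a0 a1 a2 b0 b1 b2"
  shows "\<exists>R1 R2 G3 L C. R1 \<ge> 0 \<and> R2 \<ge> 0 \<and> G3 \<ge> 0 \<and> L > 0 \<and> C > 0 \<and>
    (\<lambda>s. ennreal (quad a0 a1 a2 (pos s) / quad b0 b1 b2 (pos s))) = val (form6 R1 R2 G3 L C)"
proof -
  define c1 c2 E H where "c1 = a1 * b0 - a0 * b1" and "c2 = a2 * b0 - a0 * b2" and "E = b1 * c1 - b0 * c2"
    and "H = b2 * c1\<^sup>2 - c2 * E"
  have c: "a0 \<ge> 0" "b0 > 0" "b2 > 0" "c1 > 0" "c2 \<ge> 0" "E \<ge> 0" "H > 0"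
    using assms unfolding crit6_def c1_def c2_def E_def H_def by auto
  have p: "a0 / b0 \<ge> 0" "c2 / (b0 * b2) \<ge> 0" "b0 * b2 * E / H \<ge> 0" "c1 / b0\<^sup>2 > 0" "b0 * b2\<^sup>2 * c1 / H > 0"
    using c by auto
  have "(\<lambda>s. ennreal (quad a0 a1 a2 (pos s) / quad b0 b1 b2 (pos s))) =
    val (form6 (a0 / b0) (c2 / (b0 * b2)) (b0 * b2 * E / H) (c1 / b0\<^sup>2) (b0 * b2\<^sup>2 * c1 / H))"
    unfolding form6_val[OF p]
    by (rule ext, subst biquad_K6_eq[OF _ _ _ c1_def _ c2_def _ E_def _ H_def]) (use c in auto)
  then show ?thesis using p by blast
qed

lemma crit6_K6:
  assumes "crit6 a0 a1 a2 b0 b1 b2"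
  shows "(\<lambda>s. ennreal (quad a0 a1 a2 (pos s) / quad b0 b1 b2 (pos s))) \<in> K6"
proof -
  obtain R1 R2 G3 L C where "G3 \<ge> 0"
    and e: "(\<lambda>s. ennreal (quad a0 a1 a2 (pos s) / quad b0 b1 b2 (pos s))) = val (form6 R1 R2 G3 L C)"
    using crit6_form6[OF assms] by blast
  then show ?thesis unfolding e val_form6[OF \<open>G3 \<ge> 0\<close>] K6_def by (intro faddI fparI RESI INDI form2_KC)
qed

lemma crit6_pos:
  assumes "crit6 a0 a1 a2 b0 b1 b2" "t > 0"
  shows "quad a0 a1 a2 t > 0" "quad b0 b1 b2 t > 0"
proof -
  define c1 c2 E where "c1 = a1 * b0 - a0 * b1" and "c2 = a2 * b0 - a0 * b2" and "E = b1 * c1 - b0 * c2"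
  have c: "a0 \<ge> 0" "b0 > 0" "b2 > 0" "c1 > 0" "c2 \<ge> 0" "E \<ge> 0"
    using assms unfolding crit6_def c1_def c2_def E_def by auto
  then have "b1 * c1 \<ge> 0" using E_def by (smt (verit) mult_nonneg_nonneg)
  then have b1: "b1 \<ge> 0" using c by (simp add: zero_le_mult_iff)
  then show q: "quad b0 b1 b2 t > 0" unfolding quad_def using c assms by (intro add_pos_nonneg) auto
  have "b0 * quad a0 a1 a2 t = a0 * quad b0 b1 b2 t + t * (c2 * t + c1)"
    unfolding c1_def c2_def quad_def by (simp add: algebra_simps power2_eq_square)
  also have "\<dots> > 0" using c q assms by (intro add_nonneg_pos mult_pos_pos) (auto intro: add_nonneg_pos)
  finally show "quad a0 a1 a2 t > 0" using c by (simp add: zero_less_mult_iff)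
qed

text \<open>The substitution s -> 1/s reverses the coefficients of both quadratics; the passage to
  1/Z in the next lemma exchanges the quadratics.\<close>

lemma crit6_K7:
  assumes "crit6 a2 a1 a0 b2 b1 b0"
  shows "(\<lambda>s. ennreal (quad a0 a1 a2 (pos s) / quad b0 b1 b2 (pos s))) \<in> K7"
  by (rule fi_memI[OF _ fi_K6]) (use crit6_K6[OF assms] in \<open>simp add: pos_inverse quad_inverse\<close>)

lemma crit6_K8:
  assumes "crit6 b0 b1 b2 a0 a1 a2"
  shows "(\<lambda>s. ennreal (quad a0 a1 a2 (pos s) / quad b0 b1 b2 (pos s))) \<in> K8"
  by (rule fd_memI[OF _ fd_K6]) (use crit6_K6[OF assms] crit6_pos[OF assms pos_pos] in \<open>simp add: inverse_ennreal\<close>)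

section \<open>Parallel connection of an RL and an RC branch\<close>

text \<open>The impedance of \<open>R\<^sub>4 + [(R\<^sub>5 + L s) \<parallel> 1/G \<parallel> (R\<^sub>1 + 1/(C s))]\<close>.\<close>

definition six :: "real \<Rightarrow> real \<Rightarrow> real \<Rightarrow> real \<Rightarrow> real \<Rightarrow> real \<Rightarrow> real \<Rightarrow> real" where
  "six R4 R5 L G R1 C t = R4 + 1 / (G + (1 / (R5 + L * t) + 1 / (R1 + 1 / (C * t))))"

lemma six_quad:
  assumes "R4 > 0" "R5 > 0" "L > 0" "G > 0" "R1 > 0" "C > 0" "t > 0"
  defines "n0 \<equiv> R5" and "n1 \<equiv> L + R1 * R5 * C" and "n2 \<equiv> L * R1 * C"
  defines "d0 \<equiv> G * n0 + 1" and "d1 \<equiv> G * n1 + (R1 + R5) * C" and "d2 \<equiv> G * n2 + L * C"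
  shows "six R4 R5 L G R1 C t = quad (R4 * d0 + n0) (R4 * d1 + n1) (R4 * d2 + n2) t / quad d0 d1 d2 t"
proof -
  \<comment> \<open>n is the common denominator of the two branch admittances, and d / n is their
    sum together with G.\<close>
  define n d where "n = quad n0 n1 n2 t" and "d = quad d0 d1 d2 t"
  have n: "n = (R5 + L * t) * (R1 * C * t + 1)"
    by (simp add: n_def n0_def n1_def n2_def quad_def algebra_simps power2_eq_square)
  have p: "R5 + L * t > 0" "R1 * C * t + 1 > 0" using assms by (auto intro!: add_pos_pos)
  have n0: "n > 0" using p unfolding n by simp
  have d: "d = G * n + (R1 * C * t + 1) + (R5 + L * t) * C * t"
    by (simp add: d_def n_def n0_def n1_def n2_def d0_def d1_def d2_def quad_def algebra_simps power2_eq_square)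
  have d0: "d > 0" using p n0 assms unfolding d by (intro add_pos_pos mult_pos_pos) auto
  have "1 / (R1 + 1 / (C * t)) = C * t / (R1 * C * t + 1)"
    using p assms by (simp add: field_simps)
  moreover have "G + (1 / (R5 + L * t) + C * t / (R1 * C * t + 1)) = d / n"
    using p unfolding d n by (simp add: divide_simps)
  ultimately have "six R4 R5 L G R1 C t = R4 + n / d" unfolding six_def by simp
  also have "\<dots> = (R4 * d + n) / d" using d0 by (simp add: field_simps)
  also have "R4 * d + n = quad (R4 * d0 + n0) (R4 * d1 + n1) (R4 * d2 + n2) t"
    by (simp add: d_def n_def quad_def algebra_simps)
  finally show ?thesis unfolding d_def .
qed

text \<open>
  The sign of \<open>L - C R\<^sub>1 R\<^sub>5\<close> decides between \<open>N\<^sub>7\<close> and \<open>N\<^sub>8\<close>: all conditions on the coefficients then hold,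
  the last one being a multiple of the square of this number.
\<close>

lemma six_K7_K8:
  assumes p: "R4 > 0" "R5 > 0" "L > 0" "G > 0" "R1 > 0" "C > 0" and le: "R1 \<le> R5" and ne: "L \<noteq> C * R1 * R5"
  shows "(\<lambda>s. ennreal (six R4 R5 L G R1 C (pos s))) \<in> K7 \<union> K8"
proof -
  define n0 n1 n2 where "n0 = R5" and "n1 = L + R1 * R5 * C" and "n2 = L * R1 * C"
  define d0 d1 d2 where "d0 = G * n0 + 1" and "d1 = G * n1 + (R1 + R5) * C" and "d2 = G * n2 + L * C"
  define a0 a1 a2 where "a0 = R4 * d0 + n0" and "a1 = R4 * d1 + n1" and "a2 = R4 * d2 + n2"
  have eq: "(\<lambda>s. ennreal (six R4 R5 L G R1 C (pos s))) = (\<lambda>s. ennreal (quad a0 a1 a2 (pos s) / quad d0 d1 d2 (pos s)))"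
    by (rule ext, subst six_quad) (use p in \<open>simp_all add: a0_def a1_def a2_def d0_def d1_def d2_def n0_def n1_def n2_def\<close>)
  have pn: "n0 > 0" "n1 > 0" "n2 > 0" unfolding n0_def n1_def n2_def using p by (auto intro!: add_pos_pos)
  then have pd: "d0 > 0" "d1 > 0" "d2 > 0" unfolding d0_def d1_def d2_def using p by (auto intro!: add_pos_pos mult_pos_pos)
  then have pa: "a0 > 0" "a1 > 0" "a2 > 0" unfolding a0_def a1_def a2_def using p pn by (auto intro!: add_pos_pos mult_pos_pos)
  have sq: "(L - C * R1 * R5)\<^sup>2 > 0" using ne by simp
  have m1: "C * R1 * (R1 + R5) \<le> 2 * (C * R1 * R5)"
    using mult_left_mono[OF le, of "C * R1"] p by (simp add: algebra_simps)
  have m2: "C\<^sup>2 * R1 ^ 3 * R5 \<le> (C * R1 * R5)\<^sup>2"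
    using mult_left_mono[OF le, of "C\<^sup>2 * R1\<^sup>2 * R5"] p by (simp add: algebra_simps power2_eq_square power3_eq_cube)
  have m3: "(C * R1 * R5)\<^sup>2 \<le> R1 * R5 ^ 3 * C\<^sup>2"
    using mult_left_mono[OF le, of "C\<^sup>2 * R5\<^sup>2 * R1"] p by (simp add: algebra_simps power2_eq_square power3_eq_cube)
  have m4: "C * R1\<^sup>2 \<le> C * R1 * R5" "C * R1 * R5 \<le> C * R5\<^sup>2"
    using mult_left_mono[OF le, of "C * R1"] mult_left_mono[OF le, of "C * R5"] p by (simp_all add: algebra_simps power2_eq_square)
  show ?thesis
  proof (cases "L > C * R1 * R5")
    case True
    have "crit6 a2 a1 a0 d2 d1 d0"
    proof -
      have c1: "a1 * d2 - a2 * d1 = L * C * (L - C * R1\<^sup>2)"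
        unfolding a1_def a2_def d1_def d2_def n1_def n2_def by (simp add: algebra_simps power2_eq_square)
      \<comment> \<open>The order of R1 and R5 enters through this sign, here and in the other
        case.\<close>
      have c2: "a0 * d2 - a2 * d0 = L * C * (R5 - R1)"
        unfolding a0_def a2_def d0_def d2_def n0_def n2_def by (simp add: algebra_simps power2_eq_square)
      have E: "d1 * (a1 * d2 - a2 * d1) - d2 * (a0 * d2 - a2 * d0) =
         L * C * (C * R1 * (2 * L - C * R1 * (R1 + R5)) + G * (L\<^sup>2 - C\<^sup>2 * R1 ^ 3 * R5))"
        unfolding c1 c2 unfolding d1_def d2_def n1_def n2_def by (simp add: algebra_simps power2_eq_square power3_eq_cube)
      have H: "d0 * (a1 * d2 - a2 * d1)\<^sup>2 - (a0 * d2 - a2 * d0) * (d1 * (a1 * d2 - a2 * d1) - d2 * (a0 * d2 - a2 * d0)) =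
         (L * C)\<^sup>2 * ((L - C * R1 * R5)\<^sup>2 * (1 + G * R1))"
        unfolding E unfolding c1 c2 unfolding d0_def n0_def by (simp add: algebra_simps power2_eq_square power3_eq_cube)
      have "L\<^sup>2 \<ge> (C * R1 * R5)\<^sup>2" using True p by (intro power_mono) auto
      then have "L\<^sup>2 - C\<^sup>2 * R1 ^ 3 * R5 \<ge> 0" using m2 by linarith
      moreover have "2 * L - C * R1 * (R1 + R5) \<ge> 0" using m1 True by linarith
      ultimately have "d1 * (a1 * d2 - a2 * d1) - d2 * (a0 * d2 - a2 * d0) \<ge> 0"
        unfolding E using p by (intro mult_nonneg_nonneg add_nonneg_nonneg) auto
      moreover have "(L * C)\<^sup>2 * ((L - C * R1 * R5)\<^sup>2 * (1 + G * R1)) > 0"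
        using sq p by (intro mult_pos_pos add_pos_pos) auto
      moreover have "L - C * R1\<^sup>2 > 0" using m4(1) True by linarith
      then have "L * C * (L - C * R1\<^sup>2) > 0" using p by (intro mult_pos_pos) auto
      moreover have "L * C * (R5 - R1) \<ge> 0" using le p by auto
      ultimately show ?thesis unfolding crit6_def H using pa pd c1 c2 by simp
    qed
    then show ?thesis unfolding eq using crit6_K7 by blast
  next
    case False
    then have lt: "L < C * R1 * R5" using ne by simp
    have "crit6 d0 d1 d2 a0 a1 a2"
    proof -
      have c1: "d1 * a0 - d0 * a1 = C * R5\<^sup>2 - L"
        unfolding a0_def a1_def d0_def d1_def n0_def n1_def by (simp add: algebra_simps power2_eq_square)
      have c2: "d2 * a0 - d0 * a2 = L * C * (R5 - R1)"
        unfolding a0_def a2_def d0_def d2_def n0_def n2_def by (simp add: algebra_simps power2_eq_square)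
      have E: "a1 * (d1 * a0 - d0 * a1) - a0 * (d2 * a0 - d0 * a2) =
         (1 + R4 * G) * (R1 * R5 ^ 3 * C\<^sup>2 - L\<^sup>2) + R4 * C * R5 * (C * R5 * (R1 + R5) - 2 * L)"
        unfolding c1 c2 unfolding a0_def a1_def d0_def d1_def n0_def n1_def by (simp add: algebra_simps power2_eq_square power3_eq_cube)
      have H: "a2 * (d1 * a0 - d0 * a1)\<^sup>2 - (d2 * a0 - d0 * a2) * (a1 * (d1 * a0 - d0 * a1) - a0 * (d2 * a0 - d0 * a2)) =
         L * C * (L - C * R1 * R5)\<^sup>2 * ((1 + R4 * G) * R5 + R4)"
        unfolding E unfolding c1 c2 unfolding a2_def d2_def n2_def by (simp add: algebra_simps power2_eq_square power3_eq_cube)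
      have "L\<^sup>2 \<le> (C * R1 * R5)\<^sup>2" using lt p by (intro power_mono) auto
      then have 1: "R1 * R5 ^ 3 * C\<^sup>2 - L\<^sup>2 \<ge> 0" using m3 by linarith
      have "2 * (C * R1 * R5) \<le> C * R5 * (R1 + R5)" using m4 by (simp add: algebra_simps power2_eq_square)
      then have 2: "C * R5 * (R1 + R5) - 2 * L \<ge> 0" using lt by linarith
      have "a1 * (d1 * a0 - d0 * a1) - a0 * (d2 * a0 - d0 * a2) \<ge> 0"
        unfolding E using p 1 2 by (intro mult_nonneg_nonneg add_nonneg_nonneg) auto
      moreover have "L * C * (L - C * R1 * R5)\<^sup>2 * ((1 + R4 * G) * R5 + R4) > 0"
        using sq p by (intro mult_pos_pos add_pos_pos) (auto intro!: add_pos_pos)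
      moreover have "C * R5\<^sup>2 - L > 0" using m4 lt by linarith
      moreover have "L * C * (R5 - R1) \<ge> 0" using le p by auto
      ultimately show ?thesis unfolding crit6_def H using pa pd c1 c2 by simp
    qed
    then show ?thesis unfolding eq using crit6_K8 by blast
  qed
qed

lemma tendsto_add_inverse: "(\<lambda>n. x + 1 / real (Suc n)) \<longlonglongrightarrow> x"
  using tendsto_add[OF tendsto_const LIMSEQ_Suc[OF lim_1_over_n], of x] by simp

text \<open>For L = C R1 R5 the resultant vanishes; this case is a limit in L, and the classes are
  closed. For R1 > R5 the substitution s -> 1/s exchanges the RL with the RC branch and hence R1
  with R5.\<close>

lemma six_KCL:
  assumes p: "R4 > 0" "R5 > 0" "L > 0" "G > 0" "R1 > 0" "C > 0"
  shows "(\<lambda>s. ennreal (six R4 R5 L G R1 C (pos s))) \<in> KCL"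
proof -
  have gen: "(\<lambda>s. ennreal (six R4 R5 L G R1 C (pos s))) \<in> K7 \<union> K8"
    if p: "R4 > 0" "R5 > 0" "L > 0" "G > 0" "R1 > 0" "C > 0" and le: "R1 \<le> R5" for R5 L R1 C
  proof (cases "L = C * R1 * R5")
    case eq: True
    define l where "l n = L + 1 / real (Suc n)" for n
    have l: "l n > 0" "l n \<noteq> C * R1 * R5" for n using that(3) eq by (auto simp: l_def intro!: add_pos_pos)
    have nz: "G + (1 / (R5 + L * pos s) + 1 / (R1 + 1 / (C * pos s))) > 0" "R5 + L * pos s > 0" for s
      using p by (auto intro!: add_pos_pos)
    show ?thesis
    proof (rule closed_limit)
      show "closed (K7 \<union> K8)" using closed_K by auto
      show "(\<lambda>s. ennreal (six R4 R5 (l n) G R1 C (pos s))) \<in> K7 \<union> K8" for n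
        by (rule six_K7_K8) (use p le l in auto)
      show "(\<lambda>n. ennreal (six R4 R5 (l n) G R1 C (pos s))) \<longlonglongrightarrow> ennreal (six R4 R5 L G R1 C (pos s))" for s
        unfolding six_def l_def
        by (intro tendsto_ennrealI tendsto_intros tendsto_add_inverse) (use nz[of s] in auto)
    qed
  qed (use that six_K7_K8 in auto)
  show ?thesis
  proof (cases "R1 \<le> R5")
    case True
    then show ?thesis using gen[OF p] by (auto simp: KCL_def)
  next
    case False
    have "(\<lambda>s. ennreal (six R4 R1 (1 / C) G R5 (1 / L) (pos s))) \<in> K7 \<union> K8"
      using p False by (intro gen) auto
    moreover have "six R4 R1 (1 / C) G R5 (1 / L) (pos s) = six R4 R5 L G R1 C (pos (1 / s))" for s
      unfolding six_def pos_inverse by (simp add: add.commute)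
    ultimately have "(\<lambda>s. ennreal (six R4 R5 L G R1 C (pos (1 / s)))) \<in> K7 \<union> K8" by simp
    then have "(\<lambda>s. ennreal (six R4 R5 L G R1 C (pos s))) \<in> K6 \<union> K9"
      by (rule fi_memI) (simp add: image_Un fidK)
    then show ?thesis by (auto simp: KCL_def)
  qed
qed

text \<open>In their second normal form both factors carry a resistor in parallel, and these two
  resistors merge.\<close>

lemma KL_par_KC: "KL \<boxtimes> KC = RES \<boxtimes> ((RES \<boxplus> IND) \<boxtimes> (RES \<boxplus> CAP))"
proof -
  have "KL \<boxtimes> KC = (RES \<boxtimes> RES) \<boxtimes> ((RES \<boxplus> IND) \<boxtimes> (RES \<boxplus> CAP))"
    unfolding KL_alt KC_alt by (metis fpar_assoc fpar_comm)
  then show ?thesis by (simp only: RES_par_RES)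
qed

text \<open>After the merging, the left-hand side has four resistors, one more than
  \<open>N6\<close> to \<open>N9\<close>. For positive element values \<open>six_KCL\<close> removes
  one; the rest is density.\<close>

lemma KL_KC_le_KCL: "RES \<boxplus> (KL \<boxtimes> KC) \<subseteq> KCL"
  unfolding KL_par_KC
proof (rule fadd_closure[OF closed_K(9) _ RES_dense fpar_closure'[OF RES_dense fpar_closure'[OF
    fadd_closure'[OF RES_dense IND_dense] fadd_closure'[OF RES_dense CAP_dense]]]])
  show "RESp \<boxplus> (RESp \<boxtimes> ((RESp \<boxplus> INDp) \<boxtimes> (RESp \<boxplus> CAPp))) \<subseteq> KCL"
  proof
    fix f assume "f \<in> RESp \<boxplus> (RESp \<boxtimes> ((RESp \<boxplus> INDp) \<boxtimes> (RESp \<boxplus> CAPp)))"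
    then obtain R4 g R5 L R1 C where p: "R4 > 0" "g > 0" "R5 > 0" "L > 0" "R1 > 0" "C > 0"
      and f: "f = (\<lambda>s. ennreal R4 + prl (ennreal g) (prl (ennreal R5 + ennreal (L * pos s)) (ennreal R1 + ennreal (1 / (C * pos s)))))"
      by (auto simp: lift2_def RESp_def INDp_def CAPp_def)
    have "f = (\<lambda>s. ennreal (six R4 R5 L (1 / g) R1 C (pos s)))"
    proof
      fix s
      have q: "R5 + L * pos s > 0" "R1 + 1 / (C * pos s) > 0" using p by (auto intro!: add_pos_pos)
      then have "1 / (R5 + L * pos s) + 1 / (R1 + 1 / (C * pos s)) > 0" by (intro add_pos_pos) auto
      then show "f s = ennreal (six R4 R5 L (1 / g) R1 C (pos s))"
        unfolding f six_def using p q
        by (simp add: prl_ennreal ennreal_plus[symmetric] add_nonneg_nonneg less_imp_le del: ennreal_plus)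
    qed
    then show "f \<in> KCL" using six_KCL p by simp
  qed
qed

section \<open>Networks with two capacitors\<close>

text \<open>Division with remainder at \<open>s = \<infinity>\<close>: the parameters of \<open>R\<^sub>1 + (1/(C\<^sub>2 s) \<parallel> (R\<^sub>2 + (1/G\<^sub>3 \<parallel> 1/(C\<^sub>1 s))))\<close>
  in terms of the coefficients of the biquadratic.\<close>

lemma biquad_KCC_eq:
  assumes b: "b0 \<ge> 0" "b2 > 0" "t > 0"
    and c1: "c1 = a1 * b2 - a2 * b1" "c1 > 0" and c0: "c0 = a0 * b2 - a2 * b0"
    and E: "E = b1 * c1 - b2 * c0" "E > 0" and H: "H = c0 * E - b0 * c1\<^sup>2" "H > 0"
  shows "quad a0 a1 a2 t / quad b0 b1 b2 t = a2 / b2 + 1 / (b2\<^sup>2 / c1 * t +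
    1 / (c1\<^sup>2 / (b2 * E) + 1 / (b0 * b2 * E / H + E\<^sup>2 * b2 / (c1 * H) * t)))"
proof -
  have c0p: "c0 > 0" using E(2) H b by (smt (verit) mult_nonneg_nonneg zero_le_power2 zero_less_mult_iff)
  have "b1 * c1 > 0" using E c0p b by (smt (verit) mult_pos_pos)
  then have "b1 > 0" using c1 by (simp add: zero_less_mult_iff)
  then have q: "quad b0 b1 b2 t > 0" unfolding quad_def using b by (auto intro: add_nonneg_pos add_pos_pos)
  have p: "E * t + b0 * c1 > 0" "c1 * t + c0 > 0" using b c1 c0p E by (auto intro: add_pos_nonneg add_pos_pos)
  have "b0 * b2 * E / H + E\<^sup>2 * b2 / (c1 * H) * t = b2 * E * (E * t + b0 * c1) / (c1 * H)"
    using c1(2) H(2) by (simp add: divide_simps) (simp add: algebra_simps power2_eq_square)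
  then have "1 / (b0 * b2 * E / H + E\<^sup>2 * b2 / (c1 * H) * t) = c1 * H / (b2 * E * (E * t + b0 * c1))"
    by simp
  moreover have "c1\<^sup>2 / (b2 * E) + c1 * H / (b2 * E * (E * t + b0 * c1)) = c1 * (c1 * t + c0) / (b2 * (E * t + b0 * c1))"
    using b p E(2) unfolding H(1) by (simp add: divide_simps) (simp add: algebra_simps power2_eq_square)
  ultimately have 1: "1 / (c1\<^sup>2 / (b2 * E) + 1 / (b0 * b2 * E / H + E\<^sup>2 * b2 / (c1 * H) * t)) =
     b2 * (E * t + b0 * c1) / (c1 * (c1 * t + c0))" by simp
  have "b2\<^sup>2 / c1 * t + b2 * (E * t + b0 * c1) / (c1 * (c1 * t + c0)) =
     b2 * (b2 * t * (c1 * t + c0) + E * t + b0 * c1) / (c1 * (c1 * t + c0))"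
    using b p c1(2) by (simp add: divide_simps) (simp add: algebra_simps power2_eq_square)
  also have "b2 * t * (c1 * t + c0) + E * t + b0 * c1 = c1 * quad b0 b1 b2 t"
    unfolding E(1) quad_def by (simp add: algebra_simps power2_eq_square)
  finally have 2: "b2\<^sup>2 / c1 * t + b2 * (E * t + b0 * c1) / (c1 * (c1 * t + c0)) = b2 * quad b0 b1 b2 t / (c1 * t + c0)"
    using c1(2) by simp
  have "a2 / b2 + (c1 * t + c0) / (b2 * quad b0 b1 b2 t) = (a2 * quad b0 b1 b2 t + (c1 * t + c0)) / (b2 * quad b0 b1 b2 t)"
    using q b by (simp add: divide_simps)
  also have "a2 * quad b0 b1 b2 t + (c1 * t + c0) = b2 * quad a0 a1 a2 t"
    unfolding c1(1) c0(1) quad_def by (simp add: algebra_simps power2_eq_square)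
  finally show ?thesis unfolding 1 2 using b by simp
qed

text \<open>The signs that make the parameters of \<open>biquad_KCC_eq\<close> admissible. The last
  three expressions occur in denominators there and must not vanish; the last one is -b2 times the
  resultant.\<close>

definition crit4 :: "real \<Rightarrow> real \<Rightarrow> real \<Rightarrow> real \<Rightarrow> real \<Rightarrow> real \<Rightarrow> bool" where
  "crit4 a0 a1 a2 b0 b1 b2 \<longleftrightarrow> a2 \<ge> 0 \<and> b0 \<ge> 0 \<and> b2 > 0 \<and> a1 * b2 - a2 * b1 > 0 \<and>
     b1 * (a1 * b2 - a2 * b1) - b2 * (a0 * b2 - a2 * b0) > 0 \<and>
     (a0 * b2 - a2 * b0) * (b1 * (a1 * b2 - a2 * b1) - b2 * (a0 * b2 - a2 * b0)) - b0 * (a1 * b2 - a2 * b1)\<^sup>2 > 0"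

lemma crit4_KCC:
  assumes "crit4 a0 a1 a2 b0 b1 b2"
  shows "(\<lambda>s. ennreal (quad a0 a1 a2 (pos s) / quad b0 b1 b2 (pos s))) \<in> KCC"
proof -
  define c1 c0 E H where "c1 = a1 * b2 - a2 * b1" and "c0 = a0 * b2 - a2 * b0" and "E = b1 * c1 - b2 * c0"
    and "H = c0 * E - b0 * c1\<^sup>2"
  have c: "a2 \<ge> 0" "b0 \<ge> 0" "b2 > 0" "c1 > 0" "E > 0" "H > 0"
    using assms unfolding crit4_def c1_def c0_def E_def H_def by auto
  have p: "a2 / b2 \<ge> 0" "c1\<^sup>2 / (b2 * E) \<ge> 0" "b0 * b2 * E / H \<ge> 0" "E\<^sup>2 * b2 / (c1 * H) > 0" "b2\<^sup>2 / c1 > 0"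
    using c by auto
  have e: "(\<lambda>s. ennreal (quad a0 a1 a2 (pos s) / quad b0 b1 b2 (pos s))) =
    val (form4 (a2 / b2) (c1\<^sup>2 / (b2 * E)) (b0 * b2 * E / H) (E\<^sup>2 * b2 / (c1 * H)) (b2\<^sup>2 / c1))"
    unfolding form4_val[OF p]
    by (rule ext, subst biquad_KCC_eq[OF _ _ _ c1_def _ c0_def E_def _ H_def]) (use c in auto)
  show ?thesis unfolding e val_form4[OF p(3)] KCC_def by (intro faddI fparI RESI CAPI form2_KC p)
qed

text \<open>x and y are the time constants of the two branches. The resultant condition of
  \<open>crit4\<close> contains the factor (x - y)^2, which is why they are assumed
  distinct.\<close>

lemma par_RC_RC_generic:
  assumes p: "G > 0" "R1 > 0" "C1 > 0" "R2 > 0" "C2 > 0" and ne: "R1 * C1 \<noteq> R2 * C2"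
  shows "(\<lambda>s. ennreal (1 / (G + (1 / (R1 + 1 / (C1 * pos s)) + 1 / (R2 + 1 / (C2 * pos s)))))) \<in> KCC"
proof -
  define x y where "x = R1 * C1" and "y = R2 * C2"
  have xy: "x > 0" "y > 0" "(x - y)\<^sup>2 > 0" using p ne by (auto simp: x_def y_def)
  define b1 b2 where "b1 = G * (x + y) + (C1 + C2)" and "b2 = G * (x * y) + (C1 * y + C2 * x)"
  have eq: "1 / (G + (1 / (R1 + 1 / (C1 * t)) + 1 / (R2 + 1 / (C2 * t)))) = quad 1 (x + y) (x * y) t / quad G b1 b2 t"
    if t: "t > 0" for t
  proof -
    have q: "x * t + 1 > 0" "y * t + 1 > 0" using t xy by (auto intro!: add_pos_pos)
    have "1 / (R1 + 1 / (C1 * t)) = C1 * t / (x * t + 1)" "1 / (R2 + 1 / (C2 * t)) = C2 * t / (y * t + 1)"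
      using q t p by (simp_all add: field_simps x_def y_def)
    moreover have "quad 1 (x + y) (x * y) t = (x * t + 1) * (y * t + 1)"
      by (simp add: quad_def algebra_simps power2_eq_square)
    moreover have "G + (C1 * t / (x * t + 1) + C2 * t / (y * t + 1)) = quad G b1 b2 t / ((x * t + 1) * (y * t + 1))"
      using q unfolding quad_def b1_def b2_def by (simp add: divide_simps) (simp add: algebra_simps power2_eq_square)
    ultimately show ?thesis by simp
  qed
  have "crit4 1 (x + y) (x * y) G b1 b2"
  proof -
    have c1: "(x + y) * b2 - x * y * b1 = C1 * y\<^sup>2 + C2 * x\<^sup>2"
      unfolding b1_def b2_def by (simp add: algebra_simps power2_eq_square)
    have c0: "1 * b2 - x * y * G = C1 * y + C2 * x"
      unfolding b2_def by (simp add: algebra_simps)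
    have E: "b1 * ((x + y) * b2 - x * y * b1) - b2 * (1 * b2 - x * y * G) = C1 * C2 * (x - y)\<^sup>2 + G * (C1 * y ^ 3 + C2 * x ^ 3)"
      unfolding c1 c0 unfolding b1_def b2_def by (simp add: algebra_simps power2_eq_square power3_eq_cube)
    have H: "(1 * b2 - x * y * G) * (b1 * ((x + y) * b2 - x * y * b1) - b2 * (1 * b2 - x * y * G)) - G * ((x + y) * b2 - x * y * b1)\<^sup>2
      = C1 * C2 * (x - y)\<^sup>2 * ((C1 * y + C2 * x) + G * x * y)"
      unfolding E unfolding c1 c0 by (simp add: algebra_simps power2_eq_square power3_eq_cube)
    have "b2 > 0" using p xy unfolding b2_def by (intro add_pos_pos) auto
    moreover have "C1 * y\<^sup>2 + C2 * x\<^sup>2 > 0" using p xy by (intro add_pos_pos) auto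
    moreover have "C1 * C2 * (x - y)\<^sup>2 + G * (C1 * y ^ 3 + C2 * x ^ 3) > 0" using p xy by (intro add_pos_pos mult_pos_pos) auto
    moreover have "C1 * C2 * (x - y)\<^sup>2 * ((C1 * y + C2 * x) + G * x * y) > 0" using p xy by (intro add_pos_pos mult_pos_pos) auto
    ultimately show ?thesis unfolding crit4_def H unfolding E unfolding c1 using p xy by auto
  qed
  from crit4_KCC[OF this] show ?thesis by (simp add: eq)
qed

text \<open>Equal time constants are limits of distinct ones, and \<open>KCC\<close> is
  closed.\<close>

lemma par_RC_RC:
  assumes p: "G > 0" "R1 > 0" "C1 > 0" "R2 > 0" "C2 > 0"
  shows "(\<lambda>s. ennreal (1 / (G + (1 / (R1 + 1 / (C1 * pos s)) + 1 / (R2 + 1 / (C2 * pos s)))))) \<in> KCC"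
proof (cases "R1 * C1 = R2 * C2")
  case eq: True
  define r where "r n = R1 + 1 / real (Suc n)" for n
  have r: "r n > 0" "r n * C1 \<noteq> R2 * C2" for n using p eq by (auto simp: r_def algebra_simps intro!: add_pos_pos)
  have q: "R1 + 1 / (C1 * pos s) > 0" "R2 + 1 / (C2 * pos s) > 0"
    "G + (1 / (R1 + 1 / (C1 * pos s)) + 1 / (R2 + 1 / (C2 * pos s))) > 0" for s
    using p by (auto intro!: add_pos_pos)
  show ?thesis
  proof (rule closed_limit[OF closed_K(3)])
    show "(\<lambda>s. ennreal (1 / (G + (1 / (r n + 1 / (C1 * pos s)) + 1 / (R2 + 1 / (C2 * pos s)))))) \<in> KCC" for n
      by (rule par_RC_RC_generic) (use p r in auto)
    show "(\<lambda>n. ennreal (1 / (G + (1 / (r n + 1 / (C1 * pos s)) + 1 / (R2 + 1 / (C2 * pos s)))))) \<longlonglongrightarrow>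
      ennreal (1 / (G + (1 / (R1 + 1 / (C1 * pos s)) + 1 / (R2 + 1 / (C2 * pos s)))))" for s
      unfolding r_def
      by (intro tendsto_ennrealI tendsto_intros tendsto_add_inverse) (use q[of s] in auto)
  qed
qed (use par_RC_RC_generic p in auto)

lemma KC_par_KC: "KC \<boxtimes> KC = RES \<boxtimes> ((RES \<boxplus> CAP) \<boxtimes> (RES \<boxplus> CAP))"
proof -
  have "KC \<boxtimes> KC = (RES \<boxtimes> RES) \<boxtimes> ((RES \<boxplus> CAP) \<boxtimes> (RES \<boxplus> CAP))"
    unfolding KC_alt by (metis fpar_assoc fpar_comm)
  then show ?thesis by (simp only: RES_par_RES)
qed

lemma KC_par_KC_le: "KC \<boxtimes> KC \<subseteq> KCC"
  unfolding KC_par_KC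
proof (rule fpar_closure[OF closed_K(3) _ RES_dense fpar_closure'[OF
    fadd_closure'[OF RES_dense CAP_dense] fadd_closure'[OF RES_dense CAP_dense]]])
  show "RESp \<boxtimes> ((RESp \<boxplus> CAPp) \<boxtimes> (RESp \<boxplus> CAPp)) \<subseteq> KCC"
  proof
    fix f assume "f \<in> RESp \<boxtimes> ((RESp \<boxplus> CAPp) \<boxtimes> (RESp \<boxplus> CAPp))"
    then obtain g R1 C1 R2 C2 where p: "g > 0" "R1 > 0" "C1 > 0" "R2 > 0" "C2 > 0"
      and f: "f = (\<lambda>s. prl (ennreal g) (prl (ennreal R1 + ennreal (1 / (C1 * pos s))) (ennreal R2 + ennreal (1 / (C2 * pos s)))))"
      by (auto simp: lift2_def RESp_def CAPp_def)
    have "f = (\<lambda>s. ennreal (1 / (1 / g + (1 / (R1 + 1 / (C1 * pos s)) + 1 / (R2 + 1 / (C2 * pos s))))))"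
    proof
      fix s
      have q: "R1 + 1 / (C1 * pos s) > 0" "R2 + 1 / (C2 * pos s) > 0" using p by (auto intro!: add_pos_pos)
      then have "1 / (R1 + 1 / (C1 * pos s)) + 1 / (R2 + 1 / (C2 * pos s)) > 0" by (intro add_pos_pos) auto
      then show "f s = ennreal (1 / (1 / g + (1 / (R1 + 1 / (C1 * pos s)) + 1 / (R2 + 1 / (C2 * pos s)))))"
        unfolding f using p q
        by (simp add: prl_ennreal ennreal_plus[symmetric] add_nonneg_nonneg less_imp_le del: ennreal_plus)
    qed
    then show "f \<in> KCC" using par_RC_RC[of "1 / g"] p by simp
  qed
qed

text \<open>The left-hand side is the image of \<open>KCC\<close> under Z(s) -> 1/Z(1/s), which
  turns capacitors into capacitors. The inclusion serves to show that \<open>KCC\<close> is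
  invariant under this map.\<close>

lemma KCC_dual_le: "RES \<boxtimes> (CAP \<boxplus> KC) \<subseteq> KCC"
  unfolding KC_def
proof (rule fpar_closure[OF closed_K(3) _ RES_dense fadd_closure'[OF CAP_dense
      fadd_closure'[OF RES_dense fpar_closure'[OF RES_dense CAP_dense]]]])
  show "RESp \<boxtimes> (CAPp \<boxplus> (RESp \<boxplus> (RESp \<boxtimes> CAPp))) \<subseteq> KCC"
  proof
    fix f assume "f \<in> RESp \<boxtimes> (CAPp \<boxplus> (RESp \<boxplus> (RESp \<boxtimes> CAPp)))"
    then obtain G' C1 R g' C2 where p': "G' > 0" "C1 > 0" "R > 0" "g' > 0" "C2 > 0"
      and f: "f = (\<lambda>s. prl (ennreal G') (ennreal (1 / (C1 * pos s)) + (ennreal R + prl (ennreal g') (ennreal (1 / (C2 * pos s))))))"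
      by (auto simp: lift2_def RESp_def CAPp_def)
    define G g where "G = 1 / G'" and "g = 1 / g'"
    have p: "G > 0" "C1 > 0" "R > 0" "g > 0" "C2 > 0" using p' by (auto simp: G_def g_def)
    define n1 where "n1 = C2 + g * R * C1 + C1"
    define b1 b2 where "b1 = C1 * g + G * n1" and "b2 = C1 * C2 + G * (R * C1 * C2)"
    have n1: "n1 > 0" using p unfolding n1_def by (auto intro!: add_pos_pos)
    have "f = (\<lambda>s. ennreal (quad g n1 (R * C1 * C2) (pos s) / quad (G * g) b1 b2 (pos s)))"
    proof
      fix s
      let ?t = "pos s"
      have q: "g + C2 * ?t > 0" "1 / (C1 * ?t) + (R + 1 / (g + C2 * ?t)) > 0" using p by (auto intro!: add_pos_pos)
      have q': "quad g n1 (R * C1 * C2) ?t > 0" "quad (G * g) b1 b2 ?t > 0"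
        unfolding quad_def b1_def b2_def using p n1 by (auto intro!: add_pos_pos mult_pos_pos)
      have "1 / (C1 * ?t) + (R + 1 / (g + C2 * ?t)) = quad g n1 (R * C1 * C2) ?t / (C1 * ?t * (g + C2 * ?t))"
        using p q(1) unfolding quad_def n1_def by (simp add: divide_simps) (simp add: algebra_simps power2_eq_square)
      then have "G + 1 / (1 / (C1 * ?t) + (R + 1 / (g + C2 * ?t))) =
          (G * quad g n1 (R * C1 * C2) ?t + C1 * ?t * (g + C2 * ?t)) / quad g n1 (R * C1 * C2) ?t"
        using q' by (simp add: field_simps)
      also have "G * quad g n1 (R * C1 * C2) ?t + C1 * ?t * (g + C2 * ?t) = quad (G * g) b1 b2 ?t"
        unfolding quad_def b1_def b2_def by (simp add: algebra_simps power2_eq_square)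
      finally have "1 / (G + 1 / (1 / (C1 * ?t) + (R + 1 / (g + C2 * ?t)))) = quad g n1 (R * C1 * C2) ?t / quad (G * g) b1 b2 ?t"
        by simp
      moreover have "f s = ennreal (1 / (G + 1 / (1 / (C1 * ?t) + (R + 1 / (g + C2 * ?t)))))"
        unfolding f using p' p q
        by (simp add: prl_ennreal ennreal_plus[symmetric] add_nonneg_nonneg less_imp_le G_def g_def del: ennreal_plus)
      ultimately show "f s = ennreal (quad g n1 (R * C1 * C2) ?t / quad (G * g) b1 b2 ?t)" by simp
    qed
    moreover have "crit4 g n1 (R * C1 * C2) (G * g) b1 b2"
    proof -
      have c1: "n1 * b2 - R * C1 * C2 * b1 = C1 * C2 * (C1 + C2)"
        unfolding b1_def b2_def n1_def by (simp add: algebra_simps)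
      have c0: "g * b2 - R * C1 * C2 * (G * g) = g * C1 * C2"
        unfolding b2_def by (simp add: algebra_simps)
      have E: "b1 * (n1 * b2 - R * C1 * C2 * b1) - b2 * (g * b2 - R * C1 * C2 * (G * g)) =
         C1 ^ 3 * C2 * g + G * (C1 * C2 * ((C1 + C2)\<^sup>2 + g * R * C1\<^sup>2))"
        unfolding c1 c0 unfolding b1_def b2_def n1_def by (simp add: algebra_simps power2_eq_square power3_eq_cube)
      have H: "(g * b2 - R * C1 * C2 * (G * g)) * (b1 * (n1 * b2 - R * C1 * C2 * b1) - b2 * (g * b2 - R * C1 * C2 * (G * g)))
         - G * g * (n1 * b2 - R * C1 * C2 * b1)\<^sup>2 = g\<^sup>2 * C1 ^ 4 * C2\<^sup>2 * (1 + G * R)"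
        unfolding E unfolding c1 c0 by (simp add: algebra_simps power2_eq_square power3_eq_cube power4_eq_xxxx)
      have "b2 > 0" using p unfolding b2_def by (intro add_pos_pos) auto
      moreover have "C1 * C2 * (C1 + C2) > 0" using p by (intro mult_pos_pos add_pos_pos) auto
      moreover have "C1 ^ 3 * C2 * g + G * (C1 * C2 * ((C1 + C2)\<^sup>2 + g * R * C1\<^sup>2)) > 0"
        using p by (intro mult_pos_pos add_pos_pos) auto
      moreover have "g\<^sup>2 * C1 ^ 4 * C2\<^sup>2 * (1 + G * R) > 0" using p by (intro mult_pos_pos add_pos_pos) auto
      ultimately show ?thesis unfolding crit4_def H unfolding E unfolding c1 using p by auto
    qed
    ultimately show "f \<in> KCC" using crit4_KCC by simp
  qed
qed

text \<open>An involution that maps a set into itself maps it onto itself.\<close>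

lemma fi_fd_KCC: "fi ` fd ` KCC = KCC"
proof -
  have 1: "fi ` fd ` KCC = RES \<boxtimes> (CAP \<boxplus> KC)" unfolding KCC_def by (simp add: fidK)
  then have "fi ` fd ` KCC \<subseteq> KCC" using KCC_dual_le by simp
  then have "fd ` fi ` fi ` fd ` KCC \<subseteq> fd ` fi ` KCC" by (intro image_mono)
  then show ?thesis using 1 KCC_dual_le by (simp add: fi_fd_image)
qed

lemma fd_KCC: "fd ` KCC = KLL" using arg_cong[OF fi_fd_KCC, of "image fi"] by (simp add: fidK)
lemma fd_KLL: "fd ` KLL = KCC" using fd_KCC by (metis fd_image_fd)

section \<open>Collapsing resistor ladders\<close>

text \<open>Moving resistors past a subnetwork rescales its impedance by a positive factor, so the
  sets involved have to be stable under scaling.\<close>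

definition cone :: "rfun set \<Rightarrow> bool" where
  "cone X \<longleftrightarrow> (\<forall>f\<in>X. \<forall>k>0. (\<lambda>s. ennreal k * f s) \<in> X)"

lemma ennreal_mult_inverse_scale: "k > 0 \<Longrightarrow> inverse (ennreal k * x) = ennreal (1 / k) * inverse x"
  by (subst ennreal_inverse_mult') (auto simp: inverse_ennreal inverse_eq_divide)

lemma prl_scale: "k > 0 \<Longrightarrow> ennreal k * prl x y = prl (ennreal k * x) (ennreal k * y)"
  unfolding prl_def by (simp add: ennreal_mult_inverse_scale distrib_left[symmetric])

lemma cone_fadd: "cone A \<Longrightarrow> cone B \<Longrightarrow> cone (A \<boxplus> B)"
  unfolding cone_def lift2_def by (force simp: distrib_left)
lemma cone_fpar: "cone A \<Longrightarrow> cone B \<Longrightarrow> cone (A \<boxtimes> B)"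
  unfolding cone_def lift2_def by (force simp: prl_scale)
lemma cone_RES: "cone RES" unfolding cone_def RES_def by auto
lemma cone_IND: "cone IND" unfolding cone_def IND_def by (auto simp: mult.assoc[symmetric])
lemma cone_CAP: "cone CAP"
  unfolding cone_def
proof (intro ballI allI impI)
  fix f and k :: real assume "f \<in> CAP" "k > 0"
  then obtain c where f: "f = (\<lambda>s. inverse (c * ennreal (pos s)))" by (auto simp: CAP_def)
  have "(\<lambda>s. ennreal k * f s) = (\<lambda>s. inverse ((ennreal (1 / k) * c) * ennreal (pos s)))"
    using \<open>k > 0\<close> unfolding f mult.assoc by (simp add: ennreal_mult_inverse_scale)
  then show "(\<lambda>s. ennreal k * f s) \<in> CAP" by (simp only: CAPI)
qed
lemma cone_Un: "cone A \<Longrightarrow> cone B \<Longrightarrow> cone (A \<union> B)" unfolding cone_def by auto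
lemmas cone_intros = cone_fadd cone_fpar cone_RES cone_IND cone_CAP cone_Un

lemma cone_K: "cone KC" "cone KL" "cone KCC" "cone KLL" "cone KCL"
  unfolding K_defs by (intro cone_intros)+

text \<open>This is the LDU factorization of the chain matrix of a resistor ladder; its diagonal part scales impedances.\<close>

lemma ladder_eq:
  assumes "g > 0" "R > 0"
  shows "prl (ennreal g) (ennreal R + w) =
     ennreal (g * R / (g + R)) + prl (ennreal (g\<^sup>2 / (g + R))) (ennreal (g\<^sup>2 / (g + R)\<^sup>2) * w)"
proof -
  have gR: "g + R > 0" using assms by simp
  show ?thesis
  proof (cases w rule: ennreal_cases)
    case (real r)
    show ?thesis
    proof (cases "r = 0")
      case True
      then show ?thesis using assms real gR by (simp add: prl_ennreal) (simp add: field_simps)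
    next
      case False
      then have r: "r > 0" using real by simp
      have k: "g\<^sup>2 / (g + R)\<^sup>2 * r > 0" "g\<^sup>2 / (g + R) > 0" using r gR assms by auto
      have "1 / (1 / g + 1 / (R + r)) = g * (R + r) / (g + R + r)" using assms r by (simp add: field_simps)
      moreover have "1 / (g\<^sup>2 / (g + R)) + 1 / (g\<^sup>2 / (g + R)\<^sup>2 * r) = (g + R) * (g + R + r) / (g\<^sup>2 * r)"
        using assms r gR by (simp add: divide_simps) (simp add: algebra_simps power2_eq_square)
      then have "1 / (1 / (g\<^sup>2 / (g + R)) + 1 / (g\<^sup>2 / (g + R)\<^sup>2 * r)) = g\<^sup>2 * r / ((g + R) * (g + R + r))" by simp
      moreover have "g * R / (g + R) + g\<^sup>2 * r / ((g + R) * (g + R + r)) = g * (R + r) / (g + R + r)"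
        using assms r gR by (simp add: divide_simps) (simp add: algebra_simps power2_eq_square)
      ultimately have e: "1 / (1 / g + 1 / (R + r)) = g * R / (g + R) + 1 / (1 / (g\<^sup>2 / (g + R)) + 1 / (g\<^sup>2 / (g + R)\<^sup>2 * r))"
        by simp
      have "ennreal R + w = ennreal (R + r)" using real assms by simp
      then have "prl (ennreal g) (ennreal R + w) = ennreal (1 / (1 / g + 1 / (R + r)))"
        using assms r by (simp add: prl_ennreal del: ennreal_plus)
      also have "\<dots> = ennreal (g * R / (g + R)) + ennreal (1 / (1 / (g\<^sup>2 / (g + R)) + 1 / (g\<^sup>2 / (g + R)\<^sup>2 * r)))"
        unfolding e using assms gR r k by (intro ennreal_plus) (auto intro!: divide_nonneg_nonneg add_nonneg_nonneg)
      also have "ennreal (1 / (1 / (g\<^sup>2 / (g + R)) + 1 / (g\<^sup>2 / (g + R)\<^sup>2 * r))) =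
         prl (ennreal (g\<^sup>2 / (g + R))) (ennreal (g\<^sup>2 / (g + R)\<^sup>2 * r))" using prl_ennreal[OF k(2,1)] by simp
      also have "ennreal (g\<^sup>2 / (g + R)\<^sup>2 * r) = ennreal (g\<^sup>2 / (g + R)\<^sup>2) * w" using real by (simp add: ennreal_mult[symmetric])
      finally show ?thesis .
    qed
  next
    case top
    have "g * R / (g + R) + g\<^sup>2 / (g + R) = g * (g + R) / (g + R)"
      by (simp add: add_divide_distrib[symmetric] algebra_simps power2_eq_square)
    then have "g * R / (g + R) + g\<^sup>2 / (g + R) = g" using gR by simp
    then show ?thesis using assms gR top
      by (simp add: ennreal_mult_top ennreal_plus[symmetric] del: ennreal_plus)
  qed
qed

text \<open>The factor produced by \<open>ladder_eq\<close> is absorbed by the cone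
  \<open>W\<close>. Applied repeatedly, this brings any resistors around \<open>W\<close> into the
  order of one series and one parallel resistor.\<close>

lemma ladder:
  assumes "compact W" "cone W"
  shows "RES \<boxtimes> (RES \<boxplus> W) \<subseteq> RES \<boxplus> (RES \<boxtimes> W)"
proof (rule fpar_closure[OF _ _ RES_dense fadd_closure'[OF RES_dense closure_subset]])
  show "closed (RES \<boxplus> (RES \<boxtimes> W))" by (intro closed_compact compact_sets assms)
  show "RESp \<boxtimes> (RESp \<boxplus> W) \<subseteq> RES \<boxplus> (RES \<boxtimes> W)"
  proof
    fix f assume "f \<in> RESp \<boxtimes> (RESp \<boxplus> W)"
    then obtain g R w where p: "g > 0" "R > 0" "w \<in> W" and f: "f = (\<lambda>s. prl (ennreal g) (ennreal R + w s))"
      by (auto simp: lift2_def RESp_def)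
    have "(\<lambda>s. ennreal (g\<^sup>2 / (g + R)\<^sup>2) * w s) \<in> W" using assms(2) p unfolding cone_def by auto
    then show "f \<in> RES \<boxplus> (RES \<boxtimes> W)" unfolding f ladder_eq[OF p(1,2)] by (intro faddI fparI RESI)
  qed
qed

subsection \<open>Networks with at most two energy storage elements\<close>

lemma RES_fadd_absorb: "RES \<boxplus> (RES \<boxplus> W) = RES \<boxplus> W"
  by (simp only: fadd_assoc[symmetric] RES_add_RES)
lemma RES_fpar_absorb: "RES \<boxtimes> (RES \<boxtimes> W) = RES \<boxtimes> W"
  by (simp only: fpar_assoc[symmetric] RES_par_RES)

text \<open>The inner parallel resistor left by \<open>ladder\<close> is absorbed by the factor
  \<open>X\<close>.\<close>

lemma ladder_par:
  assumes "compact X" "compact Y" "cone X" "cone Y" "RES \<boxtimes> X \<subseteq> X"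
  shows "RES \<boxtimes> (RES \<boxplus> (X \<boxtimes> Y)) \<subseteq> RES \<boxplus> (X \<boxtimes> Y)"
proof -
  have "RES \<boxtimes> (RES \<boxplus> (X \<boxtimes> Y)) \<subseteq> RES \<boxplus> (RES \<boxtimes> (X \<boxtimes> Y))"
    by (intro ladder compact_sets cone_intros assms)
  also have "RES \<boxtimes> (X \<boxtimes> Y) = (RES \<boxtimes> X) \<boxtimes> Y" by (simp only: fpar_assoc)
  also have "RES \<boxplus> \<dots> \<subseteq> RES \<boxplus> (X \<boxtimes> Y)" by (intro lift2_mono order_refl assms)
  finally show ?thesis .
qed

lemma ladder_ser:
  assumes "compact X" "compact Y" "cone X" "cone Y" "RES \<boxtimes> X \<subseteq> X"
  shows "RES \<boxplus> (RES \<boxtimes> (fd ` X \<boxplus> fd ` Y)) \<subseteq> RES \<boxtimes> (fd ` X \<boxplus> fd ` Y)"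
  using image_mono[OF ladder_par[OF assms], of fd] by (simp add: fidK)

lemma RES_KC: "RES \<boxplus> KC = KC" "RES \<boxtimes> KC = KC"
  by (simp_all add: KC_def RES_fadd_absorb) (simp add: KC_def[symmetric] KC_alt RES_fpar_absorb)
lemma RES_KL: "RES \<boxplus> KL = KL" "RES \<boxtimes> KL = KL"
  by (simp_all add: KL_def RES_fadd_absorb) (simp add: KL_def[symmetric] KL_alt RES_fpar_absorb)
lemma RES_KLL: "RES \<boxplus> KLL = KLL" by (simp add: KLL_def RES_fadd_absorb)
lemma RES_KCC: "RES \<boxplus> KCC = KCC" "RES \<boxtimes> KCC = KCC"
proof -
  show "RES \<boxplus> KCC = KCC" by (simp add: KCC_def RES_fadd_absorb)
  show "RES \<boxtimes> KCC = KCC" using arg_cong[OF RES_KLL, of "image fd"] by (simp add: fidK fd_KLL)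
qed

lemma fadd_superset: "(\<lambda>s. 0) \<in> A \<Longrightarrow> B \<subseteq> A \<boxplus> B"
  using faddI[of "\<lambda>s. 0" A _ B] by auto
lemma fpar_superset: "(\<lambda>s. top) \<in> A \<Longrightarrow> B \<subseteq> A \<boxtimes> B"
  using fparI[of "\<lambda>s. top" A _ B] by auto

lemma zero_IND: "(\<lambda>s. 0) \<in> IND" using INDI[of 0] by simp
lemma top_IND: "(\<lambda>s. top) \<in> IND" using INDI[of top] by (simp add: ennreal_top_mult)
lemma zero_CAP: "(\<lambda>s. 0) \<in> CAP" using CAPI[of top] by (simp add: ennreal_top_mult)
lemma top_CAP: "(\<lambda>s. top) \<in> CAP" using CAPI[of 0] by simp

lemma IND_le_KL: "IND \<subseteq> KL" unfolding KL_def
  by (rule order_trans[OF fpar_superset fadd_superset]) (auto intro: RESI)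
lemma CAP_le_KC: "CAP \<subseteq> KC" unfolding KC_def
  by (rule order_trans[OF fpar_superset fadd_superset]) (auto intro: RESI)
lemma fadd_superset2: "(\<lambda>s. 0) \<in> B \<Longrightarrow> A \<subseteq> A \<boxplus> B"
  using fadd_superset[of B A] by (simp only: fadd_comm)

lemma RES_le_KL: "RES \<subseteq> KL" and RES_le_KC: "RES \<subseteq> KC"
  unfolding KL_def KC_def
  by (rule fadd_superset2, subst prl_0(1)[symmetric], rule fparI[OF RESI], rule zero_IND zero_CAP)+

lemma const_KL: "(\<lambda>s. k) \<in> KL" and const_KC: "(\<lambda>s. k) \<in> KC"
  using RES_le_KL RES_le_KC RESI by auto
lemma KC_le_KCL: "KC \<subseteq> KCL" and KL_le_KCL: "KL \<subseteq> KCL"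
proof -
  have "KC \<subseteq> K6" unfolding K6_def
    by (rule order_trans[OF fpar_superset fadd_superset]) (auto intro: RESI top_IND)
  moreover have "KL \<subseteq> K7" unfolding K7_def
    by (rule order_trans[OF fpar_superset fadd_superset]) (auto intro: RESI top_CAP)
  ultimately show "KC \<subseteq> KCL" "KL \<subseteq> KCL" by (auto simp: KCL_def)
qed
lemma const_KCL: "(\<lambda>s. k) \<in> KCL"
  using const_KC KC_le_KCL by auto

lemma KC_KL_le_KCL: "KC \<boxplus> KL \<subseteq> KCL" "KC \<boxtimes> KL \<subseteq> KCL"
proof -
  have "KC \<boxtimes> KL \<subseteq> RES \<boxplus> (KC \<boxtimes> KL)" by (intro fadd_superset RESI)
  then show "KC \<boxtimes> KL \<subseteq> KCL" using KL_KC_le_KCL by (simp add: fpar_comm[of KC])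
  from image_mono[OF this, of fd] show "KC \<boxplus> KL \<subseteq> KCL" by (simp add: fidK fadd_comm[of KC])
qed

text \<open>Only \<open>K8\<close> and \<open>K9\<close>, whose outermost resistor is parallel, need
  an argument: they lie in \<open>RES \<boxtimes> (KC \<boxplus> KL)\<close>, which the ladder makes
  stable under series resistors and which the dual of \<open>KL_KC_le_KCL\<close> places in
  \<open>KCL\<close>.\<close>

lemma RES_KCL: "RES \<boxplus> KCL \<subseteq> KCL" "RES \<boxtimes> KCL \<subseteq> KCL"
proof -
  have f: "RES \<boxtimes> (KC \<boxplus> KL) \<subseteq> KCL"
    using image_mono[OF KL_KC_le_KCL, of fd] by (simp add: fidK)
  have l: "RES \<boxplus> (RES \<boxtimes> (KC \<boxplus> KL)) \<subseteq> RES \<boxtimes> (KC \<boxplus> KL)"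
    using ladder_ser[of KL KC] by (simp add: fidK compact_K cone_K RES_KL)
  have K6: "RES \<boxplus> K6 \<subseteq> KCL" "RES \<boxplus> K7 \<subseteq> KCL"
    by (simp_all add: K6_def K7_def RES_fadd_absorb KCL_def) (auto simp: K6_def K7_def)
  have "K8 \<subseteq> RES \<boxtimes> (KC \<boxplus> KL)" unfolding K8_def by (intro lift2_mono order_refl CAP_le_KC)
  then have K8: "RES \<boxplus> K8 \<subseteq> KCL" using l f lift2_mono[OF order_refl] by blast
  have "K9 \<subseteq> RES \<boxtimes> (KC \<boxplus> KL)" unfolding K9_def fadd_comm[of IND] by (intro lift2_mono order_refl IND_le_KL)
  then have K9: "RES \<boxplus> K9 \<subseteq> KCL" using l f lift2_mono[OF order_refl] by blast
  show 1: "RES \<boxplus> KCL \<subseteq> KCL"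
    unfolding KCL_def[THEN arg_cong[where f = "lift2 (+) RES"]] using K6 K8 K9 by (simp add: lift2_Un)
  from image_mono[OF 1, of fd] show "RES \<boxtimes> KCL \<subseteq> KCL" by (simp add: fidK)
qed

lemma KC_KC_le_KCC: "KC \<boxplus> KC \<subseteq> KCC"
  using image_mono[OF image_mono[OF KC_par_KC_le, of fd], of fi] by (simp add: fidK fi_fd_KCC)

definition K21 :: "rfun set" where
  "K21 = (RES \<boxplus> (KC \<boxtimes> KCL) \<union> RES \<boxplus> (KL \<boxtimes> KCC)) \<union> (RES \<boxtimes> (KC \<boxplus> KCL) \<union> RES \<boxtimes> (KL \<boxplus> KCC))"

lemma K21_intros:
  "KC \<boxplus> KCL \<subseteq> K21" "KC \<boxtimes> KCL \<subseteq> K21" "KL \<boxplus> KCC \<subseteq> K21" "KL \<boxtimes> KCC \<subseteq> K21"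
  unfolding K21_def
  using fadd_superset[of RES "KC \<boxtimes> KCL", OF RESI] fpar_superset[of RES "KC \<boxplus> KCL", OF RESI]
    fadd_superset[of RES "KL \<boxtimes> KCC", OF RESI] fpar_superset[of RES "KL \<boxplus> KCC", OF RESI] by auto

lemma KCL_le_K21: "KCL \<subseteq> K21" and KCC_le_K21: "KCC \<subseteq> K21"
  using K21_intros fadd_superset[OF const_KC, of KCL] fadd_superset[OF const_KL, of KCC] by auto

lemma RES_K21: "RES \<boxplus> K21 \<subseteq> K21" "RES \<boxtimes> K21 \<subseteq> K21"
proof -
  have "RES \<boxplus> (RES \<boxtimes> (KC \<boxplus> KCL)) \<subseteq> RES \<boxtimes> (KC \<boxplus> KCL)"
    using ladder_ser[of KL KCL] by (simp add: fidK compact_K cone_K RES_KL)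
  moreover have "RES \<boxplus> (RES \<boxtimes> (KL \<boxplus> KCC)) \<subseteq> RES \<boxtimes> (KL \<boxplus> KCC)"
    using ladder_ser[of KC KLL] by (simp add: fidK fd_KLL compact_K cone_K RES_KC)
  ultimately show "RES \<boxplus> K21 \<subseteq> K21"
    unfolding K21_def lift2_Un RES_fadd_absorb by blast
  have "RES \<boxtimes> (RES \<boxplus> (KC \<boxtimes> KCL)) \<subseteq> RES \<boxplus> (KC \<boxtimes> KCL)"
    by (rule ladder_par) (simp_all add: compact_K cone_K RES_KC)
  moreover have "RES \<boxtimes> (RES \<boxplus> (KL \<boxtimes> KCC)) \<subseteq> RES \<boxplus> (KL \<boxtimes> KCC)"
    by (rule ladder_par) (simp_all add: compact_K cone_K RES_KL)
  ultimately show "RES \<boxtimes> K21 \<subseteq> K21"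
    unfolding K21_def lift2_Un RES_fpar_absorb by blast
qed

definition Kset :: "nat \<Rightarrow> nat \<Rightarrow> rfun set" where
  "Kset c l = (if l = 0 then (if c = 0 then RES else if c = 1 then KC else KCC)
     else (if c = 0 then KL else if c = 1 then KCL else K21))"

text \<open>The induction step for \<open>val_Kset\<close>: every distribution of two capacitors and
  one inductor over two subnetworks has been settled above, up to the order of the
  subnetworks.\<close>

lemma Kset_lift2:
  assumes "c + c' \<le> 2" "l + l' \<le> 1"
  shows "Kset c l \<boxplus> Kset c' l' \<subseteq> Kset (c + c') (l + l')"
    "Kset c l \<boxtimes> Kset c' l' \<subseteq> Kset (c + c') (l + l')"
proof -
  note F = RES_add_RES RES_par_RES RES_KC RES_KL RES_KCC RES_KCL RES_K21 KC_KL_le_KCL KC_KC_le_KCC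
    KC_par_KC_le K21_intros
  have "(c, c') \<in> {(0,0),(0,1),(0,2),(1,0),(1,1),(2,0)}" "(l, l') \<in> {(0,0),(0,1),(1,0)}"
    using assms by auto
  then show "Kset c l \<boxplus> Kset c' l' \<subseteq> Kset (c + c') (l + l')"
    using F fadd_comm[of KC RES] fadd_comm[of KL RES] fadd_comm[of KCC RES] fadd_comm[of KCL RES] fadd_comm[of K21 RES]
      fadd_comm[of KL KC] fadd_comm[of KCL KC] fadd_comm[of KCC KL]
    by (auto simp: Kset_def)
  show "Kset c l \<boxtimes> Kset c' l' \<subseteq> Kset (c + c') (l + l')"
    using F fpar_comm[of KC RES] fpar_comm[of KL RES] fpar_comm[of KCC RES] fpar_comm[of KCL RES] fpar_comm[of K21 RES]
      fpar_comm[of KL KC] fpar_comm[of KCL KC] fpar_comm[of KCC KL]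
      \<open>(c, c') \<in> _\<close> \<open>(l, l') \<in> _\<close>
    by (auto simp: Kset_def)
qed

lemma val_Kset:
  "num_capacitors N \<le> 2 \<Longrightarrow> num_inductors N \<le> 1 \<Longrightarrow> val N \<in> Kset (num_capacitors N) (num_inductors N)"
proof (induction N)
  case (Series M N)
  then have "val M \<in> Kset (num_capacitors M) (num_inductors M)" "val N \<in> Kset (num_capacitors N) (num_inductors N)" by auto
  then show ?case using Kset_lift2(1)[of "num_capacitors M" "num_capacitors N" "num_inductors M" "num_inductors N"] Series.prems
      faddI[of "val M" _ "val N"] by auto
next
  case (Parallel M N)
  then have "val M \<in> Kset (num_capacitors M) (num_inductors M)" "val N \<in> Kset (num_capacitors N) (num_inductors N)" by auto
  then show ?case using Kset_lift2(2)[of "num_capacitors M" "num_capacitors N" "num_inductors M" "num_inductors N"] Parallel.prems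
      fparI[of "val M" _ "val N"] by auto
next
  case (Inductor L)
  then show ?case using INDI[of "ennreal L"] IND_le_KL by (auto simp: Kset_def)
next
  case (Capacitor C)
  then show ?case using CAPI[of "ennreal C"] CAP_le_KC by (auto simp: Kset_def)
qed (auto simp: Kset_def RESI)

lemma Kset_le_K21: "c \<le> 2 \<Longrightarrow> l \<le> 1 \<Longrightarrow> Kset c l \<subseteq> K21"
  using KCL_le_K21 KCC_le_K21 KC_le_KCL KL_le_KCL RES_le_KC by (auto simp: Kset_def)

lemma val_K21: "num_capacitors N \<le> 2 \<Longrightarrow> num_inductors N \<le> 1 \<Longrightarrow> val N \<in> K21"
  using val_Kset Kset_le_K21 by blast

subsection \<open>Removing the redundant resistor\<close>

definition cub :: "real \<Rightarrow> real \<Rightarrow> real \<Rightarrow> real \<Rightarrow> real \<Rightarrow> real" where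
  "cub p0 p1 p2 p3 t = p0 + p1 * t + p2 * t\<^sup>2 + p3 * t ^ 3"

text \<open>The quadratic factor is the Horner quotient by t + x.\<close>

lemma cub_divide:
  assumes "cub p0 p1 p2 p3 (- x) = 0"
  shows "cub p0 p1 p2 p3 t = (t + x) * quad (p1 - x * (p2 - x * p3)) (p2 - x * p3) p3 t"
proof -
  have "p0 = x * (p1 - x * (p2 - x * p3))"
    using assms by (simp add: cub_def algebra_simps power2_eq_square power3_eq_cube)
  then show ?thesis by (simp add: cub_def quad_def algebra_simps power2_eq_square power3_eq_cube)
qed

text \<open>Splitting off a series resistor \<open>\<delta>\<close> and then a parallel branch \<open>(t + x) / \<kappa>\<close> from the
  bicubic \<open>p / q\<close>.\<close>

lemma cub_split:
  fixes p0 p1 p2 p3 q0 q1 q2 q3 x \<delta> \<kappa> :: real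
  defines "a2 \<equiv> p3 - \<delta> * q3"
  defines "a1 \<equiv> (p2 - \<delta> * q2) - x * a2"
  defines "a0 \<equiv> (p1 - \<delta> * q1) - x * a1"
  defines "b2 \<equiv> q3"
  defines "b1 \<equiv> (q2 - \<kappa> * a2) - x * b2"
  defines "b0 \<equiv> (q1 - \<kappa> * a1) - x * b1"
  assumes p: "cub p0 p1 p2 p3 (- x) = \<delta> * cub q0 q1 q2 q3 (- x)"
    and q: "cub q0 q1 q2 q3 (- x) = \<kappa> * quad a0 a1 a2 (- x)"
    and nz: "t + x \<noteq> 0" "cub q0 q1 q2 q3 t \<noteq> 0" "quad a0 a1 a2 t \<noteq> 0"
  shows "cub p0 p1 p2 p3 t / cub q0 q1 q2 q3 t = \<delta> + 1 / (\<kappa> / (t + x) + quad b0 b1 b2 t / quad a0 a1 a2 t)"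
proof -
  have "cub (p0 - \<delta> * q0) (p1 - \<delta> * q1) (p2 - \<delta> * q2) (p3 - \<delta> * q3) (- x) = 0"
    using p by (simp add: cub_def algebra_simps)
  from cub_divide[OF this, of t] have 1: "cub p0 p1 p2 p3 t = \<delta> * cub q0 q1 q2 q3 t + (t + x) * quad a0 a1 a2 t"
    unfolding a0_def a1_def a2_def by (simp add: cub_def algebra_simps)
  have "cub (q0 - \<kappa> * a0) (q1 - \<kappa> * a1) (q2 - \<kappa> * a2) q3 (- x) = 0"
    using q by (simp add: cub_def quad_def algebra_simps)
  from cub_divide[OF this, of t] have 2: "cub q0 q1 q2 q3 t = \<kappa> * quad a0 a1 a2 t + (t + x) * quad b0 b1 b2 t"
    unfolding b0_def b1_def b2_def by (simp add: cub_def quad_def algebra_simps)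
  have "\<kappa> / (t + x) + quad b0 b1 b2 t / quad a0 a1 a2 t = cub q0 q1 q2 q3 t / ((t + x) * quad a0 a1 a2 t)"
    unfolding 2 using nz(1,3) by (simp add: add_frac_eq mult.commute)
  then show ?thesis unfolding 1 using nz(2) by (simp add: add_divide_distrib)
qed

text \<open>The Sylvester resultant of two quadratics, with the constant coefficient first.\<close>

definition resultant2 :: "real \<Rightarrow> real \<Rightarrow> real \<Rightarrow> real \<Rightarrow> real \<Rightarrow> real \<Rightarrow> real" where
  "resultant2 a0 a1 a2 b0 b1 b2 = (a2 * b0 - a0 * b2)\<^sup>2 - (a2 * b1 - a1 * b2) * (a1 * b0 - a0 * b1)"

definition qfun :: "real \<Rightarrow> real \<Rightarrow> real \<Rightarrow> real \<Rightarrow> real \<Rightarrow> real \<Rightarrow> rfun" where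
  "qfun a0 a1 a2 b0 b1 b2 = (\<lambda>s. ennreal (quad a0 a1 a2 (pos s) / quad b0 b1 b2 (pos s)))"

text \<open>All coefficient vectors near the given one yield functions in \<open>Y\<close>. The
  sequential form accepts the limits of the perturbation argument directly.\<close>

definition stable :: "rfun set \<Rightarrow> real \<Rightarrow> real \<Rightarrow> real \<Rightarrow> real \<Rightarrow> real \<Rightarrow> real \<Rightarrow> bool" where
  "stable Y a0 a1 a2 b0 b1 b2 \<longleftrightarrow> (\<forall>A0 A1 A2 B0 B1 B2. A0 \<longlonglongrightarrow> a0 \<longrightarrow> A1 \<longlonglongrightarrow> a1 \<longrightarrow> A2 \<longlonglongrightarrow> a2 \<longrightarrow> B0 \<longlonglongrightarrow> b0 \<longrightarrow> B1 \<longlonglongrightarrow> b1 \<longrightarrow> B2 \<longlonglongrightarrow> b2 \<longrightarrow>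
       (\<forall>\<^sub>F n in sequentially. qfun (A0 n) (A1 n) (A2 n) (B0 n) (B1 n) (B2 n) \<in> Y))"

text \<open>Interior with respect to coefficient vectors, not to the topology of
  \<open>rfun\<close>. The nonzero resultant guarantees that an added branch L (s + x) raises the
  degree to three unless -x is a zero of y.\<close>

definition interior_of_class :: "rfun set \<Rightarrow> rfun \<Rightarrow> bool" where
  "interior_of_class Y y \<longleftrightarrow> (\<exists>a0 a1 a2 b0 b1 b2. a0 > 0 \<and> a1 > 0 \<and> a2 > 0 \<and> b0 > 0 \<and> b1 > 0 \<and> b2 > 0 \<and>
     y = qfun a0 a1 a2 b0 b1 b2 \<and> resultant2 a0 a1 a2 b0 b1 b2 \<noteq> 0 \<and>
     stable Y a0 a1 a2 b0 b1 b2)"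

lemma quad_pos: "a0 > 0 \<Longrightarrow> a1 > 0 \<Longrightarrow> a2 > 0 \<Longrightarrow> t > 0 \<Longrightarrow> quad a0 a1 a2 t > 0"
  unfolding quad_def by (intro add_pos_pos) auto

definition low_degree :: "rfun \<Rightarrow> bool" where
  "low_degree Z \<longleftrightarrow> (\<exists>p q :: real poly. degree p \<le> 2 \<and> degree q \<le> 2 \<and> q \<noteq> 0 \<and> (\<forall>s>0. enn2real (Z s) * poly q s = poly p s))"

text \<open>The impedance of \<open>R4 + [L (s + x) || a / b]\<close>, so R5 = L x and the inductive
  branch vanishes at -x.\<close>

definition zfun :: "real \<Rightarrow> real \<Rightarrow> real \<Rightarrow> real \<Rightarrow> real \<Rightarrow> real \<Rightarrow> real \<Rightarrow> real \<Rightarrow> real \<Rightarrow> real \<Rightarrow> real" where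
  "zfun r L x a0 a1 a2 b0 b1 b2 t = r + 1 / (1 / (L * (t + x)) + quad b0 b1 b2 t / quad a0 a1 a2 t)"

lemma zfun_frac:
  assumes "L > 0" "x \<ge> 0" "t > 0" "a0 > 0" "a1 > 0" "a2 > 0" "b0 > 0" "b1 > 0" "b2 > 0"
  shows "zfun r L x a0 a1 a2 b0 b1 b2 t =
     r + L * (t + x) * quad a0 a1 a2 t / (quad a0 a1 a2 t + L * (t + x) * quad b0 b1 b2 t)"
proof -
  have q: "quad a0 a1 a2 t > 0" "quad b0 b1 b2 t > 0" using quad_pos assms by auto
  have "L \<noteq> 0" "t + x \<noteq> 0" using assms by auto
  then have "1 / (L * (t + x)) + quad b0 b1 b2 t / quad a0 a1 a2 t =
     (quad a0 a1 a2 t + L * (t + x) * quad b0 b1 b2 t) / (L * (t + x) * quad a0 a1 a2 t)"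
    using q by (simp add: add_divide_distrib)
  then show ?thesis unfolding zfun_def by simp
qed

lemma zfun_rfun:
  assumes "r \<ge> 0" "L > 0" "x \<ge> 0" "a0 > 0" "a1 > 0" "a2 > 0" "b0 > 0" "b1 > 0" "b2 > 0"
  shows "(\<lambda>s. ennreal r + prl (ennreal (L * x) + ennreal L * ennreal (pos s)) (qfun a0 a1 a2 b0 b1 b2 s)) =
    (\<lambda>s. ennreal (zfun r L x a0 a1 a2 b0 b1 b2 (pos s)))"
proof
  fix s
  let ?t = "pos s"
  have q: "quad a0 a1 a2 ?t > 0" "quad b0 b1 b2 ?t > 0" using quad_pos assms by auto
  have l: "L * (?t + x) > 0" using assms by (intro mult_pos_pos add_pos_nonneg) auto
  have "ennreal (L * x) + ennreal L * ennreal ?t = ennreal (L * (?t + x))"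
    using assms by (simp add: ennreal_mult[symmetric] ennreal_plus[symmetric] algebra_simps del: ennreal_plus)
  then have "prl (ennreal (L * x) + ennreal L * ennreal ?t) (qfun a0 a1 a2 b0 b1 b2 s) =
     ennreal (1 / (1 / (L * (?t + x)) + quad b0 b1 b2 ?t / quad a0 a1 a2 ?t))"
    unfolding qfun_def using l q by (simp add: prl_ennreal)
  moreover have "1 / (1 / (L * (?t + x)) + quad b0 b1 b2 ?t / quad a0 a1 a2 ?t) \<ge> 0"
    using l q by (simp add: zero_le_divide_iff add_nonneg_nonneg less_imp_le)
  ultimately show "ennreal r + prl (ennreal (L * x) + ennreal L * ennreal ?t) (qfun a0 a1 a2 b0 b1 b2 s) =
     ennreal (zfun r L x a0 a1 a2 b0 b1 b2 ?t)"
    unfolding zfun_def using assms(1) by (simp only: ennreal_plus)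
qed

text \<open>The common factor s + x cancels: with a = (s + x) a' one has Z = r + L (s + x) a' / (a'
  + L b).\<close>

lemma zfun_low_degree:
  assumes "r \<ge> 0" "L > 0" "x \<ge> 0" "a0 > 0" "a1 > 0" "a2 > 0" "b0 > 0" "b1 > 0" "b2 > 0"
    and root: "quad a0 a1 a2 (- x) = 0"
  shows "low_degree (\<lambda>s. ennreal (zfun r L x a0 a1 a2 b0 b1 b2 (pos s)))"
proof -
  define a' where "a' = [:a1 - x * a2, a2:]"
  define q where "q = a' + smult L [:b0, b1, b2:]"
  define p where "p = smult r q + smult L ([:x, 1:] * a')"
  have dq: "coeff q 2 = L * b2" by (simp add: q_def a'_def numeral_2_eq_2)
  have "degree q \<le> 2" unfolding q_def a'_def by (intro degree_add_le order_trans[OF degree_smult_le]) auto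
  moreover have "q \<noteq> 0" using dq assms by (metis coeff_0 mult_pos_pos order_less_irrefl)
  moreover have "degree ([:x, 1:] * a') \<le> 2" by (rule order_trans[OF degree_mult_le]) (auto simp: a'_def)
  then have "degree p \<le> 2" unfolding p_def using \<open>degree q \<le> 2\<close>
    by (intro degree_add_le order_trans[OF degree_smult_le]) auto
  moreover have "enn2real (ennreal (zfun r L x a0 a1 a2 b0 b1 b2 (pos t))) * poly q t = poly p t" if t: "t > 0" for t
  proof -
    have pt: "pos t = t" using t by (simp add: pos_def)
    have a0: "a0 = x * (a1 - x * a2)" using root by (simp add: quad_def algebra_simps power2_eq_square)
    have a: "quad a0 a1 a2 t = (t + x) * poly a' t"
      unfolding a'_def quad_def a0 by (simp add: algebra_simps power2_eq_square)
    have q: "poly q t = poly a' t + L * quad b0 b1 b2 t" unfolding q_def quad_def by (simp add: algebra_simps power2_eq_square)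
    have p: "poly p t = r * poly q t + L * (t + x) * poly a' t" unfolding p_def by (simp add: algebra_simps)
    have tx: "t + x > 0" using t assms by simp
    have ap: "poly a' t > 0" using a tx quad_pos[of a0 a1 a2 t] assms t by (simp add: zero_less_mult_iff)
    have bp: "quad b0 b1 b2 t > 0" using quad_pos assms t by auto
    have qp: "poly q t > 0" unfolding q using ap bp assms by (intro add_pos_pos) auto
    have "zfun r L x a0 a1 a2 b0 b1 b2 t = r + L * (t + x) * ((t + x) * poly a' t) / ((t + x) * poly q t)"
      by (subst zfun_frac) (use assms t in \<open>auto simp: a q algebra_simps\<close>)
    then have z: "zfun r L x a0 a1 a2 b0 b1 b2 t = r + L * (t + x) * poly a' t / poly q t"
      using tx by simp
    moreover have "\<dots> \<ge> 0" by (intro add_nonneg_nonneg divide_nonneg_pos mult_nonneg_nonneg less_imp_le[OF tx] less_imp_le[OF assms(2)]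
       less_imp_le[OF ap] assms qp)
    ultimately have "enn2real (ennreal (zfun r L x a0 a1 a2 b0 b1 b2 t)) = r + L * (t + x) * poly a' t / poly q t"
      by simp
    then show ?thesis unfolding pt p using qp by (simp add: field_simps)
  qed
  ultimately show ?thesis unfolding low_degree_def by blast
qed

text \<open>Elimination: explicit combinations of a and b equal R s, and from this the nonzero
  constant R a0, where R is the resultant. Multiplying by w shows that a divides R a0 w.\<close>

lemma resultant2_dvd:
  assumes "resultant2 a0 a1 a2 b0 b1 b2 \<noteq> 0" "a0 > 0" and b: "[:a0, a1, a2:] dvd w * [:b0, b1, b2:]"
  shows "[:a0, a1, a2:] dvd w"
proof -
  define a b where "a = [:a0, a1, a2:]" and "b = [:b0, b1, b2:]"
  define D E F R where "D = a2 * b0 - a0 * b2" and "E = a2 * b1 - a1 * b2" and "F = a1 * b0 - a0 * b1"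
    and "R = resultant2 a0 a1 a2 b0 b1 b2"
  have R: "R = D\<^sup>2 - E * F" by (simp add: R_def resultant2_def D_def E_def F_def)
  have e: "[:0, R:] = smult D ([:0, 1:] * (smult a2 b - smult b2 a)) - smult E (smult b0 a - smult a0 b)"
    unfolding R a_def b_def by (simp add: D_def E_def F_def algebra_simps power2_eq_square)
  have ab: "a dvd w * b" "a dvd w * a" using b unfolding a_def b_def by (simp_all only: dvd_triv_right)
  have "w * [:0, R:] = smult D ([:0, 1:] * (smult a2 (w * b) - smult b2 (w * a))) - smult E (smult b0 (w * a) - smult a0 (w * b))"
    unfolding e by (simp only: right_diff_distrib mult_smult_right mult.left_commute[of w])
  then have 1: "a dvd w * [:0, R:]" by (simp only:) (intro dvd_diff dvd_smult dvd_mult ab)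
  have e2: "[:R * a0:] = smult R a - [:a1, a2:] * [:0, R:]" by (simp add: a_def algebra_simps)
  have "w * [:R * a0:] = smult R (w * a) - [:a1, a2:] * (w * [:0, R:])"
    unfolding e2 by (simp only: right_diff_distrib mult_smult_right mult.left_commute[of w])
  then have "a dvd w * [:R * a0:]" by (simp only:) (intro dvd_diff dvd_smult dvd_mult ab 1)
  then have "a dvd smult (R * a0) w" by (simp add: mult.commute)
  then show ?thesis using assms by (simp add: dvd_smult_iff R_def a_def)
qed

text \<open>If Z - r = p' / q, then L (s + x) a q = p' (a + L (s + x) b). At -x this shows p' = (s +
  x) p2, and after cancellation the resultant gives that a divides p2 (s + x). By degree this
  product is a constant multiple of a, and the constant is 0 because a does not vanish at
  -x.\<close>

lemma zfun_full_degree: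
  assumes "r \<ge> 0" "L > 0" "x \<ge> 0" "a0 > 0" "a1 > 0" "a2 > 0" "b0 > 0" "b1 > 0" "b2 > 0"
    and root: "quad a0 a1 a2 (- x) \<noteq> 0" and res: "resultant2 a0 a1 a2 b0 b1 b2 \<noteq> 0"
  shows "\<not> low_degree (\<lambda>s. ennreal (zfun r L x a0 a1 a2 b0 b1 b2 (pos s)))"
proof
  assume "low_degree (\<lambda>s. ennreal (zfun r L x a0 a1 a2 b0 b1 b2 (pos s)))"
  then obtain p q :: "real poly" where d: "degree p \<le> 2" "degree q \<le> 2" "q \<noteq> 0"
    and e: "\<And>s. s > 0 \<Longrightarrow> enn2real (ennreal (zfun r L x a0 a1 a2 b0 b1 b2 (pos s))) * poly q s = poly p s"
    unfolding low_degree_def by blast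
  define a b where "a = [:a0, a1, a2:]" and "b = [:b0, b1, b2:]"
  define p' where "p' = p - smult r q"
  have pa: "poly a t = quad a0 a1 a2 t" "poly b t = quad b0 b1 b2 t" for t
    by (simp_all add: a_def b_def quad_def algebra_simps power2_eq_square)
  have id: "poly (smult L ([:x, 1:] * a * q)) t = poly (p' * (a + smult L ([:x, 1:] * b))) t" if t: "t > 0" for t
  proof -
    have pt: "pos t = t" using t by (simp add: pos_def)
    define D where "D = quad a0 a1 a2 t + L * (t + x) * quad b0 b1 b2 t"
    have q: "quad a0 a1 a2 t > 0" "quad b0 b1 b2 t > 0" using quad_pos assms t by auto
    have tx: "t + x > 0" using t assms by simp
    have "D > 0" unfolding D_def by (intro add_pos_pos mult_pos_pos q tx assms)
    have z: "zfun r L x a0 a1 a2 b0 b1 b2 t = r + L * (t + x) * quad a0 a1 a2 t / D"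
      unfolding D_def by (rule zfun_frac) (use assms t in auto)
    moreover have "\<dots> \<ge> 0" by (intro add_nonneg_nonneg divide_nonneg_pos mult_nonneg_nonneg less_imp_le[OF tx] less_imp_le[OF assms(2)]
       less_imp_le[OF q(1)] assms \<open>D > 0\<close>)
    ultimately have "(r + L * (t + x) * quad a0 a1 a2 t / D) * poly q t = poly p t"
      using e[OF t] unfolding pt by simp
    then have "L * (t + x) * quad a0 a1 a2 t * poly q t = (poly p t - r * poly q t) * D"
      using \<open>D > 0\<close> by (simp add: field_simps)
    then show ?thesis unfolding p'_def D_def by (simp add: pa algebra_simps)
  qed
  have eq: "smult L ([:x, 1:] * a * q) = p' * (a + smult L ([:x, 1:] * b))"
  proof (rule ccontr)
    assume ne: "\<not> ?thesis"
    have "{0<..} \<subseteq> {t. poly (smult L ([:x, 1:] * a * q) - p' * (a + smult L ([:x, 1:] * b))) t = 0}"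
      using id by auto
    moreover have "finite {t. poly (smult L ([:x, 1:] * a * q) - p' * (a + smult L ([:x, 1:] * b))) t = 0}"
      by (rule poly_roots_finite) (use ne in simp)
    ultimately show False using infinite_Ioi[of "0::real"] finite_subset by blast
  qed
  have "poly (p' * (a + smult L ([:x, 1:] * b))) (- x) = 0" unfolding eq[symmetric] by simp
  then have "poly p' (- x) = 0" using root by (simp add: pa)
  then have "[:x, 1:] dvd p'" using poly_eq_0_iff_dvd[of p' "- x"] by simp
  then obtain p2 where p2: "p' = [:x, 1:] * p2" by (rule dvdE)
  have "[:x, 1:] * smult L (a * q) = [:x, 1:] * (p2 * (a + smult L ([:x, 1:] * b)))"
    using eq unfolding p2 by (simp only: mult_smult_right mult.assoc)
  then have eq2: "smult L (a * q) = p2 * (a + smult L ([:x, 1:] * b))"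
    by (subst (asm) mult_cancel_left) simp
  have "a dvd p2 * (a + smult L ([:x, 1:] * b))" unfolding eq2[symmetric] by (simp add: dvd_smult)
  then have "a dvd p2 * (a + smult L ([:x, 1:] * b)) - p2 * a" by (rule dvd_diff[OF _ dvd_triv_right])
  then have "a dvd smult L (p2 * [:x, 1:] * b)"
    by (simp only: distrib_left mult_smult_right mult.assoc add_diff_cancel_left')
  then have "a dvd p2 * [:x, 1:] * b" using assms(2) by (simp add: dvd_smult_iff)
  then have ax: "a dvd p2 * [:x, 1:]" unfolding a_def b_def by (rule resultant2_dvd[OF res assms(4)])
  have "degree p' \<le> 2" unfolding p'_def by (intro degree_diff_le d order_trans[OF degree_smult_le])
  have "p2 = 0"
  proof (rule ccontr)
    assume "p2 \<noteq> 0"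
    then have "degree p' = degree p2 + 1" unfolding p2 by (subst degree_mult_eq) auto
    then have dp: "degree p2 \<le> 1" using \<open>degree p' \<le> 2\<close> by simp
    have da: "degree a = 2" using assms by (simp add: a_def)
    have ne: "p2 * [:x, 1:] \<noteq> 0" using \<open>p2 \<noteq> 0\<close> unfolding mult_eq_0_iff by simp
    obtain k where k: "p2 * [:x, 1:] = a * k" using ax by (rule dvdE)
    then have "k \<noteq> 0" using ne by auto
    have "degree (p2 * [:x, 1:]) = degree p2 + 1" using \<open>p2 \<noteq> 0\<close> by (subst degree_mult_eq) auto
    moreover have "degree (a * k) = 2 + degree k" using \<open>k \<noteq> 0\<close> da by (subst degree_mult_eq) auto
    ultimately have "degree k = 0" using k dp by simp
    then obtain c where c: "k = [:c:]" by (rule degree_eq_zeroE)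
    have "poly (a * k) (- x) = 0" unfolding k[symmetric] by simp
    then have "c = 0" using root by (simp add: c pa)
    then show False using \<open>k \<noteq> 0\<close> c by simp
  qed
  then have "a * q = 0" using eq2 assms(2) by simp
  then show False using d(3) assms unfolding a_def mult_eq_0_iff by simp
qed

text \<open>Moving the zero \<open>-x\<close> of \<open>Z - R\<^sub>4\<close> slightly to the right increases \<open>R\<^sub>4\<close>.\<close>

lemma perturb:
  assumes r: "r \<ge> 0" "L > 0" "x > 0" and pos: "a0 > 0" "a1 > 0" "a2 > 0" "b0 > 0" "b1 > 0" "b2 > 0"
    and root: "quad a0 a1 a2 (- x) \<noteq> 0"
    and nbh: "stable Y a0 a1 a2 b0 b1 b2"
  obtains r' L' x' a0' a1' a2' b0' b1' b2' where "r' > r" "L' > 0" "x' \<ge> 0"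
    "a0' > 0" "a1' > 0" "a2' > 0" "b0' > 0" "b1' > 0" "b2' > 0" "qfun a0' a1' a2' b0' b1' b2' \<in> Y"
    "\<And>t. t > 0 \<Longrightarrow> zfun r L x a0 a1 a2 b0 b1 b2 t = zfun r' L' x' a0' a1' a2' b0' b1' b2' t"
proof -
  \<comment> \<open>p / q is Z - r.\<close>
  define p0 p1 p2 p3 where "p0 = L * x * a0" and "p1 = L * (a0 + x * a1)" and "p2 = L * (a1 + x * a2)" and "p3 = L * a2"
  define q0 q1 q2 q3 where "q0 = a0 + L * x * b0" and "q1 = a1 + L * (b0 + x * b1)" and "q2 = a2 + L * (b1 + x * b2)" and "q3 = L * b2"
  have cp: "cub p0 p1 p2 p3 t = L * (t + x) * quad a0 a1 a2 t" for t
    by (simp add: cub_def quad_def p0_def p1_def p2_def p3_def algebra_simps power2_eq_square power3_eq_cube)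
  have cq: "cub q0 q1 q2 q3 t = quad a0 a1 a2 t + L * (t + x) * quad b0 b1 b2 t" for t
    by (simp add: cub_def quad_def q0_def q1_def q2_def q3_def algebra_simps power2_eq_square power3_eq_cube)
  define X where "X n = x - x / real (Suc (Suc n))" for n
  have Xlim: "X \<longlonglongrightarrow> x"
  proof -
    have "(\<lambda>n. x - x * (1 / real (Suc (Suc n)))) \<longlonglongrightarrow> x - x * 0"
      by (intro tendsto_diff tendsto_mult tendsto_const LIMSEQ_Suc[OF LIMSEQ_Suc[OF lim_1_over_n]])
    then show ?thesis by (simp add: X_def[abs_def])
  qed
  have X: "X n < x" "X n \<ge> 0" for n using r(3) by (simp_all add: X_def field_simps)
  define al be where "al n = quad a0 a1 a2 (- X n)" and "be n = cub q0 q1 q2 q3 (- X n)" for n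
  \<comment> \<open>The value of Z - r at -X n, by which the series resistance grows. The limits of
    \<open>al\<close> and \<open>be\<close> agree because the second summand of q vanishes at -x; so
    \<open>D n\<close> tends to 0 and is eventually positive.\<close>
  define D where "D n = L * (x - X n) * al n / be n" for n
  have al: "al \<longlonglongrightarrow> quad a0 a1 a2 (- x)"
    unfolding al_def quad_def by (intro tendsto_intros Xlim)
  have be: "be \<longlonglongrightarrow> quad a0 a1 a2 (- x)"
  proof -
    have "be \<longlonglongrightarrow> cub q0 q1 q2 q3 (- x)" unfolding be_def cub_def by (intro tendsto_intros Xlim)
    then show ?thesis by (simp add: cq)
  qed
  have D: "D \<longlonglongrightarrow> 0"
  proof -
    have "D \<longlonglongrightarrow> L * (x - x) * quad a0 a1 a2 (- x) / quad a0 a1 a2 (- x)"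
      unfolding D_def by (intro tendsto_intros Xlim al be root)
    then show ?thesis by simp
  qed
  define A2 where "A2 n = p3 - D n * q3" for n
  define A1 where "A1 n = (p2 - D n * q2) - X n * A2 n" for n
  define A0 where "A0 n = (p1 - D n * q1) - X n * A1 n" for n
  have "A2 \<longlonglongrightarrow> p3 - 0 * q3" unfolding A2_def by (intro tendsto_intros D)
  then have A2: "A2 \<longlonglongrightarrow> L * a2" by (simp add: p3_def)
  have "A1 \<longlonglongrightarrow> (p2 - 0 * q2) - x * (L * a2)" unfolding A1_def by (intro tendsto_intros D Xlim A2)
  then have A1: "A1 \<longlonglongrightarrow> L * a1" by (simp add: p2_def algebra_simps)
  have "A0 \<longlonglongrightarrow> (p1 - 0 * q1) - x * (L * a1)" unfolding A0_def by (intro tendsto_intros D Xlim A1)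
  then have A0: "A0 \<longlonglongrightarrow> L * a0" by (simp add: p1_def algebra_simps)
  define ga where "ga n = quad (A0 n) (A1 n) (A2 n) (- X n)" for n
  have "ga \<longlonglongrightarrow> quad (L * a0) (L * a1) (L * a2) (- x)"
    unfolding ga_def quad_def by (intro tendsto_intros Xlim A0 A1 A2)
  also have "quad (L * a0) (L * a1) (L * a2) (- x) = L * quad a0 a1 a2 (- x)" by (simp add: quad_def algebra_simps)
  finally have ga: "ga \<longlonglongrightarrow> L * quad a0 a1 a2 (- x)" .
  have ga0: "L * quad a0 a1 a2 (- x) \<noteq> 0" using root r by simp
  \<comment> \<open>Chosen such that q - K A vanishes at -X n and the next division by t + X n is
    exact; 1 / K is the new inductance.\<close>
  define K where "K n = be n / ga n" for n
  have "K \<longlonglongrightarrow> quad a0 a1 a2 (- x) / (L * quad a0 a1 a2 (- x))"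
    unfolding K_def by (intro tendsto_intros be ga ga0)
  then have K: "K \<longlonglongrightarrow> 1 / L" using root by simp
  define B2 where "B2 n = q3" for n :: nat
  define B1 where "B1 n = (q2 - K n * A2 n) - X n * B2 n" for n
  define B0 where "B0 n = (q1 - K n * A1 n) - X n * B1 n" for n
  have B2: "B2 \<longlonglongrightarrow> L * b2" by (simp add: B2_def[abs_def] q3_def)
  have "B1 \<longlonglongrightarrow> (q2 - 1 / L * (L * a2)) - x * (L * b2)" unfolding B1_def by (intro tendsto_intros Xlim K A2 B2)
  then have B1: "B1 \<longlonglongrightarrow> L * b1" using r by (simp add: q2_def algebra_simps)
  have "B0 \<longlonglongrightarrow> (q1 - 1 / L * (L * a1)) - x * (L * b1)" unfolding B0_def by (intro tendsto_intros Xlim K A1 B1)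
  then have B0: "B0 \<longlonglongrightarrow> L * b0" using r by (simp add: q1_def algebra_simps)
  \<comment> \<open>All six coefficients converge to L times the old ones, so they are divided by L
    before stability is applied.\<close>
  have scale: "(\<lambda>n. c n / L) \<longlonglongrightarrow> u" if "c \<longlonglongrightarrow> L * u" for c u
    using tendsto_divide[OF that tendsto_const[of L]] r by simp
  have ev1: "\<forall>\<^sub>F n in sequentially. c n > 0" if "c \<longlonglongrightarrow> L * u" "u > 0" for c u
    using order_tendstoD(1)[OF that(1), of 0] that(2) r by simp
  have "\<forall>\<^sub>F n in sequentially. qfun (A0 n / L) (A1 n / L) (A2 n / L) (B0 n / L) (B1 n / L) (B2 n / L) \<in> Y"
    by (intro nbh[unfolded stable_def, rule_format] scale A0 A1 A2 B0 B1 B2)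
  moreover have "\<forall>\<^sub>F n in sequentially. K n > 0" using order_tendstoD(1)[OF K, of 0] r by simp
  moreover have "\<forall>\<^sub>F n in sequentially. be n \<noteq> 0" using be root by (rule tendsto_imp_eventually_ne)
  moreover have "\<forall>\<^sub>F n in sequentially. ga n \<noteq> 0" using ga ga0 by (rule tendsto_imp_eventually_ne)
  moreover have "\<forall>\<^sub>F n in sequentially. al n / be n > 0"
    using order_tendstoD(1)[OF tendsto_divide[OF al be root], of 0] root by simp
  ultimately have "\<forall>\<^sub>F n in sequentially. qfun (A0 n / L) (A1 n / L) (A2 n / L) (B0 n / L) (B1 n / L) (B2 n / L) \<in> Y \<and>
     K n > 0 \<and> be n \<noteq> 0 \<and> ga n \<noteq> 0 \<and> al n / be n > 0 \<and> A0 n > 0 \<and> A1 n > 0 \<and> A2 n > 0 \<and> B0 n > 0 \<and> B1 n > 0 \<and> B2 n > 0"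
    using ev1[OF A0 pos(1)] ev1[OF A1 pos(2)] ev1[OF A2 pos(3)] ev1[OF B0 pos(4)] ev1[OF B1 pos(5)] ev1[OF B2 pos(6)]
    by eventually_elim simp
  then obtain n where n: "qfun (A0 n / L) (A1 n / L) (A2 n / L) (B0 n / L) (B1 n / L) (B2 n / L) \<in> Y"
     "K n > 0" "be n \<noteq> 0" "ga n \<noteq> 0" "al n / be n > 0" and An: "A0 n > 0" "A1 n > 0" "A2 n > 0" and Bn: "B0 n > 0" "B1 n > 0" "B2 n > 0"
    unfolding eventually_sequentially by blast
  have "L * (x - X n) * (al n / be n) > 0" using n(5) X[of n] r by (intro mult_pos_pos) auto
  then have Dn: "D n > 0" by (simp add: D_def)
  have id: "zfun r L x a0 a1 a2 b0 b1 b2 t = zfun (r + D n) (1 / K n) (X n) (A0 n / L) (A1 n / L) (A2 n / L) (B0 n / L) (B1 n / L) (B2 n / L) t"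
    if t: "t > 0" for t
  proof -
    have 1: "cub p0 p1 p2 p3 (- X n) = D n * cub q0 q1 q2 q3 (- X n)"
      using n(3) unfolding cp by (simp add: D_def al_def be_def)
    have 2: "cub q0 q1 q2 q3 (- X n) = K n * quad (A0 n) (A1 n) (A2 n) (- X n)"
      using n(4) unfolding K_def by (simp add: ga_def be_def)
    have q: "quad a0 a1 a2 t > 0" "quad b0 b1 b2 t > 0" using quad_pos pos t by auto
    have "cub q0 q1 q2 q3 t > 0" unfolding cq using q r t by (intro add_pos_pos mult_pos_pos) auto
    moreover have "quad (A0 n) (A1 n) (A2 n) t > 0" using quad_pos An t by auto
    moreover have "t + X n > 0" using X[of n] t by simp
    ultimately have "cub p0 p1 p2 p3 t / cub q0 q1 q2 q3 t =
      D n + 1 / (K n / (t + X n) + quad (B0 n) (B1 n) (B2 n) t / quad (A0 n) (A1 n) (A2 n) t)"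
      using cub_split[of p0 p1 p2 p3 "X n" "D n" q0 q1 q2 q3 "K n" t, folded A2_def B2_def[of n]] 1 2
      unfolding A0_def A1_def A2_def B0_def B1_def B2_def by simp
    moreover have "zfun r L x a0 a1 a2 b0 b1 b2 t = r + cub p0 p1 p2 p3 t / cub q0 q1 q2 q3 t"
      unfolding cp cq by (rule zfun_frac) (use r pos t in auto)
    moreover have "quad (B0 n / L) (B1 n / L) (B2 n / L) t / quad (A0 n / L) (A1 n / L) (A2 n / L) t =
       quad (B0 n) (B1 n) (B2 n) t / quad (A0 n) (A1 n) (A2 n) t"
    proof -
      have "quad (u / L) (v / L) (w / L) t = quad u v w t / L" for u v w
        by (simp add: quad_def add_divide_distrib)
      then show ?thesis using r by simp
    qed
    ultimately show ?thesis unfolding zfun_def by simp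
  qed
  show ?thesis
    by (rule that[of "r + D n" "1 / K n" "X n", OF _ _ _ _ _ _ _ _ _ n(1) id]) (use Dn n X[of n] An Bn r in auto)
qed

lemma RES_fadd_parE:
  assumes "Z \<in> RES \<boxplus> (A \<boxtimes> B)"
  shows "\<exists>k X y. X \<in> A \<and> y \<in> B \<and> Z = (\<lambda>s. k + prl (X s) (y s))"
proof -
  obtain f g where f: "f \<in> RES" "g \<in> A \<boxtimes> B" "Z = (\<lambda>s. f s + g s)"
    using assms lift2_iff[of Z "(+)" RES "A \<boxtimes> B"] by blast
  obtain k where k: "f = (\<lambda>s. k)" using f(1) by (auto simp: RES_def)
  obtain X y where "X \<in> A" "y \<in> B" "g = (\<lambda>s. prl (X s) (y s))"
    using f(2) lift2_iff[of g prl A B] by blast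
  then show ?thesis using f(3) unfolding k by blast
qed

lemma ennreal_posE: assumes "k \<noteq> 0" "k \<noteq> top" obtains r where "k = ennreal r" "r > 0"
  using assms by (cases k rule: ennreal_cases) (auto simp: less_le)

text \<open>Degenerate values of k, R5 or L, and functions y on a face, lead into \<open>G\<close>.
  What remains are finite values with R5 and L positive, written with x = R5 / L, which is the
  situation of \<open>perturb\<close>.\<close>

lemma three_storage_cases:
  assumes cY: "compact Y" and cG: "closed G" and RG: "RES \<subseteq> G"
    and ind: "RES \<boxplus> (IND \<boxtimes> Y) \<subseteq> G" and res: "RES \<boxplus> (RES \<boxtimes> Y) \<subseteq> G"
    and face: "\<And>y. y \<in> Y \<Longrightarrow> RES \<boxplus> ((RES \<boxplus> IND) \<boxtimes> {y}) \<subseteq> G \<or> interior_of_class Y y"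
    and X: "X \<in> RES \<boxplus> IND" and y: "y \<in> Y"
  shows "(\<lambda>s. k + prl (X s) (y s)) \<in> G \<or>
      (\<exists>r L x. r \<ge> 0 \<and> L > 0 \<and> x > 0 \<and> k = ennreal r \<and> X = (\<lambda>s. ennreal (L * x) + ennreal L * ennreal (pos s)) \<and> interior_of_class Y y)"
  proof -
    obtain R5 L where XX: "X = (\<lambda>s. R5 + L * ennreal (pos s))" using X by (auto simp: lift2_def RES_def IND_def)
    have const: "(\<lambda>s. k + prl c (y s)) \<in> G" for c using faddI[OF RESI fparI[OF RESI y]] res by blast
    show ?thesis
    proof (cases "k = top \<or> L = 0 \<or> L = top \<or> R5 = top \<or> R5 = 0 \<or> \<not> interior_of_class Y y")
      case True
      then consider "k = top" | "L = 0 \<or> L = top \<or> R5 = top" | "R5 = 0" | "RES \<boxplus> ((RES \<boxplus> IND) \<boxtimes> {y}) \<subseteq> G"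
        using face[OF y] by blast
      then have "(\<lambda>s. k + prl (X s) (y s)) \<in> G"
      proof cases
        case 1 then show ?thesis using RG RESI by auto
      next
        case 2
        then have "X = (\<lambda>s. R5) \<or> X = (\<lambda>s. top)" unfolding XX by (auto simp: ennreal_top_mult)
        then show ?thesis using const by auto
      next
        case 3
        then have "X \<in> IND" unfolding XX using INDI by simp
        then show ?thesis using faddI[OF RESI fparI[OF _ y]] ind by blast
      next
        case 4
        then show ?thesis using faddI[OF RESI[of k] fparI[OF X, of y "{y}"]] by auto
      qed
      then show ?thesis ..
    next
      case False
      then obtain l R where p: "L = ennreal l" "l > 0" "R5 = ennreal R" "R > 0" by (metis ennreal_posE)
      obtain r where r: "k = ennreal r" "r \<ge> 0" using False by (cases k rule: ennreal_cases) auto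
      have "l * (R / l) = R" "R / l > 0" using p by auto
      then show ?thesis using False p r unfolding XX by metis
    qed
  qed

text \<open>A realization with the largest possible \<open>R\<^sub>4\<close> exists by compactness; by the perturbation above it is not an interior one.\<close>

lemma three_storage_full:
  assumes cY: "compact Y" and cG: "closed G" and RG: "RES \<subseteq> G"
    and ind: "RES \<boxplus> (IND \<boxtimes> Y) \<subseteq> G" and res: "RES \<boxplus> (RES \<boxtimes> Y) \<subseteq> G"
    and face: "\<And>y. y \<in> Y \<Longrightarrow> RES \<boxplus> ((RES \<boxplus> IND) \<boxtimes> {y}) \<subseteq> G \<or> interior_of_class Y y"
    and Z: "Z \<in> RES \<boxplus> ((RES \<boxplus> IND) \<boxtimes> Y)" and nl: "\<not> low_degree Z"
  shows "Z \<in> G"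
  proof (rule ccontr)
    assume ZG: "Z \<notin> G"
    define m :: "ennreal \<times> rfun \<times> rfun \<Rightarrow> rfun" where "m = (\<lambda>p s. fst p + prl (fst (snd p) s) (snd (snd p) s))"
    \<comment> \<open>The set of all realizations of Z, with R4 as first component.\<close>
    define S where "S = (UNIV \<times> (RES \<boxplus> IND) \<times> Y) \<inter> (m -` {Z})"
    have cm: "continuous_on UNIV m"
    proof -
      have "continuous_on UNIV (\<lambda>p::ennreal \<times> rfun \<times> rfun. fst (snd p) s)" for s
        by (rule continuous_on_product_then_coordinatewise[OF continuous_on_fst[OF continuous_on_snd[OF continuous_on_id]]])
      moreover have "continuous_on UNIV (\<lambda>p::ennreal \<times> rfun \<times> rfun. snd (snd p) s)" for s
        by (rule continuous_on_product_then_coordinatewise[OF continuous_on_snd[OF continuous_on_snd[OF continuous_on_id]]])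
      ultimately show ?thesis unfolding m_def
        by (intro continuous_on_coordinatewise_then_product)
          (rule continuous_on_add[OF continuous_on_fst[OF continuous_on_id] continuous_prl])
    qed
    have "closed {Z}" by (rule closed_compact) simp
    then have "closed (m -` {Z})" using cm by (rule closed_vimage)
    then have "compact S" unfolding S_def by (intro compact_Int_closed compact_Times compact_UNIV compact_sets cY)
    moreover obtain k X y where "X \<in> RES \<boxplus> IND" "y \<in> Y" "Z = (\<lambda>s. k + prl (X s) (y s))"
      using Z RES_fadd_parE by blast
    then have "(k, X, y) \<in> S" by (simp add: S_def m_def)
    then have "S \<noteq> {}" by blast
    ultimately obtain P where P: "P \<in> S" "\<And>Q. Q \<in> S \<Longrightarrow> fst Q \<le> fst P"
      using continuous_attains_sup[of S fst, OF _ _ continuous_on_fst[OF continuous_on_id]] by blast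
    obtain k X y where Pe: "P = (k, X, y)" by (cases P)
    have kX: "X \<in> RES \<boxplus> IND" "y \<in> Y" "Z = (\<lambda>s. k + prl (X s) (y s))" using P(1) unfolding Pe S_def by (simp_all add: m_def)
    have "(\<lambda>s. k + prl (X s) (y s)) \<notin> G" using ZG kX(3) by simp
    with three_storage_cases[OF assms(1-6) kX(1,2), of k] obtain r L x where p: "r \<ge> 0" "L > 0" "x > 0" "k = ennreal r"
      "X = (\<lambda>s. ennreal (L * x) + ennreal L * ennreal (pos s))" and int: "interior_of_class Y y" by blast
    from int obtain a0 a1 a2 b0 b1 b2 where q: "a0 > 0" "a1 > 0" "a2 > 0" "b0 > 0" "b1 > 0" "b2 > 0"
      and ye: "y = qfun a0 a1 a2 b0 b1 b2"
      and nbh: "stable Y a0 a1 a2 b0 b1 b2"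
      unfolding interior_of_class_def by blast
    have Ze: "Z = (\<lambda>s. ennreal (zfun r L x a0 a1 a2 b0 b1 b2 (pos s)))"
      unfolding kX(3) p(4,5) ye by (rule zfun_rfun) (use p q in auto)
    have root: "quad a0 a1 a2 (- x) \<noteq> 0"
      using zfun_low_degree[OF p(1,2) less_imp_le[OF p(3)] q] nl unfolding Ze by blast
    obtain r' L' x' a0' a1' a2' b0' b1' b2' where p': "r' > r" "L' > 0" "x' \<ge> 0"
      "a0' > 0" "a1' > 0" "a2' > 0" "b0' > 0" "b1' > 0" "b2' > 0" and Y': "qfun a0' a1' a2' b0' b1' b2' \<in> Y"
      and eq: "\<And>t. t > 0 \<Longrightarrow> zfun r L x a0 a1 a2 b0 b1 b2 t = zfun r' L' x' a0' a1' a2' b0' b1' b2' t"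
      by (rule perturb[OF p(1-3) q root nbh]) (rule that; assumption)
    define X' where "X' = (\<lambda>s. ennreal (L' * x') + ennreal L' * ennreal (pos s))"
    have "Z = (\<lambda>s. ennreal (zfun r' L' x' a0' a1' a2' b0' b1' b2' (pos s)))"
      unfolding Ze by (rule ext) (simp add: eq)
    also have "\<dots> = (\<lambda>s. ennreal r' + prl (X' s) (qfun a0' a1' a2' b0' b1' b2' s))"
      unfolding X'_def by (rule zfun_rfun[symmetric]) (use p p' in auto)
    finally have "m (ennreal r', X', qfun a0' a1' a2' b0' b1' b2') = Z" by (simp add: m_def)
    moreover have "X' \<in> RES \<boxplus> IND" unfolding X'_def by (intro faddI RESI INDI)
    ultimately have "(ennreal r', X', qfun a0' a1' a2' b0' b1' b2') \<in> S"
      unfolding S_def using Y' by simp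
    from P(2)[OF this] show False using p'(1) p(1) unfolding Pe p(4) by simp
  qed

text \<open>Impedances of low degree are limits of impedances of degree three.\<close>

lemma three_storage_max:
  assumes cY: "compact Y" and cG: "closed G" and RG: "RES \<subseteq> G"
    and ind: "RES \<boxplus> (IND \<boxtimes> Y) \<subseteq> G" and res: "RES \<boxplus> (RES \<boxtimes> Y) \<subseteq> G"
    and face: "\<And>y. y \<in> Y \<Longrightarrow> RES \<boxplus> ((RES \<boxplus> IND) \<boxtimes> {y}) \<subseteq> G \<or> interior_of_class Y y"
  shows "RES \<boxplus> ((RES \<boxplus> IND) \<boxtimes> Y) \<subseteq> G"
  proof
    fix Z assume Z: "Z \<in> RES \<boxplus> ((RES \<boxplus> IND) \<boxtimes> Y)"
    then obtain k X y where kX: "X \<in> RES \<boxplus> IND" "y \<in> Y" "Z = (\<lambda>s. k + prl (X s) (y s))"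
      using RES_fadd_parE by blast
    show "Z \<in> G"
    proof (rule ccontr)
      assume ZG: "Z \<notin> G"
      have "(\<lambda>s. k + prl (X s) (y s)) \<notin> G" using ZG kX(3) by simp
    with three_storage_cases[OF assms(1-6) kX(1,2), of k] obtain r L x where p: "r \<ge> 0" "L > 0" "x > 0" "k = ennreal r"
        "X = (\<lambda>s. ennreal (L * x) + ennreal L * ennreal (pos s))" and int: "interior_of_class Y y" by blast
      from int obtain a0 a1 a2 b0 b1 b2 where q: "a0 > 0" "a1 > 0" "a2 > 0" "b0 > 0" "b1 > 0" "b2 > 0"
        and ye: "y = qfun a0 a1 a2 b0 b1 b2" and re: "resultant2 a0 a1 a2 b0 b1 b2 \<noteq> 0"
        unfolding interior_of_class_def by blast
      \<comment> \<open>Moving the zero leaves y and its resultant unchanged. Only finitely many of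
        the points -X n are zeros of the numerator of y; all others give degree three.\<close>
      define X where "X n = x + 1 / real (Suc n)" for n
      define z where "z n = (\<lambda>s. ennreal (zfun r L (X n) a0 a1 a2 b0 b1 b2 (pos s)))" for n
      have Ze: "Z = (\<lambda>s. ennreal (zfun r L x a0 a1 a2 b0 b1 b2 (pos s)))"
        unfolding kX(3) p(4,5) ye by (rule zfun_rfun) (use p q in auto)
      have Xp: "X n > 0" for n using p by (auto simp: X_def intro: add_pos_pos)
      have zG: "z n \<in> G" if nr: "quad a0 a1 a2 (- X n) \<noteq> 0" for n
      proof (rule three_storage_full[OF assms])
        have "z n = (\<lambda>s. ennreal r + prl (ennreal (L * X n) + ennreal L * ennreal (pos s)) (y s))"
          unfolding z_def ye by (rule zfun_rfun[symmetric]) (use p q Xp[of n] in auto)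
        then show "z n \<in> RES \<boxplus> ((RES \<boxplus> IND) \<boxtimes> Y)"
          by (simp only:) (intro faddI fparI RESI INDI kX)
        show "\<not> low_degree (z n)" unfolding z_def
          by (rule zfun_full_degree) (use p q Xp[of n] nr re in auto)
      qed
      have "quad a0 a1 a2 = poly [:a0, a1, a2:]" by (rule ext) (simp add: quad_def algebra_simps power2_eq_square)
      then have "finite {t. quad a0 a1 a2 t = 0}" using poly_roots_finite[of "[:a0, a1, a2:]"] q by simp
      moreover have "inj (\<lambda>n. - X n)" by (auto simp: inj_def X_def)
      ultimately have "finite ((\<lambda>n. - X n) -` {t. quad a0 a1 a2 t = 0})" by (rule finite_vimageI)
      then have "finite {n. quad a0 a1 a2 (- X n) = 0}" by (simp add: vimage_def)
      then obtain N where N: "\<And>n. n \<ge> N \<Longrightarrow> quad a0 a1 a2 (- X n) \<noteq> 0"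
        by (metis (mono_tags, lifting) finite_nat_set_iff_bounded mem_Collect_eq not_le)
      have Xl: "X \<longlonglongrightarrow> x" unfolding X_def by (rule tendsto_add_inverse)
      have "Z \<in> G"
      proof (rule closed_limit[OF cG])
        show "z (n + N) \<in> G" for n by (rule zG[OF N]) simp
        show "(\<lambda>n. z (n + N) s) \<longlonglongrightarrow> Z s" for s
        proof (rule LIMSEQ_ignore_initial_segment)
          have qp: "quad a0 a1 a2 (pos s) > 0" "quad b0 b1 b2 (pos s) > 0" using quad_pos q by auto
          have l: "L * (pos s + x) > 0" using p by (intro mult_pos_pos add_pos_pos) auto
          then have "1 / (L * (pos s + x)) + quad b0 b1 b2 (pos s) / quad a0 a1 a2 (pos s) > 0"
            using qp by (intro add_pos_pos) auto
          then show "(\<lambda>n. z n s) \<longlonglongrightarrow> Z s" unfolding Ze z_def zfun_def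
            by (intro tendsto_ennrealI tendsto_intros Xl) (use l qp in auto)
        qed
      qed
      then show False using ZG by simp
    qed
  qed

section \<open>Interior points of the two-storage classes\<close>

lemma qfun_fi: "fi (qfun a0 a1 a2 b0 b1 b2) = qfun a2 a1 a0 b2 b1 b0"
  by (simp add: fi_def qfun_def pos_inverse quad_inverse)

lemma qfun_fd: "a0 > 0 \<Longrightarrow> a1 > 0 \<Longrightarrow> a2 > 0 \<Longrightarrow> b0 > 0 \<Longrightarrow> b1 > 0 \<Longrightarrow> b2 > 0 \<Longrightarrow>
  fd (qfun a0 a1 a2 b0 b1 b2) = qfun b0 b1 b2 a0 a1 a2"
  by (simp add: fd_def qfun_def inverse_ennreal quad_pos)

lemma interior_fi: "interior_of_class Y y \<Longrightarrow> interior_of_class (fi ` Y) (fi y)"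
proof -
  assume "interior_of_class Y y"
  then obtain a0 a1 a2 b0 b1 b2 where q: "a0 > 0" "a1 > 0" "a2 > 0" "b0 > 0" "b1 > 0" "b2 > 0"
    and y: "y = qfun a0 a1 a2 b0 b1 b2" and re: "resultant2 a0 a1 a2 b0 b1 b2 \<noteq> 0"
    and nbh: "stable Y a0 a1 a2 b0 b1 b2"
    unfolding interior_of_class_def by blast
  have im: "z \<in> fi ` Y" if "fi z \<in> Y" for z using imageI[OF that, of fi] by simp
  show ?thesis
    unfolding interior_of_class_def stable_def
  proof (intro exI conjI allI impI)
    show "fi y = qfun a2 a1 a0 b2 b1 b0" by (simp add: y qfun_fi)
    show "resultant2 a2 a1 a0 b2 b1 b0 \<noteq> 0" using re by (simp add: resultant2_def algebra_simps power2_eq_square)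
    fix A0 A1 A2 B0 B1 B2 :: "nat \<Rightarrow> real"
    assume "A0 \<longlonglongrightarrow> a2" "A1 \<longlonglongrightarrow> a1" "A2 \<longlonglongrightarrow> a0" "B0 \<longlonglongrightarrow> b2" "B1 \<longlonglongrightarrow> b1" "B2 \<longlonglongrightarrow> b0"
    then have "\<forall>\<^sub>F n in sequentially. qfun (A2 n) (A1 n) (A0 n) (B2 n) (B1 n) (B0 n) \<in> Y"
      using nbh[unfolded stable_def, rule_format, of A2 A1 A0 B2 B1 B0] by simp
    then show "\<forall>\<^sub>F n in sequentially. qfun (A0 n) (A1 n) (A2 n) (B0 n) (B1 n) (B2 n) \<in> fi ` Y"
      by (rule eventually_mono) (simp add: im qfun_fi)
  qed (use q in auto)
qed

lemma interior_fd: "interior_of_class Y y \<Longrightarrow> interior_of_class (fd ` Y) (fd y)"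
proof -
  assume "interior_of_class Y y"
  then obtain a0 a1 a2 b0 b1 b2 where q: "a0 > 0" "a1 > 0" "a2 > 0" "b0 > 0" "b1 > 0" "b2 > 0"
    and y: "y = qfun a0 a1 a2 b0 b1 b2" and re: "resultant2 a0 a1 a2 b0 b1 b2 \<noteq> 0"
    and nbh: "stable Y a0 a1 a2 b0 b1 b2"
    unfolding interior_of_class_def by blast
  have im: "z \<in> fd ` Y" if "fd z \<in> Y" for z using imageI[OF that, of fd] by simp
  show ?thesis
    unfolding interior_of_class_def stable_def
  proof (intro exI conjI allI impI)
    show "fd y = qfun b0 b1 b2 a0 a1 a2" using q by (simp add: y qfun_fd)
    show "resultant2 b0 b1 b2 a0 a1 a2 \<noteq> 0" using re by (simp add: resultant2_def algebra_simps power2_eq_square)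
    fix A0 A1 A2 B0 B1 B2 :: "nat \<Rightarrow> real"
    assume l: "A0 \<longlonglongrightarrow> b0" "A1 \<longlonglongrightarrow> b1" "A2 \<longlonglongrightarrow> b2" "B0 \<longlonglongrightarrow> a0" "B1 \<longlonglongrightarrow> a1" "B2 \<longlonglongrightarrow> a2"
    then have "\<forall>\<^sub>F n in sequentially. qfun (B0 n) (B1 n) (B2 n) (A0 n) (A1 n) (A2 n) \<in> Y"
      using nbh[unfolded stable_def, rule_format, of B0 B1 B2 A0 A1 A2] by simp
    \<comment> \<open>Exchanging the quadratics by inversion uses positive coefficients, which hold
      near a positive limit.\<close>
    moreover note order_tendstoD(1)[OF l(1) q(4)] order_tendstoD(1)[OF l(2) q(5)] order_tendstoD(1)[OF l(3) q(6)]
      order_tendstoD(1)[OF l(4) q(1)] order_tendstoD(1)[OF l(5) q(2)] order_tendstoD(1)[OF l(6) q(3)]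
    ultimately show "\<forall>\<^sub>F n in sequentially. qfun (A0 n) (A1 n) (A2 n) (B0 n) (B1 n) (B2 n) \<in> fd ` Y"
      by eventually_elim (simp add: im qfun_fd)
  qed (use q in auto)
qed

lemma crit6_strict:
  assumes "crit6 a0 a1 a2 b0 b1 b2" "a0 > 0" "b1 * (a1 * b0 - a0 * b1) - b0 * (a2 * b0 - a0 * b2) > 0"
  shows "a1 > 0" "a2 > 0" "b1 > 0" "resultant2 a0 a1 a2 b0 b1 b2 \<noteq> 0"
proof -
  define c1 c2 E where "c1 = a1 * b0 - a0 * b1" and "c2 = a2 * b0 - a0 * b2" and "E = b1 * c1 - b0 * c2"
  have c: "a0 > 0" "b0 > 0" "b2 > 0" "c1 > 0" "c2 \<ge> 0" "E > 0" "b2 * c1\<^sup>2 - c2 * E > 0"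
    using assms unfolding crit6_def c1_def c2_def E_def by auto
  have "b1 * c1 = E + b0 * c2" by (simp add: E_def)
  also have "\<dots> > 0" using c by (intro add_pos_nonneg) auto
  finally show b1: "b1 > 0" using c(4) by (simp add: zero_less_mult_iff)
  have "a1 * b0 = c1 + a0 * b1" by (simp add: c1_def)
  also have "\<dots> > 0" using c b1 by (intro add_pos_pos) auto
  finally show "a1 > 0" using c(2) by (simp add: zero_less_mult_iff)
  have "a2 * b0 = c2 + a0 * b2" by (simp add: c2_def)
  also have "\<dots> > 0" using c b1 by (intro add_nonneg_pos) auto
  finally show "a2 > 0" using c(2) by (simp add: zero_less_mult_iff)
  have "b0 * resultant2 a0 a1 a2 b0 b1 b2 = b2 * c1\<^sup>2 - c2 * E"
    by (simp add: resultant2_def c1_def c2_def E_def algebra_simps power2_eq_square)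
  then show "resultant2 a0 a1 a2 b0 b1 b2 \<noteq> 0" using c(7) by auto
qed

text \<open>For \<open>c\<^sub>2 = 0\<close>, i.e. \<open>R\<^sub>2 = 0\<close>, a neighbourhood of the biquadratic is covered by \<open>N\<^sub>6\<close> together with \<open>N\<^sub>7\<close>.\<close>

lemma interior_K6:
  assumes "crit6 a0 a1 a2 b0 b1 b2" "a0 > 0" "b1 * (a1 * b0 - a0 * b1) - b0 * (a2 * b0 - a0 * b2) > 0"
  shows "interior_of_class (K6 \<union> K7) (qfun a0 a1 a2 b0 b1 b2)"
  unfolding interior_of_class_def stable_def
proof (intro exI conjI allI impI)
  note st = crit6_strict[OF assms]
  note cr = assms[unfolded crit6_def]
  fix A0 A1 A2 B0 B1 B2 :: "nat \<Rightarrow> real"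
  assume l: "A0 \<longlonglongrightarrow> a0" "A1 \<longlonglongrightarrow> a1" "A2 \<longlonglongrightarrow> a2" "B0 \<longlonglongrightarrow> b0" "B1 \<longlonglongrightarrow> b1" "B2 \<longlonglongrightarrow> b2"
  let ?c2 = "\<lambda>n. A2 n * B0 n - A0 n * B2 n"
  have A0: "\<forall>\<^sub>F n in sequentially. A0 n > 0" "\<forall>\<^sub>F n in sequentially. A2 n > 0" "\<forall>\<^sub>F n in sequentially. B0 n > 0" "\<forall>\<^sub>F n in sequentially. B2 n > 0"
    using order_tendstoD(1)[OF l(1), of 0] order_tendstoD(1)[OF l(3), of 0] order_tendstoD(1)[OF l(4), of 0] order_tendstoD(1)[OF l(6), of 0] assms st
    by (auto simp: crit6_def)
  have "\<forall>\<^sub>F n in sequentially. A1 n * B0 n - A0 n * B1 n > 0"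
    by (rule order_tendstoD(1)[where y = "a1 * b0 - a0 * b1"]) (use cr in \<open>auto intro!: tendsto_intros l\<close>)
  moreover have "\<forall>\<^sub>F n in sequentially. B1 n * (A1 n * B0 n - A0 n * B1 n) - B0 n * ?c2 n > 0"
    by (rule order_tendstoD(1)[where y = "b1 * (a1 * b0 - a0 * b1) - b0 * (a2 * b0 - a0 * b2)"]) (use cr in \<open>auto intro!: tendsto_intros l\<close>)
  moreover have "\<forall>\<^sub>F n in sequentially. B2 n * (A1 n * B0 n - A0 n * B1 n)\<^sup>2 - ?c2 n * (B1 n * (A1 n * B0 n - A0 n * B1 n) - B0 n * ?c2 n) > 0"
    by (rule order_tendstoD(1)[where y = "b2 * (a1 * b0 - a0 * b1)\<^sup>2 - (a2 * b0 - a0 * b2) * (b1 * (a1 * b0 - a0 * b1) - b0 * (a2 * b0 - a0 * b2))"])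
      (use cr in \<open>auto intro!: tendsto_intros l\<close>)
  ultimately have 6: "\<forall>\<^sub>F n in sequentially. ?c2 n \<ge> 0 \<longrightarrow> crit6 (A0 n) (A1 n) (A2 n) (B0 n) (B1 n) (B2 n)"
    using A0 by eventually_elim (auto simp: crit6_def)
  \<comment> \<open>Negative values of c2 occur near the limit only if c2 = 0 there. Then the
    reversed conditions hold strictly at the limit: with u = b2 c1 / b0 > 0 their expressions are u,
    b1 u and b0 u^2.\<close>
  have 7: "\<forall>\<^sub>F n in sequentially. ?c2 n < 0 \<longrightarrow> crit6 (A2 n) (A1 n) (A0 n) (B2 n) (B1 n) (B0 n)"
  proof (cases "a2 * b0 - a0 * b2 = 0")
    case False
    then have "\<forall>\<^sub>F n in sequentially. ?c2 n > 0"
      using cr by (intro order_tendstoD(1)[where y = "a2 * b0 - a0 * b2"]) (auto intro!: tendsto_intros l)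
    then show ?thesis by eventually_elim simp
  next
    case True
    define u where "u = a1 * b2 - a2 * b1"
    have p: "a0 > 0" "b0 > 0" "b1 > 0" "b2 > 0" "a1 * b0 - a0 * b1 > 0" using assms st by (auto simp: crit6_def)
    have "b0 * u = b2 * (a1 * b0 - a0 * b1) - b1 * (a2 * b0 - a0 * b2)" by (simp add: u_def algebra_simps)
    also have "\<dots> > 0" unfolding True using p by simp
    finally have u: "u > 0" using p by (simp add: zero_less_mult_iff)
    have w: "a0 * b2 - a2 * b0 = 0" using True by simp
    have "\<forall>\<^sub>F n in sequentially. A1 n * B2 n - A2 n * B1 n > 0"
      by (rule order_tendstoD(1)[where y = u]) (use u in \<open>auto intro!: tendsto_intros l simp: u_def\<close>)
    moreover have "\<forall>\<^sub>F n in sequentially. B1 n * (A1 n * B2 n - A2 n * B1 n) - B2 n * (A0 n * B2 n - A2 n * B0 n) > 0"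
    proof (rule order_tendstoD(1))
      show "(\<lambda>n. B1 n * (A1 n * B2 n - A2 n * B1 n) - B2 n * (A0 n * B2 n - A2 n * B0 n)) \<longlonglongrightarrow> b1 * u - b2 * (a0 * b2 - a2 * b0)"
        unfolding u_def by (intro tendsto_intros l)
    qed (use u p w in simp)
    moreover have "\<forall>\<^sub>F n in sequentially. B0 n * (A1 n * B2 n - A2 n * B1 n)\<^sup>2 -
        (A0 n * B2 n - A2 n * B0 n) * (B1 n * (A1 n * B2 n - A2 n * B1 n) - B2 n * (A0 n * B2 n - A2 n * B0 n)) > 0"
    proof (rule order_tendstoD(1))
      show "(\<lambda>n. B0 n * (A1 n * B2 n - A2 n * B1 n)\<^sup>2 -
        (A0 n * B2 n - A2 n * B0 n) * (B1 n * (A1 n * B2 n - A2 n * B1 n) - B2 n * (A0 n * B2 n - A2 n * B0 n))) \<longlonglongrightarrow>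
         b0 * u\<^sup>2 - (a0 * b2 - a2 * b0) * (b1 * u - b2 * (a0 * b2 - a2 * b0))"
        unfolding u_def by (intro tendsto_intros l)
    qed (use u p w in simp)
    ultimately show ?thesis using A0 by eventually_elim (auto simp: crit6_def)
  qed
  from 6 7 show "\<forall>\<^sub>F n in sequentially. qfun (A0 n) (A1 n) (A2 n) (B0 n) (B1 n) (B2 n) \<in> K6 \<union> K7"
  proof eventually_elim
    case (elim n)
    then show ?case using crit6_K6 crit6_K7 unfolding qfun_def by (cases "?c2 n \<ge> 0") auto
  qed
qed (use crit6_strict[OF assms] assms in \<open>auto simp: crit6_def\<close>)

text \<open>For positive a2 and b0 all conditions of \<open>crit4\<close> are strict and hence open,
  and the last one excludes a vanishing resultant.\<close>

lemma interior_KCC: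
  assumes "crit4 a0 a1 a2 b0 b1 b2" "a0 > 0" "a1 > 0" "a2 > 0" "b0 > 0" "b1 > 0"
  shows "interior_of_class KCC (qfun a0 a1 a2 b0 b1 b2)"
  unfolding interior_of_class_def stable_def
proof (intro exI conjI allI impI)
  note cr = assms[unfolded crit4_def]
  have "- b2 * resultant2 a0 a1 a2 b0 b1 b2 =
    (a0 * b2 - a2 * b0) * (b1 * (a1 * b2 - a2 * b1) - b2 * (a0 * b2 - a2 * b0)) - b0 * (a1 * b2 - a2 * b1)\<^sup>2"
    by (simp add: resultant2_def algebra_simps power2_eq_square)
  then show "resultant2 a0 a1 a2 b0 b1 b2 \<noteq> 0" using cr by auto
  fix A0 A1 A2 B0 B1 B2 :: "nat \<Rightarrow> real"
  assume l: "A0 \<longlonglongrightarrow> a0" "A1 \<longlonglongrightarrow> a1" "A2 \<longlonglongrightarrow> a2" "B0 \<longlonglongrightarrow> b0" "B1 \<longlonglongrightarrow> b1" "B2 \<longlonglongrightarrow> b2"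
  have "\<forall>\<^sub>F n in sequentially. A2 n > 0" "\<forall>\<^sub>F n in sequentially. B0 n > 0" "\<forall>\<^sub>F n in sequentially. B2 n > 0"
    using order_tendstoD(1)[OF l(3), of 0] order_tendstoD(1)[OF l(4), of 0] order_tendstoD(1)[OF l(6), of 0] cr by auto
  moreover have "\<forall>\<^sub>F n in sequentially. A1 n * B2 n - A2 n * B1 n > 0"
    by (rule order_tendstoD(1)[where y = "a1 * b2 - a2 * b1"]) (use cr in \<open>auto intro!: tendsto_intros l\<close>)
  moreover have "\<forall>\<^sub>F n in sequentially. B1 n * (A1 n * B2 n - A2 n * B1 n) - B2 n * (A0 n * B2 n - A2 n * B0 n) > 0"
    by (rule order_tendstoD(1)[where y = "b1 * (a1 * b2 - a2 * b1) - b2 * (a0 * b2 - a2 * b0)"])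
      (use cr in \<open>auto intro!: tendsto_intros l\<close>)
  moreover have "\<forall>\<^sub>F n in sequentially. (A0 n * B2 n - A2 n * B0 n) * (B1 n * (A1 n * B2 n - A2 n * B1 n) - B2 n * (A0 n * B2 n - A2 n * B0 n))
      - B0 n * (A1 n * B2 n - A2 n * B1 n)\<^sup>2 > 0"
    by (rule order_tendstoD(1)[where y = "(a0 * b2 - a2 * b0) * (b1 * (a1 * b2 - a2 * b1) - b2 * (a0 * b2 - a2 * b0)) - b0 * (a1 * b2 - a2 * b1)\<^sup>2"])
      (use cr in \<open>auto intro!: tendsto_intros l\<close>)
  ultimately show "\<forall>\<^sub>F n in sequentially. qfun (A0 n) (A1 n) (A2 n) (B0 n) (B1 n) (B2 n) \<in> KCC"
    by eventually_elim (unfold qfun_def, rule crit4_KCC, simp add: crit4_def)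
qed (use assms in \<open>auto simp: crit4_def\<close>)

lemma ennreal_ge0E: assumes "k \<noteq> top" obtains r where "k = ennreal r" "r \<ge> 0"
  using assms by (cases k rule: ennreal_cases) auto

text \<open>The value g = infinity is not degenerate: it is an absent parallel resistor, G =
  0.\<close>

lemma KC_cases:
  fixes r g c :: ennreal
  defines "y \<equiv> (\<lambda>s. r + prl g (inverse (c * ennreal (pos s))))"
  shows "y \<in> RES \<or> (\<exists>R G C. R \<ge> 0 \<and> G \<ge> 0 \<and> C > 0 \<and> r = ennreal R \<and> g = inverse (ennreal G) \<and> c = ennreal C \<and> y = val (form2 R G C))"
proof (cases "r = top \<or> g = 0 \<or> c = 0 \<or> c = top")
  case True
  then have "y = (\<lambda>s. top) \<or> y = (\<lambda>s. r) \<or> y = (\<lambda>s. r + g)" unfolding y_def by (auto simp: ennreal_top_mult)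
  then show ?thesis using RESI by auto
next
  case False
  obtain R where R: "r = ennreal R" "R \<ge> 0" using False ennreal_ge0E by blast
  obtain C where C: "c = ennreal C" "C > 0" using False ennreal_posE by metis
  obtain G where G: "inverse g = ennreal G" "G \<ge> 0" using False ennreal_ge0E[of "inverse g"] by auto
  then have "g = inverse (ennreal G)" by (metis inverse_inverse_ennreal)
  moreover have "y = val (form2 R G C)" using G(2)
    unfolding y_def R C \<open>g = _\<close> by (simp add: form2_def val_ser val_par val_res val_cond)
  ultimately show ?thesis using R G(2) C by blast
qed

text \<open>Inadmissible values 0 or infinity reduce the shape to one storage element. The equations
  for \<open>r1\<close> and \<open>g3\<close> are kept because the subfamilies with R1 = 0 or G3 = 0
  are recognized by them.\<close>

lemma form6_cases:
  fixes r1 l r2 g3 c :: ennreal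
  defines "y \<equiv> (\<lambda>s. r1 + prl (l * ennreal (pos s)) (r2 + prl g3 (inverse (c * ennreal (pos s)))))"
  shows "y \<in> KC \<union> KL \<or> (\<exists>R1 R2 G3 L C. R1 \<ge> 0 \<and> R2 \<ge> 0 \<and> G3 \<ge> 0 \<and> L > 0 \<and> C > 0 \<and>
    r1 = ennreal R1 \<and> g3 = inverse (ennreal G3) \<and> y = val (form6 R1 R2 G3 L C))"
proof -
  define w where "w = (\<lambda>s. r2 + prl g3 (inverse (c * ennreal (pos s))))"
  have yw: "y = (\<lambda>s. r1 + prl (l * ennreal (pos s)) (w s))" by (simp add: y_def w_def)
  have wKC: "w \<in> KC" unfolding w_def KC_def by (intro faddI fparI RESI CAPI)
  consider "r1 = top \<or> l = 0" | "l = top" | "w \<in> RES" | "r1 \<noteq> top" "l \<noteq> 0" "l \<noteq> top" "w \<notin> RES" by blast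
  then show ?thesis
  proof cases
    case 1
    then have "y = (\<lambda>s. top) \<or> y = (\<lambda>s. r1)" unfolding yw by auto
    then show ?thesis using const_KC by auto
  next
    case 2
    then have "y = (\<lambda>s. r1 + w s)" unfolding yw by (simp add: ennreal_top_mult)
    then have "y \<in> KC" using faddI[OF RESI wKC, of r1] RES_KC by simp
    then show ?thesis by blast
  next
    case 3
    have "(\<lambda>s. r1 + prl (w s) (l * ennreal (pos s))) \<in> KL" unfolding KL_def by (intro faddI fparI RESI INDI 3)
    then show ?thesis unfolding yw by (simp add: prl_comm)
  next
    case 4
    obtain R1 where R1: "r1 = ennreal R1" "R1 \<ge> 0" using 4 ennreal_ge0E by blast
    obtain L where L: "l = ennreal L" "L > 0" using 4 ennreal_posE by metis
    from KC_cases[of r2 g3 c] 4(4)[unfolded w_def] obtain R2 G3 C where p: "R2 \<ge> 0" "G3 \<ge> 0" "C > 0" "g3 = inverse (ennreal G3)" and w: "w = val (form2 R2 G3 C)"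
      unfolding w_def by blast
    have "y = val (form6 R1 R2 G3 L C)" unfolding val_form6[OF p(2)] yw w R1 L ..
    then show ?thesis using R1 p L by blast
  qed
qed

lemma CAP_par_CAP: "CAP \<boxtimes> CAP \<subseteq> CAP"
proof
  fix f assume "f \<in> CAP \<boxtimes> CAP"
  then obtain a b where "f = (\<lambda>s. prl (inverse (a * ennreal (pos s))) (inverse (b * ennreal (pos s))))"
    by (auto simp: lift2_def CAP_def)
  then have "f = (\<lambda>s. inverse ((a + b) * ennreal (pos s)))" by (simp add: prl_def distrib_right)
  then show "f \<in> CAP" by (simp only: CAPI)
qed

lemma form4_cases:
  fixes r1 c2 r2 g3 c1 :: ennreal
  defines "y \<equiv> (\<lambda>s. r1 + prl (inverse (c2 * ennreal (pos s))) (r2 + prl g3 (inverse (c1 * ennreal (pos s)))))"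
  shows "y \<in> KC \<or> (\<exists>R1 R2 G3 C1 C2. R1 \<ge> 0 \<and> R2 > 0 \<and> G3 \<ge> 0 \<and> C1 > 0 \<and> C2 > 0 \<and>
    r1 = ennreal R1 \<and> g3 = inverse (ennreal G3) \<and> y = val (form4 R1 R2 G3 C1 C2))"
proof -
  define w where "w = (\<lambda>s. r2 + prl g3 (inverse (c1 * ennreal (pos s))))"
  have yw: "y = (\<lambda>s. r1 + prl (inverse (c2 * ennreal (pos s))) (w s))" by (simp add: y_def w_def)
  have wKC: "w \<in> KC" unfolding w_def KC_def by (intro faddI fparI RESI CAPI)
  consider "r1 = top \<or> c2 = top" | "c2 = 0" | "w \<in> RES" | "r2 = 0" | "r1 \<noteq> top" "c2 \<noteq> 0" "c2 \<noteq> top" "w \<notin> RES" "r2 \<noteq> 0" by blast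
  then show ?thesis
  proof cases
    case 1
    then have "y = (\<lambda>s. top) \<or> y = (\<lambda>s. r1)" unfolding yw by (auto simp: ennreal_top_mult)
    then show ?thesis using const_KC by auto
  next
    case 2
    then have "y = (\<lambda>s. r1 + w s)" unfolding yw by simp
    then have "y \<in> KC" using faddI[OF RESI wKC, of r1] RES_KC by simp
    then show ?thesis by blast
  next
    case 3
    have "(\<lambda>s. r1 + prl (w s) (inverse (c2 * ennreal (pos s)))) \<in> KC" unfolding KC_def by (intro faddI fparI RESI CAPI 3)
    then show ?thesis unfolding yw by (simp add: prl_comm)
  next
    \<comment> \<open>Without R2 the two capacitors are in parallel and merge; this is the origin of
      the condition R2 > 0.\<close>
    case 4
    have "(\<lambda>s. prl (inverse (c2 * ennreal (pos s))) (inverse (c1 * ennreal (pos s)))) \<in> CAP"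
      using CAP_par_CAP fparI[OF CAPI CAPI] by blast
    then have "(\<lambda>s. r1 + prl g3 (prl (inverse (c2 * ennreal (pos s))) (inverse (c1 * ennreal (pos s))))) \<in> KC"
      unfolding KC_def by (intro faddI fparI RESI)
    moreover have "y = (\<lambda>s. r1 + prl g3 (prl (inverse (c2 * ennreal (pos s))) (inverse (c1 * ennreal (pos s)))))"
      unfolding y_def 4 by (simp add: prl_assoc[symmetric] prl_comm[of _ g3])
    ultimately show ?thesis by simp
  next
    case 5
    obtain R1 where R1: "r1 = ennreal R1" "R1 \<ge> 0" using 5 ennreal_ge0E by blast
    obtain C2 where C2: "c2 = ennreal C2" "C2 > 0" using 5 ennreal_posE by metis
    from KC_cases[of r2 g3 c1] 5(4)[unfolded w_def] obtain R2 G3 C where p: "R2 \<ge> 0" "G3 \<ge> 0" "C > 0" "r2 = ennreal R2" "g3 = inverse (ennreal G3)" and w: "w = val (form2 R2 G3 C)"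
      unfolding w_def by blast
    have "R2 > 0" using p 5(5) by (cases "R2 = 0") auto
    have "y = val (form4 R1 R2 G3 C C2)" unfolding val_form4[OF p(2)] yw w R1 C2 ..
    then show ?thesis using R1 \<open>R2 > 0\<close> p C2 by blast
  qed
qed

text \<open>R1 > 0 gives a0 > 0, and G3 > 0 makes the condition on E strict. R2 = 0 means c2 = 0,
  which is interior to the union with \<open>K7\<close>.\<close>

lemma interior_form6:
  assumes p: "R1 > 0" "R2 \<ge> 0" "G3 > 0" "L > 0" "C > 0"
  shows "interior_of_class (K6 \<union> K7) (val (form6 R1 R2 G3 L C))"
proof -
  define b0 b1 b2 where "b0 = 1 + R2 * G3" and "b1 = R2 * C + L * G3" and "b2 = L * C"
  define a0 a1 a2 where "a0 = R1 * b0" and "a1 = R1 * b1 + L * b0" and "a2 = R1 * b2 + L * R2 * C"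
  define H where "H = L ^ 3 * C * b0 ^ 3"
  have b0: "b0 > 0" using p unfolding b0_def by (intro add_pos_nonneg) auto
  have b2: "b2 > 0" using p by (simp add: b2_def)
  have a0: "a0 > 0" using p b0 by (simp add: a0_def)
  have c1: "a1 * b0 - a0 * b1 = L * b0\<^sup>2" by (simp add: a0_def a1_def algebra_simps power2_eq_square)
  have c2: "a2 * b0 - a0 * b2 = L * R2 * C * b0" by (simp add: a0_def a2_def algebra_simps power2_eq_square)
  have E: "b1 * (a1 * b0 - a0 * b1) - b0 * (a2 * b0 - a0 * b2) = L\<^sup>2 * G3 * b0\<^sup>2"
    unfolding c1 c2 by (simp add: b1_def algebra_simps power2_eq_square)
  have "b2 * (L * b0\<^sup>2)\<^sup>2 - (L * R2 * C * b0) * (L\<^sup>2 * G3 * b0\<^sup>2) = L ^ 3 * C * b0 ^ 3 * (b0 - R2 * G3)"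
    by (simp add: b2_def algebra_simps power2_eq_square power3_eq_cube)
  then have H: "b2 * (L * b0\<^sup>2)\<^sup>2 - (L * R2 * C * b0) * (L\<^sup>2 * G3 * b0\<^sup>2) = H"
    by (simp add: H_def b0_def)
  have pp: "L * b0\<^sup>2 > 0" "L * R2 * C * b0 \<ge> 0" "L\<^sup>2 * G3 * b0\<^sup>2 > 0" "H > 0" using p b0 by (auto simp: H_def)
  have cr: "crit6 a0 a1 a2 b0 b1 b2" unfolding crit6_def E unfolding c1 c2 H using pp a0 b0 b2 by simp
  have "quad a0 a1 a2 t / quad b0 b1 b2 t = R1 + 1 / (1 / (L * t) + 1 / (R2 + 1 / (G3 + C * t)))" if t: "t > 0" for t
  proof -
    have e: "a0 / b0 = R1" "L * b0\<^sup>2 / b0\<^sup>2 = L" "L * R2 * C * b0 / (b0 * b2) = R2"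
      using b0 p by (simp_all add: a0_def b2_def)
    have e2: "b0 * b2 * (L\<^sup>2 * G3 * b0\<^sup>2) / H = G3" "b0 * b2\<^sup>2 * (L * b0\<^sup>2) / H = C"
      using b0 p by (simp_all add: H_def b2_def power2_eq_square power3_eq_cube)
    show ?thesis
      using biquad_K6_eq[OF b0 b2 t c1[symmetric] pp(1) c2[symmetric] pp(2) _ less_imp_le[OF pp(3)] H[symmetric] pp(4)] E
      unfolding e e2 c1 c2 by simp
  qed
  then have "val (form6 R1 R2 G3 L C) = qfun a0 a1 a2 b0 b1 b2"
    unfolding qfun_def by (subst form6_val) (use p in auto)
  then show ?thesis using interior_K6[OF cr a0] E pp by simp
qed

lemma interior_form4:
  assumes p: "R1 > 0" "R2 > 0" "G3 > 0" "C1 > 0" "C2 > 0"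
  shows "interior_of_class KCC (val (form4 R1 R2 G3 C1 C2))"
proof -
  define v where "v = R2 * G3 + 1"
  define b0 b1 b2 where "b0 = G3" and "b1 = C1 + C2 * v" and "b2 = C1 * C2 * R2"
  define a0 a1 a2 where "a0 = R1 * b0 + v" and "a1 = R1 * b1 + R2 * C1" and "a2 = R1 * b2"
  have v: "v > 0" using p by (auto simp: v_def intro: add_pos_pos)
  have b: "b0 > 0" "b1 > 0" "b2 > 0" using p v by (auto simp: b0_def b1_def b2_def intro!: add_pos_pos)
  then have a: "a0 > 0" "a1 > 0" "a2 > 0" using p v by (auto simp: a0_def a1_def a2_def intro!: add_pos_pos)
  have c1: "a1 * b2 - a2 * b1 = R2 * C1 * b2" by (simp add: a1_def a2_def algebra_simps)
  have c0: "a0 * b2 - a2 * b0 = v * b2" by (simp add: a0_def a2_def algebra_simps)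
  have E: "b1 * (a1 * b2 - a2 * b1) - b2 * (a0 * b2 - a2 * b0) = b2 * R2 * C1\<^sup>2"
    unfolding c1 c0 by (simp add: b1_def b2_def algebra_simps power2_eq_square)
  have H: "(v * b2) * (b2 * R2 * C1\<^sup>2) - b0 * (R2 * C1 * b2)\<^sup>2 = b2\<^sup>2 * R2 * C1\<^sup>2"
    by (simp add: v_def b0_def algebra_simps power2_eq_square)
  have pp: "R2 * C1 * b2 > 0" "b2 * R2 * C1\<^sup>2 > 0" "b2\<^sup>2 * R2 * C1\<^sup>2 > 0" using p b by auto
  have cr: "crit4 a0 a1 a2 b0 b1 b2" unfolding crit4_def E unfolding c1 c0 H using pp a b by simp
  have "quad a0 a1 a2 t / quad b0 b1 b2 t = R1 + 1 / (C2 * t + 1 / (R2 + 1 / (G3 + C1 * t)))" if t: "t > 0" for t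
  proof -
    have e: "a2 / b2 = R1" "b2\<^sup>2 / (R2 * C1 * b2) = C2" "(R2 * C1 * b2)\<^sup>2 / (b2 * (b2 * R2 * C1\<^sup>2)) = R2"
      using b p by (simp_all add: a2_def b2_def power2_eq_square)
    have e2: "b0 * b2 * (b2 * R2 * C1\<^sup>2) / (b2\<^sup>2 * R2 * C1\<^sup>2) = G3"
      "(b2 * R2 * C1\<^sup>2)\<^sup>2 * b2 / ((R2 * C1 * b2) * (b2\<^sup>2 * R2 * C1\<^sup>2)) = C1"
      using b p by (simp_all add: b0_def power2_eq_square)
    show ?thesis
      using biquad_KCC_eq[OF less_imp_le[OF b(1)] b(3) t c1[symmetric] pp(1) c0[symmetric] _ pp(2) H[symmetric] pp(3)] E
      unfolding e e2 c1 c0 by simp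
  qed
  then have "val (form4 R1 R2 G3 C1 C2) = qfun a0 a1 a2 b0 b1 b2"
    unfolding qfun_def by (subst form4_val) (use p in auto)
  then show ?thesis using interior_KCC[OF cr a b(1,2)] by simp
qed

section \<open>Faces, and the closed set for three storage elements\<close>

text \<open>The number refers to the class whose two-storage part this is, with one resistor
  missing; \<open>W29\<close> belongs to the image of \<open>class29\<close> under s -> 1/s.\<close>

definition W17 where "W17 = RES \<boxplus> (IND \<boxtimes> (RES \<boxplus> CAP))"
definition W20 where "W20 = RES \<boxplus> (CAP \<boxtimes> (RES \<boxplus> IND))"
definition W22 where "W22 = CAP \<boxplus> KL"
definition W23 where "W23 = RES \<boxtimes> (CAP \<boxplus> (RES \<boxtimes> IND))"
definition W25 where "W25 = IND \<boxplus> KC"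
definition W26 where "W26 = RES \<boxtimes> (IND \<boxplus> (RES \<boxtimes> CAP))"
definition W29 where "W29 = RES \<boxplus> (CAP \<boxtimes> (RES \<boxplus> CAP))"
lemmas W_defs = W17_def W20_def W22_def W23_def W25_def W26_def W29_def

definition XL where "XL W = RES \<boxplus> ((RES \<boxplus> IND) \<boxtimes> W)"

text \<open>The closed counterpart of the twelve classes. The sets \<open>XL W\<close> lack a
  resistor inside the two-storage part, \<open>RES \<boxplus> (IND \<boxtimes> KCL)\<close> has R5 =
  0 and covers \<open>class18\<close>, \<open>class21\<close>, \<open>class24\<close> and
  \<open>class27\<close>, and the images under \<open>fi\<close> cover \<open>class29\<close> and
  \<open>class30\<close>. \<open>KCL\<close> and \<open>KLL\<close> take up impedances needing at
  most two storage elements.\<close>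

definition GA :: "rfun set" where
  "GA = XL W17 \<union> XL W20 \<union> XL W22 \<union> XL W23 \<union> XL W25 \<union> XL W26 \<union> RES \<boxplus> (IND \<boxtimes> KCL) \<union>
     fi ` XL W29 \<union> fi ` (RES \<boxplus> (IND \<boxtimes> KCC)) \<union> KCL \<union> KLL"

lemma compact_GA: "compact GA"
  unfolding GA_def XL_def W_defs by (intro compact_sets compact_fi compact_K)

lemma XL_mono: "A \<subseteq> B \<Longrightarrow> XL A \<subseteq> XL B" unfolding XL_def by (intro lift2_mono order_refl)

lemma RES_IND_le_KL: "RES \<boxplus> IND \<subseteq> KL" unfolding KL_alt by (intro fpar_superset RESI)
lemma KL_KL_le: "KL \<boxtimes> KL \<subseteq> KLL" using image_mono[OF KC_par_KC_le, of fi] by (simp add: fidK)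

lemma XL_le: "XL W \<subseteq> RES \<boxplus> (KL \<boxtimes> W)"
  unfolding XL_def by (intro lift2_mono order_refl RES_IND_le_KL)
lemma XL_KC: "XL KC \<subseteq> KCL" using XL_le KL_KC_le_KCL by blast
lemma XL_KL: "XL KL \<subseteq> KLL"
proof -
  have "RES \<boxplus> (KL \<boxtimes> KL) \<subseteq> RES \<boxplus> KLL" by (intro lift2_mono order_refl KL_KL_le)
  then show ?thesis using XL_le RES_KLL by blast
qed

text \<open>Without R1 the storage element A is in parallel with the branch R5 + L s and can take
  its place; the rest, an RL branch in parallel with B, collapses to a two-storage impedance. For
  this reason R1 = 0 in \<open>N10\<close>, \<open>N11\<close> and \<open>N14\<close> yields no
  class of its own.\<close>

lemma XL_par:
  assumes "KL \<boxtimes> B \<subseteq> D"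
  shows "XL (A \<boxtimes> B) \<subseteq> RES \<boxplus> (A \<boxtimes> D)"
proof -
  have "(RES \<boxplus> IND) \<boxtimes> (A \<boxtimes> B) = A \<boxtimes> ((RES \<boxplus> IND) \<boxtimes> B)" by (metis fpar_assoc fpar_comm)
  moreover have "(RES \<boxplus> IND) \<boxtimes> B \<subseteq> D" using lift2_mono[OF RES_IND_le_KL order_refl[of B], of prl] assms by blast
  ultimately show ?thesis unfolding XL_def by (simp add: lift2_mono)
qed

lemma XL_IND_KC: "XL (IND \<boxtimes> KC) \<subseteq> RES \<boxplus> (IND \<boxtimes> KCL)"
  by (rule XL_par) (use KC_KL_le_KCL in \<open>simp add: fpar_comm\<close>)
lemma XL_CAP_KL: "XL (CAP \<boxtimes> KL) \<subseteq> RES \<boxplus> (CAP \<boxtimes> KLL)"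
  by (rule XL_par) (rule KL_KL_le)
lemma XL_CAP_KC: "XL (CAP \<boxtimes> KC) \<subseteq> RES \<boxplus> (CAP \<boxtimes> KCL)"
  by (rule XL_par) (use KC_KL_le_KCL in \<open>simp add: fpar_comm\<close>)

lemma K6_E: "y \<in> K6 \<Longrightarrow> \<exists>r1 l r2 g3 c. y = (\<lambda>s. r1 + prl (l * ennreal (pos s)) (r2 + prl g3 (inverse (c * ennreal (pos s)))))"
  by (auto simp: K6_def KC_def lift2_def RES_def IND_def CAP_def) ((rule exI)+, rule refl)
lemma KCC_E: "y \<in> KCC \<Longrightarrow> \<exists>r1 c2 r2 g3 c1. y = (\<lambda>s. r1 + prl (inverse (c2 * ennreal (pos s))) (r2 + prl g3 (inverse (c1 * ennreal (pos s)))))"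
  by (auto simp: KCC_def KC_def lift2_def RES_def CAP_def) ((rule exI)+, rule refl)

text \<open>Only R1 and G3 give faces, since R2 = 0 is interior to
  \<open>K6 \<union> K7\<close>.\<close>

lemma K6_faces:
  assumes "y \<in> K6"
  shows "y \<in> KC \<union> KL \<union> W17 \<union> IND \<boxtimes> KC \<or> interior_of_class (K6 \<union> K7) y"
proof -
  obtain r1 l r2 g3 c where y: "y = (\<lambda>s. r1 + prl (l * ennreal (pos s)) (r2 + prl g3 (inverse (c * ennreal (pos s)))))"
    using K6_E[OF assms] by blast
  consider "y \<in> KC \<union> KL" | R1 R2 G3 L C where "R1 \<ge> 0" "R2 \<ge> 0" "G3 \<ge> 0" "L > 0" "C > 0" "r1 = ennreal R1" "g3 = inverse (ennreal G3)"
     "y = val (form6 R1 R2 G3 L C)" using form6_cases[of r1 l r2 g3 c] unfolding y by blast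
  then show ?thesis
  proof cases
    case 2
    show ?thesis
    proof (cases "R1 = 0 \<or> G3 = 0")
      case True
      then show ?thesis
      proof
        assume "R1 = 0"
        then have "y = (\<lambda>s. prl (l * ennreal (pos s)) (r2 + prl g3 (inverse (c * ennreal (pos s)))))" using 2 y by simp
        also have "\<dots> \<in> IND \<boxtimes> KC" unfolding KC_def by (intro fparI faddI RESI INDI CAPI)
        finally show ?thesis by blast
      next
        assume "G3 = 0"
        then have "y = (\<lambda>s. r1 + prl (l * ennreal (pos s)) (r2 + inverse (c * ennreal (pos s))))" using 2 y by simp
        also have "\<dots> \<in> W17" unfolding W17_def by (intro fparI faddI RESI INDI CAPI)
        finally show ?thesis by blast
      qed
    next
      case False
      then show ?thesis using 2 interior_form6[of R1 R2 G3 L C] by auto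
    qed
  qed auto
qed

lemma KCC_faces:
  assumes "y \<in> KCC"
  shows "y \<in> KC \<union> W29 \<union> CAP \<boxtimes> KC \<or> interior_of_class KCC y"
proof -
  obtain r1 c2 r2 g3 c1 where y: "y = (\<lambda>s. r1 + prl (inverse (c2 * ennreal (pos s))) (r2 + prl g3 (inverse (c1 * ennreal (pos s)))))"
    using KCC_E[OF assms] by blast
  consider "y \<in> KC" | R1 R2 G3 C1 C2 where "R1 \<ge> 0" "R2 > 0" "G3 \<ge> 0" "C1 > 0" "C2 > 0" "r1 = ennreal R1" "g3 = inverse (ennreal G3)"
     "y = val (form4 R1 R2 G3 C1 C2)" using form4_cases[of r1 c2 r2 g3 c1] unfolding y by blast
  then show ?thesis
  proof cases
    case 2
    show ?thesis
    proof (cases "R1 = 0 \<or> G3 = 0")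
      case True
      then show ?thesis
      proof
        assume "R1 = 0"
        then have "y = (\<lambda>s. prl (inverse (c2 * ennreal (pos s))) (r2 + prl g3 (inverse (c1 * ennreal (pos s)))))" using 2 y by simp
        also have "\<dots> \<in> CAP \<boxtimes> KC" unfolding KC_def by (intro fparI faddI RESI INDI CAPI)
        finally show ?thesis by blast
      next
        assume "G3 = 0"
        then have "y = (\<lambda>s. r1 + prl (inverse (c2 * ennreal (pos s))) (r2 + inverse (c1 * ennreal (pos s))))" using 2 y by simp
        also have "\<dots> \<in> W29" unfolding W29_def by (intro fparI faddI RESI INDI CAPI)
        finally show ?thesis by blast
      qed
    next
      case False
      then show ?thesis using 2 interior_form4[of R1 R2 G3 C1 C2] by auto
    qed
  qed auto
qed

lemma fi_W17: "fi ` W17 = W20" and fd_W17: "fd ` W17 = W23" and fd_W20: "fd ` W20 = W26"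
  and fd_INDKC: "fd ` (IND \<boxtimes> KC) = W22" and fd_CAPKL: "fd ` (CAP \<boxtimes> KL) = W25"
  unfolding W_defs by (simp_all add: fidK)

lemma K67_faces:
  assumes "y \<in> K6 \<union> K7"
  shows "y \<in> KC \<union> KL \<union> W17 \<union> IND \<boxtimes> KC \<union> W20 \<union> CAP \<boxtimes> KL \<or> interior_of_class (K6 \<union> K7) y"
proof (cases "y \<in> K6")
  case True
  then show ?thesis using K6_faces by blast
next
  case False
  then have "fi y \<in> fi ` K7" using assms by auto
  then have "fi y \<in> K6" by (simp add: fidK)
  from K6_faces[OF this] show ?thesis
  proof
    assume "fi y \<in> KC \<union> KL \<union> W17 \<union> IND \<boxtimes> KC"
    then have "fi (fi y) \<in> fi ` (KC \<union> KL \<union> W17 \<union> IND \<boxtimes> KC)" by (rule imageI)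
    then have "y \<in> KL \<union> KC \<union> W20 \<union> CAP \<boxtimes> KL" by (simp add: image_Un fi_W17 fidK)
    then show ?thesis by blast
  next
    assume "interior_of_class (K6 \<union> K7) (fi y)"
    from interior_fi[OF this] show ?thesis by (simp add: fidK Un_commute)
  qed
qed

lemma K89_faces:
  assumes "y \<in> K8 \<union> K9"
  shows "y \<in> KC \<union> KL \<union> W22 \<union> W23 \<union> W25 \<union> W26 \<or> interior_of_class (K8 \<union> K9) y"
proof -
  have "fd y \<in> fd ` (K8 \<union> K9)" using assms by (rule imageI)
  then have "fd y \<in> K6 \<union> K7" by (simp add: image_Un fidK)
  from K67_faces[OF this] show ?thesis
  proof
    assume "fd y \<in> KC \<union> KL \<union> W17 \<union> IND \<boxtimes> KC \<union> W20 \<union> CAP \<boxtimes> KL"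
    then have "fd (fd y) \<in> fd ` (KC \<union> KL \<union> W17 \<union> IND \<boxtimes> KC \<union> W20 \<union> CAP \<boxtimes> KL)" by (rule imageI)
    then have "y \<in> KL \<union> KC \<union> W23 \<union> W22 \<union> W26 \<union> W25" by (simp only: image_Un fd_W17 fd_W20 fd_INDKC fd_CAPKL fd_KL fd_KC fd_fd)
    then show ?thesis by blast
  next
    assume "interior_of_class (K6 \<union> K7) (fd y)"
    from interior_fd[OF this] show ?thesis by (simp add: image_Un fidK)
  qed
qed

text \<open>\<open>K6\<close> is paired with \<open>K7\<close>, and \<open>K8\<close> with
  \<open>K9\<close>, because R2 = 0, or dually G2 = 0, is interior only in these unions.\<close>

lemma three_storage_KCL: "XL KCL \<subseteq> GA"
proof -
  have k: "K6 \<union> K7 \<subseteq> KCL" "K8 \<union> K9 \<subseteq> KCL" by (auto simp: KCL_def)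
  have b: "RES \<subseteq> GA" "RES \<boxplus> (IND \<boxtimes> Y) \<subseteq> GA" "RES \<boxplus> (RES \<boxtimes> Y) \<subseteq> GA" if "Y \<subseteq> KCL" for Y
  proof -
    show "RES \<subseteq> GA" using const_KCL by (auto simp: GA_def RES_def)
    have "RES \<boxplus> (IND \<boxtimes> Y) \<subseteq> RES \<boxplus> (IND \<boxtimes> KCL)" by (intro lift2_mono order_refl that)
    then show "RES \<boxplus> (IND \<boxtimes> Y) \<subseteq> GA" by (auto simp: GA_def)
    have "RES \<boxplus> (RES \<boxtimes> Y) \<subseteq> RES \<boxplus> (RES \<boxtimes> KCL)" by (intro lift2_mono order_refl that)
    also have "\<dots> \<subseteq> RES \<boxplus> KCL" by (intro lift2_mono order_refl RES_KCL)
    also have "\<dots> \<subseteq> KCL" by (rule RES_KCL)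
    finally show "RES \<boxplus> (RES \<boxtimes> Y) \<subseteq> GA" by (auto simp: GA_def)
  qed
  have XLG: "XL W \<subseteq> GA" if "W \<in> {KC, KL, W17, IND \<boxtimes> KC, W20, CAP \<boxtimes> KL, W22, W23, W25, W26}" for W
  proof -
    have "RES \<boxplus> (CAP \<boxtimes> KLL) = fi ` (RES \<boxplus> (IND \<boxtimes> KCC))" by (simp add: fidK)
    then have "XL (CAP \<boxtimes> KL) \<subseteq> GA" using XL_CAP_KL unfolding GA_def by blast
    moreover have "XL (IND \<boxtimes> KC) \<subseteq> GA" using XL_IND_KC unfolding GA_def by blast
    moreover have "XL KC \<subseteq> GA" "XL KL \<subseteq> GA" using XL_KC XL_KL unfolding GA_def by blast+
    moreover have "XL W17 \<subseteq> GA" "XL W20 \<subseteq> GA" "XL W22 \<subseteq> GA" "XL W23 \<subseteq> GA" "XL W25 \<subseteq> GA" "XL W26 \<subseteq> GA"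
      unfolding GA_def by blast+
    ultimately show ?thesis using that by blast
  qed
  have s: "RES \<boxplus> ((RES \<boxplus> IND) \<boxtimes> {y}) \<subseteq> GA" if "y \<in> W" "XL W \<subseteq> GA" for y W
    using XL_mono[of "{y}" W] that unfolding XL_def by blast
  have "XL (K6 \<union> K7) \<subseteq> GA"
    unfolding XL_def
  proof (rule three_storage_max[OF _ closed_compact[OF compact_GA] b[OF k(1)]])
    show "compact (K6 \<union> K7)" by (intro compact_Un compact_K)
    fix y assume "y \<in> K6 \<union> K7"
    from K67_faces[OF this] show "RES \<boxplus> ((RES \<boxplus> IND) \<boxtimes> {y}) \<subseteq> GA \<or> interior_of_class (K6 \<union> K7) y"
      using s[OF _ XLG] by blast
  qed
  moreover have "XL (K8 \<union> K9) \<subseteq> GA"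
    unfolding XL_def
  proof (rule three_storage_max[OF _ closed_compact[OF compact_GA] b[OF k(2)]])
    show "compact (K8 \<union> K9)" by (intro compact_Un compact_K)
    fix y assume "y \<in> K8 \<union> K9"
    from K89_faces[OF this] show "RES \<boxplus> ((RES \<boxplus> IND) \<boxtimes> {y}) \<subseteq> GA \<or> interior_of_class (K8 \<union> K9) y"
      using s[OF _ XLG] by blast
  qed
  moreover have "XL KCL = XL (K6 \<union> K7) \<union> XL (K8 \<union> K9)" unfolding XL_def KCL_def lift2_Un by blast
  ultimately show ?thesis by simp
qed

text \<open>\<open>GA\<close> stands for two inductors and one capacitor. The storage elements are
  exchanged here, hence the image under \<open>fi\<close>.\<close>

lemma three_storage_KCC: "XL KCC \<subseteq> fi ` GA"
proof -
  have G: "fi ` XL W29 \<subseteq> GA" "fi ` (RES \<boxplus> (IND \<boxtimes> KCC)) \<subseteq> GA" "RES \<boxplus> (IND \<boxtimes> KCL) \<subseteq> GA" "KCL \<subseteq> GA" "KLL \<subseteq> GA"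
    unfolding GA_def by blast+
  have H: "XL W29 \<subseteq> fi ` GA" "RES \<boxplus> (IND \<boxtimes> KCC) \<subseteq> fi ` GA" "RES \<boxplus> (CAP \<boxtimes> KCL) \<subseteq> fi ` GA" "KCL \<subseteq> fi ` GA" "KCC \<subseteq> fi ` GA"
    using G[THEN image_mono[of _ _ fi]] by (simp_all add: fidK)
  have s: "RES \<boxplus> ((RES \<boxplus> IND) \<boxtimes> {y}) \<subseteq> fi ` GA" if "y \<in> W" "XL W \<subseteq> fi ` GA" for y W
    using XL_mono[of "{y}" W] that unfolding XL_def by blast
  show ?thesis
    unfolding XL_def
  proof (rule three_storage_max[OF compact_K(3) closed_compact[OF compact_fi[OF compact_GA]]])
    show "RES \<subseteq> fi ` GA" using H(4) const_KCL by (auto simp: RES_def)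
    show "RES \<boxplus> (IND \<boxtimes> KCC) \<subseteq> fi ` GA" by (rule H)
    show "RES \<boxplus> (RES \<boxtimes> KCC) \<subseteq> fi ` GA" using H(5) by (simp add: RES_KCC)
    fix y assume "y \<in> KCC"
    from KCC_faces[OF this] show "RES \<boxplus> ((RES \<boxplus> IND) \<boxtimes> {y}) \<subseteq> fi ` GA \<or> interior_of_class KCC y"
      using s[OF _ order_trans[OF XL_KC H(4)]] s[OF _ H(1)] s[OF _ order_trans[OF XL_CAP_KC H(3)]] by blast
  qed
qed

text \<open>The parallel resistor in the second normal form of an RL branch is absorbed by
  \<open>W\<close>.\<close>

lemma KL_par_le_XL: "RES \<boxtimes> W \<subseteq> W \<Longrightarrow> RES \<boxplus> (KL \<boxtimes> W) \<subseteq> XL W"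
proof -
  assume W: "RES \<boxtimes> W \<subseteq> W"
  have "KL \<boxtimes> W = (RES \<boxplus> IND) \<boxtimes> (RES \<boxtimes> W)" unfolding KL_alt by (metis fpar_assoc fpar_comm)
  then show ?thesis using W unfolding XL_def by (simp add: lift2_mono)
qed

text \<open>Both parts of \<open>K21\<close> with \<open>KCL\<close> are images of
  \<open>RES \<boxplus> (KL \<boxtimes> KCL)\<close>, one under s -> 1/s and one under Z -> 1/Z; the
  two parts with \<open>KCC\<close> are mapped to each other by the composition of these
  symmetries.\<close>

theorem K21_le: "K21 \<subseteq> fi ` GA \<union> fd ` GA"
proof -
  have A: "RES \<boxplus> (KL \<boxtimes> KCL) \<subseteq> GA" using KL_par_le_XL[OF RES_KCL(2)] three_storage_KCL by blast
  have B: "RES \<boxplus> (KL \<boxtimes> KCC) \<subseteq> fi ` GA" using KL_par_le_XL[of KCC] RES_KCC three_storage_KCC by auto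
  have "RES \<boxplus> (KC \<boxtimes> KCL) \<subseteq> fi ` GA" "RES \<boxtimes> (KC \<boxplus> KCL) \<subseteq> fd ` GA"
    using image_mono[OF A, of fi] image_mono[OF A, of fd] by (simp_all add: fidK)
  moreover have "RES \<boxtimes> (KL \<boxplus> KCC) \<subseteq> fd ` GA"
    using image_mono[OF image_mono[OF B, of fi], of fd] by (simp add: fidK fd_KLL)
  ultimately show ?thesis unfolding K21_def using B by blast
qed

subsection \<open>Rational impedances and the network classes\<close>

text \<open>Relates a formal impedance to its function. The signs are carried along because they
  exclude cancellation: a sum vanishes only if both terms do, and \<open>None\<close> matches
  exactly the infinite function.\<close>

definition rep :: "real poly fract option \<Rightarrow> rfun \<Rightarrow> bool" where
  "rep Z f \<longleftrightarrow> (Z = None \<and> f = (\<lambda>s. top)) \<or>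
    (\<exists>p q. Z = Some (Fract p q) \<and> (\<forall>t>0. poly q t > 0) \<and> (p = 0 \<or> (\<forall>t>0. poly p t > 0)) \<and>
       f = (\<lambda>s. ennreal (poly p (pos s) / poly q (pos s))))"

lemma pos_poly_nz: "(\<forall>t>0. poly q t > 0) \<Longrightarrow> (q :: real poly) \<noteq> 0"
  by (auto dest: spec[of _ 1])

lemma rep_add: "rep Z f \<Longrightarrow> rep W g \<Longrightarrow> rep (imp_add Z W) (\<lambda>s. f s + g s)"
proof -
  assume a: "rep Z f" "rep W g"
  consider "Z = None" "f = (\<lambda>s. top)" | "W = None" "g = (\<lambda>s. top)" |
    p q p' q' where "Z = Some (Fract p q)" "\<forall>t>0. poly q t > 0" "p = 0 \<or> (\<forall>t>0. poly p t > 0)"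
       "f = (\<lambda>s. ennreal (poly p (pos s) / poly q (pos s)))"
       "W = Some (Fract p' q')" "\<forall>t>0. poly q' t > 0" "p' = 0 \<or> (\<forall>t>0. poly p' t > 0)"
       "g = (\<lambda>s. ennreal (poly p' (pos s) / poly q' (pos s)))"
    using a unfolding rep_def by blast
  then show ?thesis
  proof cases
    case 1 then show ?thesis by (simp add: rep_def)
  next
    case 2 then show ?thesis by (cases Z) (simp_all add: rep_def)
  next
    case 3
    have nz: "q \<noteq> 0" "q' \<noteq> 0" using 3(2,6) pos_poly_nz by auto
    have "imp_add Z W = Some (Fract (p * q' + p' * q) (q * q'))" using 3(1,5) nz by simp
    moreover have "\<forall>t>0. poly (q * q') t > 0" using 3(2,6) by simp
    moreover have "p * q' + p' * q = 0 \<or> (\<forall>t>0. poly (p * q' + p' * q) t > 0)"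
    proof (cases "p = 0 \<and> p' = 0")
      case False
      have "poly (p * q' + p' * q) t > 0" if t: "t > 0" for t
      proof -
        have q: "poly q t > 0" "poly q' t > 0" using 3(2,6) t by blast+
        have "poly p t \<ge> 0 \<and> poly p' t \<ge> 0 \<and> (poly p t > 0 \<or> poly p' t > 0)"
          using 3(3,7) t False by (metis less_imp_le order_refl poly_0)
        then show ?thesis using q by (auto intro: add_pos_nonneg add_nonneg_pos)
      qed
      then show ?thesis by blast
    qed simp
    moreover have "(\<lambda>s. f s + g s) = (\<lambda>s. ennreal (poly (p * q' + p' * q) (pos s) / poly (q * q') (pos s)))"
    proof
      fix s
      have q: "poly q (pos s) > 0" "poly q' (pos s) > 0" using 3(2,6) by auto
      have p: "poly p (pos s) \<ge> 0" "poly p' (pos s) \<ge> 0" using 3(3,7) by (auto simp: less_imp_le)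
      have "f s + g s = ennreal (poly p (pos s) / poly q (pos s) + poly p' (pos s) / poly q' (pos s))"
        unfolding 3(4,8) using p q by (intro ennreal_plus[symmetric] divide_nonneg_pos)
      then show "f s + g s = ennreal (poly (p * q' + p' * q) (pos s) / poly (q * q') (pos s))"
        using q by (simp add: add_frac_eq mult.commute)
    qed
    ultimately show ?thesis unfolding rep_def by blast
  qed
qed

lemma rep_recip: "rep Z f \<Longrightarrow> rep (imp_recip Z) (fd f)"
proof -
  assume a: "rep Z f"
  consider "Z = None" "f = (\<lambda>s. top)" |
    p q where "Z = Some (Fract p q)" "\<forall>t>0. poly q t > 0" "p = 0 \<or> (\<forall>t>0. poly p t > 0)"
       "f = (\<lambda>s. ennreal (poly p (pos s) / poly q (pos s)))"
    using a unfolding rep_def by blast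
  then show ?thesis
  proof cases
    case 1
    have "imp_recip Z = Some (Fract 0 1)" using 1 by (simp add: Zero_fract_def)
    then show ?thesis using 1 unfolding rep_def fd_def by (intro disjI2 exI[of _ 0] exI[of _ 1]) auto
  next
    case 2
    have nz: "q \<noteq> 0" using 2(2) pos_poly_nz by auto
    show ?thesis
    proof (cases "p = 0")
      case True
      then have "imp_recip Z = None" using 2 nz by (simp add: Zero_fract_def eq_fract)
      moreover have "fd f = (\<lambda>s. top)" unfolding fd_def 2(4) True by simp
      ultimately show ?thesis unfolding rep_def by blast
    next
      case False
      then have pp: "\<forall>t>0. poly p t > 0" using 2 by blast
      have "Fract p q \<noteq> 0" using False nz by (simp add: Zero_fract_def eq_fract)
      then have "imp_recip Z = Some (Fract q p)" using 2(1) by simp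
      moreover have "fd f = (\<lambda>s. ennreal (poly q (pos s) / poly p (pos s)))"
        unfolding fd_def 2(4) using pp 2(2) by (intro ext) (simp add: inverse_ennreal)
      ultimately show ?thesis using pp 2(2) unfolding rep_def by blast
    qed
  qed
qed

lemma rep_impedance: "series_parallel N \<Longrightarrow> rep (impedance N) (val N)"
proof (induction rule: series_parallel.induct)
  case 1
  then show ?case unfolding rep_def
    by (intro disjI2 exI[of _ 0] exI[of _ 1]) (auto simp: Zero_fract_def)
next
  case (3 R)
  then show ?case unfolding rep_def
    by (intro disjI2 exI[of _ "[:R:]"] exI[of _ 1]) auto
next
  case (4 L)
  then show ?case unfolding rep_def
    by (intro disjI2 exI[of _ "[:0, L:]"] exI[of _ 1]) (auto simp: ennreal_mult mult.commute)
next
  case (5 C)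
  then show ?case unfolding rep_def
    by (intro disjI2 exI[of _ 1] exI[of _ "[:0, C:]"])
      (auto simp: inverse_mult_pos inverse_ennreal inverse_eq_divide mult.commute simp flip: ennreal_mult)
next
  case (7 M N)
  have "val (Parallel M N) = fd (\<lambda>s. fd (val M) s + fd (val N) s)" by (simp add: fd_def prl_def)
  then show ?case using rep_recip[OF rep_add[OF rep_recip[OF 7(3)] rep_recip[OF 7(4)]]] by simp
next
  case (6 M N)
  then show ?case using rep_add by simp
qed (simp add: rep_def)

lemma poly_eq_on_pos: "(\<And>t. t > 0 \<Longrightarrow> poly p t = poly q t) \<Longrightarrow> p = (q :: real poly)"
proof (rule ccontr)
  assume a: "\<And>t. t > 0 \<Longrightarrow> poly p t = poly q t" and ne: "p \<noteq> q"
  have "{0<..} \<subseteq> {t. poly (p - q) t = 0}" using a by auto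
  moreover have "finite {t. poly (p - q) t = 0}" by (rule poly_roots_finite) (use ne in simp)
  ultimately show False using infinite_Ioi[of "0::real"] finite_subset by blast
qed

lemma rep_top: "rep Z (\<lambda>s. top) \<Longrightarrow> Z = None"
  unfolding rep_def by (auto dest: fun_cong[of _ _ 0])

lemma rep_SomeE:
  assumes "rep Z f" "f \<noteq> (\<lambda>s. top)"
  obtains p q where "Z = Some (Fract p q)" "\<forall>t>0. poly q t > 0" "p = 0 \<or> (\<forall>t>0. poly p t > 0)"
    "f = (\<lambda>s. ennreal (poly p (pos s) / poly q (pos s)))"
  using assms unfolding rep_def by blast

text \<open>The cross-multiplied polynomials agree at all s > 0, hence everywhere.\<close>

lemma rep_unique:
  assumes "rep Z f" "rep W f"
  shows "Z = W"
proof (cases "f = (\<lambda>s. top)")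
  case True
  then show ?thesis using assms rep_top[of Z] rep_top[of W] by simp
next
  case False
  obtain p q where 1: "Z = Some (Fract p q)" "\<forall>t>0. poly q t > 0" "p = 0 \<or> (\<forall>t>0. poly p t > 0)"
    "f = (\<lambda>s. ennreal (poly p (pos s) / poly q (pos s)))" by (rule rep_SomeE[OF assms(1) False])
  obtain p' q' where 2: "W = Some (Fract p' q')" "\<forall>t>0. poly q' t > 0" "p' = 0 \<or> (\<forall>t>0. poly p' t > 0)"
    "f = (\<lambda>s. ennreal (poly p' (pos s) / poly q' (pos s)))" by (rule rep_SomeE[OF assms(2) False])
  have nz: "q \<noteq> 0" "q' \<noteq> 0" using 1(2) 2(2) pos_poly_nz by auto
  have "p * q' = p' * q"
  proof (rule poly_eq_on_pos)
    fix t :: real assume t: "t > 0"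
    have q: "poly q t > 0" "poly q' t > 0" using 1(2) 2(2) t by blast+
    have p: "poly p t \<ge> 0" "poly p' t \<ge> 0" using 1(3) 2(3) t by (metis less_imp_le order_refl poly_0)+
    have "ennreal (poly p t / poly q t) = ennreal (poly p' t / poly q' t)"
      using fun_cong[OF trans[OF 1(4)[symmetric] 2(4)], of t] t by (simp add: pos_def)
    then have "poly p t / poly q t = poly p' t / poly q' t"
      by (subst (asm) ennreal_inj) (intro divide_nonneg_pos p q)+
    then show "poly (p * q') t = poly (p' * q) t" using q by (simp add: field_simps)
  qed
  then show ?thesis unfolding 1(1) 2(1) using nz by (simp add: eq_fract)
qed

lemma impedance_cong: "series_parallel M \<Longrightarrow> series_parallel N \<Longrightarrow> val M = val N \<Longrightarrow> impedance M = impedance N"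
  by (rule rep_unique[OF rep_impedance]) (use rep_impedance in auto)

lemma impedance_SomeI:
  assumes "series_parallel N" "\<forall>t>0. poly q t > 0" "\<forall>t>0. poly p t > 0"
    "val N = (\<lambda>s. ennreal (poly p (pos s) / poly q (pos s)))"
  shows "impedance N = Some (Fract p q)"
proof (rule rep_unique[OF rep_impedance[OF assms(1)]])
  show "rep (Some (Fract p q)) (val N)" using assms unfolding rep_def by blast
qed

section \<open>Networks realizing the closed sets\<close>

text \<open>\<open>P\<close> constrains the first and third slot, whose resistors give the faces. In
  \<open>fam8\<close> and \<open>fam9\<close> these slots hold G1 and R3, so there
  \<open>noR\<close> means G1 = 0 and \<open>noG\<close> means R3 = 0.\<close>

definition fam4 where "fam4 P = {form4 R1 R2 G3 C1 C2 | R1 R2 G3 C1 C2. R1 \<ge> 0 \<and> R2 > 0 \<and> G3 \<ge> 0 \<and> C1 > 0 \<and> C2 > 0 \<and> P R1 G3}"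
definition fam6 where "fam6 P = {form6 R1 R2 G3 L C | R1 R2 G3 L C. R1 \<ge> 0 \<and> R2 \<ge> 0 \<and> G3 \<ge> 0 \<and> L > 0 \<and> C > 0 \<and> P R1 G3}"
definition fam7 where "fam7 P = {form7 R1 R2 G3 L C | R1 R2 G3 L C. R1 \<ge> 0 \<and> R2 \<ge> 0 \<and> G3 \<ge> 0 \<and> L > 0 \<and> C > 0 \<and> P R1 G3}"
definition fam8 where "fam8 P = {form8 R1 R2 G3 L C | R1 R2 G3 L C. R1 \<ge> 0 \<and> R2 \<ge> 0 \<and> G3 \<ge> 0 \<and> L > 0 \<and> C > 0 \<and> P R1 G3}"
definition fam9 where "fam9 P = {form9 R1 R2 G3 L C | R1 R2 G3 L C. R1 \<ge> 0 \<and> R2 \<ge> 0 \<and> G3 \<ge> 0 \<and> L > 0 \<and> C > 0 \<and> P R1 G3}"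

abbreviation full :: "real \<Rightarrow> real \<Rightarrow> bool" where "full \<equiv> \<lambda>R G. True"
abbreviation noR :: "real \<Rightarrow> real \<Rightarrow> bool" where "noR \<equiv> \<lambda>R G. R = 0"
abbreviation noG :: "real \<Rightarrow> real \<Rightarrow> bool" where "noG \<equiv> \<lambda>R G. G = 0"

definition nets where "nets Q F = {res R4 \<oplus> ((res R5 \<oplus> ind L2) \<parallel> M) | R4 R5 L2 M. R4 \<ge> 0 \<and> R5 \<in> Q \<and> L2 > 0 \<and> M \<in> F}"

lemma sp_fam4: "M \<in> fam4 P \<Longrightarrow> series_parallel M" unfolding fam4_def by (auto intro: sp_form)
lemma sp_fam6: "M \<in> fam6 P \<Longrightarrow> series_parallel M" unfolding fam6_def by (auto intro: sp_form)
lemma sp_fam7: "M \<in> fam7 P \<Longrightarrow> series_parallel M" unfolding fam7_def by (auto intro: sp_form)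

lemma inv_fam6: "inv_net ` fam6 P \<subseteq> fam7 P"
proof
  fix M assume "M \<in> inv_net ` fam6 P"
  then obtain R1 R2 G3 L C where p: "R1 \<ge> 0" "R2 \<ge> 0" "G3 \<ge> 0" "L > 0" "C > 0" "P R1 G3" and "M = form7 R1 R2 G3 (1 / C) (1 / L)"
    unfolding fam6_def by (auto simp: inv_form6)
  moreover have "1 / L > 0" "1 / C > 0" using p by auto
  ultimately show "M \<in> fam7 P" unfolding fam7_def by blast
qed
lemma dual_fam6: "dual_net ` fam6 P \<subseteq> fam8 P"
  unfolding fam6_def fam8_def by (rule image_subsetI) (elim CollectE exE conjE, simp only: dual_form6, blast)
lemma dual_fam7: "dual_net ` fam7 P \<subseteq> fam9 P"
  unfolding fam7_def fam9_def by (rule image_subsetI) (elim CollectE exE conjE, simp only: dual_form7, blast)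

lemma fi_val: "(\<And>M. M \<in> F \<Longrightarrow> series_parallel M) \<Longrightarrow> fi ` val ` F = val ` inv_net ` F"
  unfolding image_image by (rule image_cong[OF refl]) (simp add: val_inv)
lemma fd_val: "(\<And>M. M \<in> F \<Longrightarrow> series_parallel M) \<Longrightarrow> fd ` val ` F = val ` dual_net ` F"
  unfolding image_image by (rule image_cong[OF refl]) (simp add: val_dual)

lemma K6_nets: "K6 \<subseteq> KC \<union> KL \<union> val ` fam6 full"
proof
  fix y assume "y \<in> K6"
  then obtain r1 l r2 g3 c where "y = (\<lambda>s. r1 + prl (l * ennreal (pos s)) (r2 + prl g3 (inverse (c * ennreal (pos s)))))"
    using K6_E by blast
  then show "y \<in> KC \<union> KL \<union> val ` fam6 full" using form6_cases[of r1 l r2 g3 c] unfolding fam6_def by blast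
qed

lemma W17_nets: "W17 \<subseteq> KC \<union> KL \<union> val ` fam6 noG"
proof
  fix y assume "y \<in> W17"
  then obtain r1 l r2 c where y: "y = (\<lambda>s. r1 + prl (l * ennreal (pos s)) (r2 + prl top (inverse (c * ennreal (pos s)))))"
    by (auto simp: W17_def lift2_def RES_def IND_def CAP_def)
  \<comment> \<open>The absent resistor enters as the value infinity and is translated back into G3
    = 0.\<close>
  have "G3 = 0" if "G3 \<ge> 0" "top = inverse (ennreal G3)" for G3 using that by (cases "G3 = 0") (auto simp: inverse_ennreal)
  then show "y \<in> KC \<union> KL \<union> val ` fam6 noG" using form6_cases[of r1 l r2 top c] unfolding fam6_def y by blast
qed

lemma IND_KC_nets: "IND \<boxtimes> KC \<subseteq> KC \<union> KL \<union> val ` fam6 noR"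
proof
  fix y assume "y \<in> IND \<boxtimes> KC"
  then obtain l r2 g3 c where y: "y = (\<lambda>s. 0 + prl (l * ennreal (pos s)) (r2 + prl g3 (inverse (c * ennreal (pos s)))))"
    by (auto simp: KC_def lift2_def RES_def IND_def CAP_def)
  have "R = 0" if "R \<ge> 0" "0 = ennreal R" for R using that by simp
  then show "y \<in> KC \<union> KL \<union> val ` fam6 noR" using form6_cases[of 0 l r2 g3 c] unfolding fam6_def y by blast
qed

lemma KCC_nets: "KCC \<subseteq> KC \<union> val ` fam4 full"
proof
  fix y assume "y \<in> KCC"
  then obtain r1 c2 r2 g3 c1 where "y = (\<lambda>s. r1 + prl (inverse (c2 * ennreal (pos s))) (r2 + prl g3 (inverse (c1 * ennreal (pos s)))))"
    using KCC_E by blast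
  then show "y \<in> KC \<union> val ` fam4 full" using form4_cases[of r1 c2 r2 g3 c1] unfolding fam4_def by blast
qed

lemma W29_nets: "W29 \<subseteq> KC \<union> val ` fam4 noG"
proof
  fix y assume "y \<in> W29"
  then obtain r1 c2 r2 c1 where y: "y = (\<lambda>s. r1 + prl (inverse (c2 * ennreal (pos s))) (r2 + prl top (inverse (c1 * ennreal (pos s)))))"
    by (auto simp: W29_def lift2_def RES_def CAP_def)
  have "G3 = 0" if "G3 \<ge> 0" "top = inverse (ennreal G3)" for G3 using that by (cases "G3 = 0") (auto simp: inverse_ennreal)
  then show "y \<in> KC \<union> val ` fam4 noG" using form4_cases[of r1 c2 r2 top c1] unfolding fam4_def y by blast
qed

lemma nets_fi:
  assumes "W \<subseteq> KC \<union> KL \<union> val ` F" "\<And>M. M \<in> F \<Longrightarrow> series_parallel M" "inv_net ` F \<subseteq> F'"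
  shows "fi ` W \<subseteq> KC \<union> KL \<union> val ` F'"
  using image_mono[OF assms(1), of fi] image_mono[OF assms(3), of val] by (auto simp: image_Un fidK fi_val[OF assms(2)])
lemma nets_fd:
  assumes "W \<subseteq> KC \<union> KL \<union> val ` F" "\<And>M. M \<in> F \<Longrightarrow> series_parallel M" "dual_net ` F \<subseteq> F'"
  shows "fd ` W \<subseteq> KC \<union> KL \<union> val ` F'"
  using image_mono[OF assms(1), of fd] image_mono[OF assms(3), of val] by (auto simp: image_Un fidK fd_val[OF assms(2)])

text \<open>\<open>A\<close> is the set of inductive branches, and \<open>Q\<close> records whether
  R5 is free or 0. \<open>E\<close> collects the degenerate part of \<open>W\<close>, and
  \<open>D\<close> everything that degenerates in the whole network.\<close>

lemma par_nets:
  assumes A: "\<And>X. X \<in> A \<Longrightarrow> X \<in> RES \<or> (\<exists>R L. R \<in> Q \<and> L > 0 \<and> X = val (res R \<oplus> ind L))" "A \<subseteq> RES \<boxplus> IND"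
    and W: "W \<subseteq> E \<union> val ` F" and D: "XL E \<subseteq> D" "RES \<boxplus> (RES \<boxtimes> W) \<subseteq> D" "RES \<subseteq> D"
  shows "RES \<boxplus> (A \<boxtimes> W) \<subseteq> D \<union> val ` nets Q F"
proof
  fix Z assume "Z \<in> RES \<boxplus> (A \<boxtimes> W)"
  then obtain k X y where X: "X \<in> A" "y \<in> W" and Z: "Z = (\<lambda>s. k + prl (X s) (y s))"
    using RES_fadd_parE by blast
  consider "k = top" | "X \<in> RES" | "y \<in> E" | R5 L M where "k \<noteq> top" "R5 \<in> Q" "L > 0" "X = val (res R5 \<oplus> ind L)" "M \<in> F" "y = val M"
    using X W A(1)[OF X(1)] by blast
  then show "Z \<in> D \<union> val ` nets Q F"
  proof cases
    case 1
    then have "Z \<in> RES" unfolding Z by (simp add: RESI)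
    then show ?thesis using D by blast
  next
    case 2
    then have "Z \<in> RES \<boxplus> (RES \<boxtimes> W)" unfolding Z by (intro faddI fparI RESI X)
    then show ?thesis using D by blast
  next
    case 3
    have "X \<in> RES \<boxplus> IND" using X A by blast
    then have "Z \<in> XL E" unfolding Z XL_def using 3 by (intro faddI fparI RESI)
    then show ?thesis using D by blast
  next
    case 4
    obtain R4 where R4: "k = ennreal R4" "R4 \<ge> 0" using 4 ennreal_ge0E by blast
    have "Z = val (res R4 \<oplus> ((res R5 \<oplus> ind L) \<parallel> M))"
      unfolding Z R4 4(4,6) by (simp add: val_ser val_par val_res)
    moreover have "res R4 \<oplus> ((res R5 \<oplus> ind L) \<parallel> M) \<in> nets Q F" using R4 4 unfolding nets_def by blast
    ultimately show ?thesis by blast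
  qed
qed

lemma RES_IND_cases:
  assumes "X \<in> RES \<boxplus> IND"
  shows "X \<in> RES \<or> (\<exists>R L. R \<in> {0..} \<and> L > 0 \<and> X = val (res R \<oplus> ind L))"
proof -
  obtain r l where X: "X = (\<lambda>s. r + l * ennreal (pos s))" using assms by (auto simp: lift2_def RES_def IND_def)
  show ?thesis
  proof (cases "r = top \<or> l = 0 \<or> l = top")
    case True
    then show ?thesis unfolding X by (auto simp: ennreal_top_mult RESI)
  next
    case False
    obtain R where R: "r = ennreal R" "R \<ge> 0" using False ennreal_ge0E by blast
    obtain L where L: "l = ennreal L" "L > 0" using False ennreal_posE by metis
    have "X = val (res R \<oplus> ind L)" unfolding X R L by (simp add: val_ser val_res)
    then show ?thesis using R L by auto
  qed
qed

lemma IND_cases: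
  assumes "X \<in> IND"
  shows "X \<in> RES \<or> (\<exists>R L. R \<in> {0} \<and> L > 0 \<and> X = val (res R \<oplus> ind L))"
proof -
  obtain l where X: "X = (\<lambda>s. l * ennreal (pos s))" using assms by (auto simp: IND_def)
  show ?thesis
  proof (cases "l = 0 \<or> l = top")
    case True
    then show ?thesis unfolding X by (auto simp: ennreal_top_mult RESI)
  next
    case False
    obtain L where L: "l = ennreal L" "L > 0" using False ennreal_posE by metis
    have "X = val (res 0 \<oplus> ind L)" unfolding X L by (simp add: val_ser val_res)
    then show ?thesis using L by blast
  qed
qed

lemma XL_nets:
  assumes "W \<subseteq> E \<union> val ` F" "XL E \<subseteq> D" "RES \<boxplus> (RES \<boxtimes> W) \<subseteq> D" "RES \<subseteq> D"
  shows "XL W \<subseteq> D \<union> val ` nets {0..} F"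
  unfolding XL_def by (rule par_nets[OF _ order_refl assms]) (rule RES_IND_cases)

lemma IND_nets:
  assumes "W \<subseteq> E \<union> val ` F" "XL E \<subseteq> D" "RES \<boxplus> (RES \<boxtimes> W) \<subseteq> D" "RES \<subseteq> D"
  shows "RES \<boxplus> (IND \<boxtimes> W) \<subseteq> D \<union> val ` nets {0} F"
  by (rule par_nets[OF _ fadd_superset[OF RESI] assms]) (rule IND_cases)

lemma KC_nets: "KC \<subseteq> RES \<union> val ` class2"
proof
  fix y assume "y \<in> KC"
  then obtain r g c where "y = (\<lambda>s. r + prl g (inverse (c * ennreal (pos s))))"
    by (auto simp: KC_def lift2_def RES_def CAP_def)
  then show "y \<in> RES \<union> val ` class2" using KC_cases[of r g c] unfolding class2_def form2_def by blast
qed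

lemma sp_class2: "M \<in> class2 \<Longrightarrow> series_parallel M" unfolding class2_def by (auto intro!: sp_intros)

lemma inv_class2: "inv_net ` class2 \<subseteq> class3"
proof
  fix M assume "M \<in> inv_net ` class2"
  then obtain R G C where "R \<ge> 0" "G \<ge> 0" "C > 0" "M = res R \<oplus> (cond G \<parallel> ind (1 / C))"
    unfolding class2_def by (auto simp: inv_ser inv_par inv_res inv_cond)
  moreover have "1 / C > 0" using \<open>C > 0\<close> by simp
  ultimately show "M \<in> class3" unfolding class3_def by blast
qed

lemma KL_nets: "KL \<subseteq> RES \<union> val ` class3"
proof -
  have "KL \<subseteq> RES \<union> val ` inv_net ` class2"
    using image_mono[OF KC_nets, of fi] by (simp add: image_Un fidK fi_val[OF sp_class2])
  then show ?thesis using inv_class2 by blast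
qed

lemma RES_nets: "f \<in> RES \<Longrightarrow> f \<noteq> (\<lambda>s. top) \<Longrightarrow> f \<in> val ` class1"
proof -
  assume "f \<in> RES" "f \<noteq> (\<lambda>s. top)"
  then obtain k where "f = (\<lambda>s. k)" "k \<noteq> top" by (auto simp: RES_def)
  then obtain r where r: "f = (\<lambda>s. ennreal r)" "r \<ge> 0" using ennreal_ge0E by metis
  then have "f = val (res r)" by (simp add: val_res)
  then show ?thesis using r unfolding class1_def by blast
qed

lemma fam_class:
  "fam4 full = class4" "fam6 full = class6" "fam7 full = class7" "fam8 full = class8" "fam9 full = class9"
  unfolding fam4_def fam6_def fam7_def fam8_def fam9_def class4_def class6_def class7_def class8_def class9_def form_defs
  by simp_all

lemma K_nets:
  "K6 \<subseteq> (KC \<union> KL) \<union> val ` fam6 full" "K7 \<subseteq> (KC \<union> KL) \<union> val ` fam7 full"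
  "K8 \<subseteq> (KC \<union> KL) \<union> val ` fam8 full" "K9 \<subseteq> (KC \<union> KL) \<union> val ` fam9 full"
proof -
  show 6: "K6 \<subseteq> (KC \<union> KL) \<union> val ` fam6 full" by (rule K6_nets)
  show 7: "K7 \<subseteq> (KC \<union> KL) \<union> val ` fam7 full" using nets_fi[OF 6 sp_fam6 inv_fam6] by (simp only: fi_K6)
  show "K8 \<subseteq> (KC \<union> KL) \<union> val ` fam8 full" using nets_fd[OF 6 sp_fam6 dual_fam6] by (simp only: fd_K6)
  show "K9 \<subseteq> (KC \<union> KL) \<union> val ` fam9 full" using nets_fd[OF 7 sp_fam7 dual_fam7] by (simp only: fd_K7)
qed

lemma W_nets:
  "W17 \<subseteq> (KC \<union> KL) \<union> val ` fam6 noG" "W20 \<subseteq> (KC \<union> KL) \<union> val ` fam7 noG"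
  "W23 \<subseteq> (KC \<union> KL) \<union> val ` fam8 noG" "W26 \<subseteq> (KC \<union> KL) \<union> val ` fam9 noG"
  "W22 \<subseteq> (KC \<union> KL) \<union> val ` fam8 noR" "W25 \<subseteq> (KC \<union> KL) \<union> val ` fam9 noR"
proof -
  show 1: "W17 \<subseteq> (KC \<union> KL) \<union> val ` fam6 noG" by (rule W17_nets)
  show 2: "W20 \<subseteq> (KC \<union> KL) \<union> val ` fam7 noG" using nets_fi[OF 1 sp_fam6 inv_fam6] by (simp only: fi_W17)
  show "W23 \<subseteq> (KC \<union> KL) \<union> val ` fam8 noG" using nets_fd[OF 1 sp_fam6 dual_fam6] by (simp only: fd_W17)
  show "W26 \<subseteq> (KC \<union> KL) \<union> val ` fam9 noG" using nets_fd[OF 2 sp_fam7 dual_fam7] by (simp only: fd_W20)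
  show "W22 \<subseteq> (KC \<union> KL) \<union> val ` fam8 noR" using nets_fd[OF IND_KC_nets sp_fam6 dual_fam6] by (simp only: fd_INDKC)
  have "CAP \<boxtimes> KL \<subseteq> (KC \<union> KL) \<union> val ` fam7 noR" using nets_fi[OF IND_KC_nets sp_fam6 inv_fam6] by (simp only: fi_fpar fi_IND fi_KC)
  from nets_fd[OF this sp_fam7 dual_fam7] show "W25 \<subseteq> (KC \<union> KL) \<union> val ` fam9 noR" by (simp only: fd_CAPKL)
qed

lemma base_nets:
  assumes "f \<in> KCL \<union> KCC" "f \<noteq> (\<lambda>s. top)"
  shows "f \<in> val ` \<Union> base_classes"
proof -
  note K = K_nets[unfolded fam_class]
  have "KCC \<subseteq> KC \<union> val ` class4" using KCC_nets unfolding fam_class .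
  moreover have "KCL \<subseteq> KC \<union> KL \<union> val ` class6 \<union> val ` class7 \<union> val ` class8 \<union> val ` class9"
    unfolding KCL_def using K by blast
  ultimately have "f \<in> KC \<union> KL \<union> val ` class4 \<union> val ` class6 \<union> val ` class7 \<union> val ` class8 \<union> val ` class9"
    using assms(1) by blast
  then have "f \<in> RES \<union> val ` class2 \<union> val ` class3 \<union> val ` class4 \<union> val ` class6 \<union> val ` class7 \<union> val ` class8 \<union> val ` class9"
    using KC_nets KL_nets by blast
  then have "f \<in> val ` class1 \<union> val ` class2 \<union> val ` class3 \<union> val ` class4 \<union> val ` class6 \<union> val ` class7 \<union> val ` class8 \<union> val ` class9"
    using RES_nets assms(2) by blast
  then show ?thesis unfolding base_classes_def by blast
qed

lemma nets_fam6: "M \<in> nets Q (fam6 P) \<Longrightarrow> \<exists>a b c d e l1 l2 c1. a \<ge> 0 \<and> b \<ge> 0 \<and> c \<ge> 0 \<and> d \<ge> 0 \<and> e \<in> Q \<and>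
    l1 > 0 \<and> l2 > 0 \<and> c1 > 0 \<and> P a c \<and> M = N10 a b c d e l1 l2 c1"
  unfolding nets_def fam6_def form6_def N10_def by blast
lemma nets_fam7: "M \<in> nets Q (fam7 P) \<Longrightarrow> \<exists>a b c d e l1 l2 c1. a \<ge> 0 \<and> b \<ge> 0 \<and> c \<ge> 0 \<and> d \<ge> 0 \<and> e \<in> Q \<and>
    l1 > 0 \<and> l2 > 0 \<and> c1 > 0 \<and> P a c \<and> M = N11 a b c d e l1 l2 c1"
  unfolding nets_def fam7_def form7_def N11_def by blast
lemma nets_fam8: "M \<in> nets Q (fam8 P) \<Longrightarrow> \<exists>a b c d e l1 l2 c1. a \<ge> 0 \<and> b \<ge> 0 \<and> c \<ge> 0 \<and> d \<ge> 0 \<and> e \<in> Q \<and>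
    l1 > 0 \<and> l2 > 0 \<and> c1 > 0 \<and> P a c \<and> M = N12 a b c d e l1 l2 c1"
  unfolding nets_def fam8_def form8_def N12_def by blast
lemma nets_fam9: "M \<in> nets Q (fam9 P) \<Longrightarrow> \<exists>a b c d e l1 l2 c1. a \<ge> 0 \<and> b \<ge> 0 \<and> c \<ge> 0 \<and> d \<ge> 0 \<and> e \<in> Q \<and>
    l1 > 0 \<and> l2 > 0 \<and> c1 > 0 \<and> P a c \<and> M = N13 a b c d e l1 l2 c1"
  unfolding nets_def fam9_def form9_def N13_def by blast

lemma nets_class17: "nets {0..} (fam6 noG) \<subseteq> class17" and nets_class18: "nets {0} (fam6 full) \<subseteq> class18"
  unfolding class17_def class18_def by (rule subsetI, drule nets_fam6, simp only: atLeast_iff singleton_iff, blast)+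
lemma nets_class20: "nets {0..} (fam7 noG) \<subseteq> class20" and nets_class21: "nets {0} (fam7 full) \<subseteq> class21"
  unfolding class20_def class21_def by (rule subsetI, drule nets_fam7, simp only: atLeast_iff singleton_iff, blast)+
lemma nets_class22: "nets {0..} (fam8 noR) \<subseteq> class22" and nets_class23: "nets {0..} (fam8 noG) \<subseteq> class23"
  and nets_class24: "nets {0} (fam8 full) \<subseteq> class24"
  unfolding class22_def class23_def class24_def by (rule subsetI, drule nets_fam8, simp only: atLeast_iff singleton_iff, blast)+
lemma nets_class25: "nets {0..} (fam9 noR) \<subseteq> class25" and nets_class26: "nets {0..} (fam9 noG) \<subseteq> class26"
  and nets_class27: "nets {0} (fam9 full) \<subseteq> class27"
  unfolding class25_def class26_def class27_def by (rule subsetI, drule nets_fam9, simp only: atLeast_iff singleton_iff, blast)+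

text \<open>\<open>N14\<close> has two inductors, so its networks arise from an inductive branch
  beside \<open>form4\<close> by s -> 1/s, which replaces the storage values by their
  reciprocals.\<close>

lemma nets_fam4: "M \<in> inv_net ` nets Q (fam4 P) \<Longrightarrow> \<exists>a b c d e l1 l2 c1. a \<ge> 0 \<and> b > 0 \<and> c \<ge> 0 \<and> d \<ge> 0 \<and> e \<in> Q \<and>
    l1 > 0 \<and> l2 > 0 \<and> c1 > 0 \<and> P a c \<and> M = N14 a b c d e l1 l2 c1"
proof -
  assume "M \<in> inv_net ` nets Q (fam4 P)"
  then obtain R4 R5 L2 R1 R2 G3 C1 C2 where p: "R4 \<ge> 0" "R5 \<in> Q" "L2 > 0" "R1 \<ge> 0" "R2 > 0" "G3 \<ge> 0" "C1 > 0" "C2 > 0" "P R1 G3"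
    "M = inv_net (res R4 \<oplus> ((res R5 \<oplus> ind L2) \<parallel> form4 R1 R2 G3 C1 C2))" unfolding nets_def fam4_def by blast
  have "M = N14 R1 R2 G3 R4 R5 (1 / C1) (1 / C2) (1 / L2)"
    unfolding p(10) form4_def N14_def by (simp add: inv_ser inv_par inv_res inv_cond)
  moreover have "1 / C1 > 0" "1 / C2 > 0" "1 / L2 > 0" using p by auto
  ultimately show ?thesis using p(1-9) by blast
qed
lemma inv_nets_class: "inv_net ` nets {0..} (fam4 noG) \<subseteq> class29" "inv_net ` nets {0} (fam4 full) \<subseteq> class30"
  unfolding class29_def class30_def by (rule subsetI, drule nets_fam4, simp only: atLeast_iff singleton_iff, blast)+

lemma sp_N:
  "R1 \<ge> 0 \<Longrightarrow> R2 \<ge> 0 \<Longrightarrow> G3 \<ge> 0 \<Longrightarrow> R4 \<ge> 0 \<Longrightarrow> R5 \<ge> 0 \<Longrightarrow> L1 > 0 \<Longrightarrow> L2 > 0 \<Longrightarrow> C1 > 0 \<Longrightarrow> series_parallel (N10 R1 R2 G3 R4 R5 L1 L2 C1)"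
  "R1 \<ge> 0 \<Longrightarrow> R2 \<ge> 0 \<Longrightarrow> G3 \<ge> 0 \<Longrightarrow> R4 \<ge> 0 \<Longrightarrow> R5 \<ge> 0 \<Longrightarrow> L1 > 0 \<Longrightarrow> L2 > 0 \<Longrightarrow> C1 > 0 \<Longrightarrow> series_parallel (N11 R1 R2 G3 R4 R5 L1 L2 C1)"
  "R1 \<ge> 0 \<Longrightarrow> R2 \<ge> 0 \<Longrightarrow> G3 \<ge> 0 \<Longrightarrow> R4 \<ge> 0 \<Longrightarrow> R5 \<ge> 0 \<Longrightarrow> L1 > 0 \<Longrightarrow> L2 > 0 \<Longrightarrow> C1 > 0 \<Longrightarrow> series_parallel (N12 R1 R2 G3 R4 R5 L1 L2 C1)"
  "R1 \<ge> 0 \<Longrightarrow> R2 \<ge> 0 \<Longrightarrow> G3 \<ge> 0 \<Longrightarrow> R4 \<ge> 0 \<Longrightarrow> R5 \<ge> 0 \<Longrightarrow> L1 > 0 \<Longrightarrow> L2 > 0 \<Longrightarrow> C1 > 0 \<Longrightarrow> series_parallel (N13 R1 R2 G3 R4 R5 L1 L2 C1)"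
  "R1 \<ge> 0 \<Longrightarrow> R2 \<ge> 0 \<Longrightarrow> G3 \<ge> 0 \<Longrightarrow> R4 \<ge> 0 \<Longrightarrow> R5 \<ge> 0 \<Longrightarrow> L1 > 0 \<Longrightarrow> L2 > 0 \<Longrightarrow> C1 > 0 \<Longrightarrow> series_parallel (N14 R1 R2 G3 R4 R5 L1 L2 C1)"
  unfolding N10_def N11_def N12_def N13_def N14_def by (intro sp_intros; assumption)+

text \<open>The condition \<open>a * b * c * e = 0\<close> records that at least one of the five resistors is missing.\<close>

definition shapes :: "network set" where
  "shapes = {N a b c d e l1 l2 c1 | N a b c d e l1 l2 c1. N \<in> {N10, N11, N12, N13, N14} \<and>
     a \<ge> 0 \<and> b \<ge> 0 \<and> c \<ge> 0 \<and> d \<ge> 0 \<and> e \<ge> 0 \<and> l1 > 0 \<and> l2 > 0 \<and> c1 > 0 \<and> a * b * c * e = 0}"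

lemma shapesI:
  assumes "N \<in> {N10, N11, N12, N13, N14}"
    "a \<ge> 0" "b \<ge> 0" "c \<ge> 0" "d \<ge> 0" "e \<ge> 0" "l1 > 0" "l2 > 0" "c1 > 0" "a * b * c * e = 0"
  shows "N a b c d e l1 l2 c1 \<in> shapes"
  using assms unfolding shapes_def by blast

lemma three_storage_shapes: "\<Union> three_storage_classes \<subseteq> shapes"
  unfolding three_storage_classes_def class17_def class18_def class20_def class21_def class22_def class23_def class24_def
    class25_def class26_def class27_def class29_def class30_def
  by (auto intro!: shapesI)

lemma sp_shapes: "M \<in> shapes \<Longrightarrow> series_parallel M"
  unfolding shapes_def using sp_N by auto

text \<open>Each piece of \<open>GA\<close> is matched with its class; what degenerates needs only
  two storage elements and lies in \<open>KCL\<close> or \<open>KLL\<close>.\<close>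

lemma GA_nets: "GA \<subseteq> KCL \<union> KLL \<union> val ` \<Union> three_storage_classes"
proof -
  let ?D = "KCL \<union> KLL"
  have RK: "RES \<boxplus> (RES \<boxtimes> KCL) \<subseteq> KCL"
  proof -
    have "RES \<boxplus> (RES \<boxtimes> KCL) \<subseteq> RES \<boxplus> KCL" by (intro lift2_mono order_refl RES_KCL)
    then show ?thesis using RES_KCL(1) by blast
  qed
  have RW: "RES \<boxplus> (RES \<boxtimes> W) \<subseteq> ?D" if "W \<subseteq> KCL" for W
  proof -
    have "RES \<boxplus> (RES \<boxtimes> W) \<subseteq> RES \<boxplus> (RES \<boxtimes> KCL)" by (intro lift2_mono order_refl that)
    then show ?thesis using RK by blast
  qed
  have XLE: "XL (KC \<union> KL) \<subseteq> ?D"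
  proof -
    have "XL (KC \<union> KL) = XL KC \<union> XL KL" unfolding XL_def lift2_Un ..
    then show ?thesis using XL_KC XL_KL by blast
  qed
  have RD: "RES \<subseteq> ?D" using const_KCL by (auto simp: RES_def)
  have KW: "K6 \<subseteq> KCL" "K7 \<subseteq> KCL" "K8 \<subseteq> KCL" "K9 \<subseteq> KCL" by (auto simp: KCL_def)
  have "W17 \<subseteq> K6" unfolding W17_def K6_def KC_def
    by (intro lift2_mono order_refl fpar_superset RESI)
  then have W: "W17 \<subseteq> KCL" using KW by blast
  have W20: "W20 \<subseteq> KCL" using image_mono[OF W, of fi] by (simp add: fi_W17 fidK)
  have W23: "W23 \<subseteq> KCL" using image_mono[OF W, of fd] by (simp add: fd_W17 fidK)
  have W26: "W26 \<subseteq> KCL" using image_mono[OF W20, of fd] by (simp add: fd_W20 fidK)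
  have "IND \<boxtimes> KC \<subseteq> K6" unfolding K6_def by (intro fadd_superset RESI)
  then have I: "IND \<boxtimes> KC \<subseteq> KCL" using KW by blast
  have W22: "W22 \<subseteq> KCL" using image_mono[OF I, of fd] by (simp add: fd_INDKC fd_KCL)
  have "CAP \<boxtimes> KL \<subseteq> KCL" using image_mono[OF I, of fi] by (simp add: fidK)
  then have W25: "W25 \<subseteq> KCL" using image_mono[of "CAP \<boxtimes> KL" KCL fd] by (simp add: fd_CAPKL fd_KCL)
  have X: "XL W \<subseteq> ?D \<union> val ` c"
    if "W \<subseteq> (KC \<union> KL) \<union> val ` F" "W \<subseteq> KCL" "nets {0..} F \<subseteq> c" for W F c
    using XL_nets[OF that(1) XLE RW[OF that(2)] RD] image_mono[OF that(3), of val] by blast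
  have X0: "RES \<boxplus> (IND \<boxtimes> W) \<subseteq> ?D \<union> val ` c"
    if "W \<subseteq> (KC \<union> KL) \<union> val ` F" "W \<subseteq> KCL" "nets {0} F \<subseteq> c" for W F c
    using IND_nets[OF that(1) XLE RW[OF that(2)] RD] image_mono[OF that(3), of val] by blast
  let ?T = "\<Union> three_storage_classes"
  have T: "class17 \<subseteq> ?T" "class18 \<subseteq> ?T" "class20 \<subseteq> ?T" "class21 \<subseteq> ?T" "class22 \<subseteq> ?T" "class23 \<subseteq> ?T" "class24 \<subseteq> ?T"
    "class25 \<subseteq> ?T" "class26 \<subseteq> ?T" "class27 \<subseteq> ?T" "class29 \<subseteq> ?T" "class30 \<subseteq> ?T"
    unfolding three_storage_classes_def by (rule Union_upper, simp)+
  note A = X[OF W_nets(1) W order_trans[OF nets_class17 T(1)]] X[OF W_nets(2) W20 order_trans[OF nets_class20 T(3)]]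
    X[OF W_nets(5) W22 order_trans[OF nets_class22 T(5)]] X[OF W_nets(3) W23 order_trans[OF nets_class23 T(6)]]
    X[OF W_nets(6) W25 order_trans[OF nets_class25 T(8)]] X[OF W_nets(4) W26 order_trans[OF nets_class26 T(9)]]
  have B: "RES \<boxplus> (IND \<boxtimes> KCL) \<subseteq> ?D \<union> val ` ?T"
  proof -
    have "RES \<boxplus> (IND \<boxtimes> KCL) = RES \<boxplus> (IND \<boxtimes> K6) \<union> RES \<boxplus> (IND \<boxtimes> K7) \<union> RES \<boxplus> (IND \<boxtimes> K8) \<union> RES \<boxplus> (IND \<boxtimes> K9)"
      unfolding KCL_def lift2_Un ..
    moreover note X0[OF K_nets(1) KW(1) order_trans[OF nets_class18 T(2)]]
    moreover note X0[OF K_nets(2) KW(2) order_trans[OF nets_class21 T(4)]]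
    moreover note X0[OF K_nets(3) KW(3) order_trans[OF nets_class24 T(7)]]
    moreover note X0[OF K_nets(4) KW(4) order_trans[OF nets_class27 T(10)]]
    ultimately show ?thesis by (simp only: Un_subset_iff)
  qed
  \<comment> \<open>The last two classes are treated before the substitution s -> 1/s, where the
    degenerate part contains two capacitors instead of two inductors.\<close>
  let ?E = "KCL \<union> KCC"
  have XE: "XL KC \<subseteq> ?E" using XL_KC by blast
  have RE: "RES \<boxplus> (RES \<boxtimes> KCC) \<subseteq> ?E" by (simp add: RES_KCC)
  have REE: "RES \<subseteq> ?E" using const_KCL by (auto simp: RES_def)
  have "W29 \<subseteq> KCC" unfolding W29_def KCC_def KC_def
    by (intro lift2_mono order_refl fpar_superset RESI)
  then have "RES \<boxplus> (RES \<boxtimes> W29) \<subseteq> RES \<boxplus> (RES \<boxtimes> KCC)" by (intro lift2_mono order_refl)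
  then have "RES \<boxplus> (RES \<boxtimes> W29) \<subseteq> ?E" using RE by (rule order_trans)
  then have 29: "XL W29 \<subseteq> ?E \<union> val ` nets {0..} (fam4 noG)" by (rule XL_nets[OF W29_nets XE _ REE])
  have 30: "RES \<boxplus> (IND \<boxtimes> KCC) \<subseteq> ?E \<union> val ` nets {0} (fam4 full)" by (rule IND_nets[OF KCC_nets XE RE REE])
  have sp: "M \<in> nets {0..} (fam4 noG) \<Longrightarrow> series_parallel M" "M \<in> nets {0} (fam4 full) \<Longrightarrow> series_parallel M" for M
    unfolding nets_def using sp_fam4 by (auto intro!: sp_intros)
  have E: "fi ` ?E = ?D" by (simp add: image_Un fidK)
  have v: "fi ` val ` nets {0..} (fam4 noG) = val ` inv_net ` nets {0..} (fam4 noG)" "fi ` val ` nets {0} (fam4 full) = val ` inv_net ` nets {0} (fam4 full)"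
    by (rule fi_val, rule sp, assumption)+
  have i: "val ` inv_net ` nets {0..} (fam4 noG) \<subseteq> val ` ?T" "val ` inv_net ` nets {0} (fam4 full) \<subseteq> val ` ?T"
    by (rule image_mono[OF order_trans[OF inv_nets_class(1) T(11)]], rule image_mono[OF order_trans[OF inv_nets_class(2) T(12)]])
  have C1: "fi ` XL W29 \<subseteq> ?D \<union> val ` ?T"
    by (rule order_trans[OF image_mono[OF 29]], unfold image_Un[of fi ?E] E v, rule Un_mono[OF order_refl i(1)])
  have C2: "fi ` (RES \<boxplus> (IND \<boxtimes> KCC)) \<subseteq> ?D \<union> val ` ?T"
    by (rule order_trans[OF image_mono[OF 30]], unfold image_Un[of fi ?E] E v, rule Un_mono[OF order_refl i(2)])
  have D: "KCL \<subseteq> ?D \<union> val ` ?T" "KLL \<subseteq> ?D \<union> val ` ?T"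
    by (rule order_trans[OF Un_upper1 Un_upper1], rule order_trans[OF Un_upper2 Un_upper1])
  show ?thesis unfolding GA_def by (rule Un_least)+ (rule A B C1 C2 D)+
qed

lemma sp_three: "M \<in> \<Union> three_storage_classes \<Longrightarrow> series_parallel M"
  using three_storage_shapes sp_shapes by blast

text \<open>The infinite function belongs to the closed sets but is not the value of a rational
  impedance, so it is excluded.\<close>

lemma K21_nets:
  assumes "f \<in> K21" "f \<noteq> (\<lambda>s. top)"
  shows "\<exists>M \<in> \<Union> classes_2_1. val M = f"
proof -
  define T where "T = \<Union> three_storage_classes"
  have sp: "M \<in> T \<Longrightarrow> series_parallel M" for M unfolding T_def by (rule sp_three)
  have G: "GA \<subseteq> (KCL \<union> KLL) \<union> val ` T" unfolding T_def by (rule GA_nets)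
  have v: "fi ` val ` T = val ` inv_net ` T" "fd ` val ` T = val ` dual_net ` T"
    by (rule fi_val, rule sp, assumption, rule fd_val, rule sp)
  have 1: "fi ` GA \<subseteq> (KCL \<union> KCC) \<union> val ` inv_net ` T"
    using image_mono[OF G, of fi] unfolding image_Un fi_KCL fi_KLL v .
  have 2: "fd ` GA \<subseteq> (KCL \<union> KCC) \<union> val ` dual_net ` T"
    using image_mono[OF G, of fd] unfolding image_Un fd_KCL fd_KLL v .
  have c: "\<Union> base_classes \<subseteq> \<Union> classes_2_1" "inv_net ` T \<subseteq> \<Union> classes_2_1" "dual_net ` T \<subseteq> \<Union> classes_2_1"
    unfolding classes_2_1_def T_def image_Union by blast+
  have b: "f \<in> KCL \<union> KCC \<Longrightarrow> f \<in> val ` \<Union> classes_2_1"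
    by (rule subsetD[OF image_mono[OF c(1)] base_nets[OF _ assms(2)]])
  have "f \<in> fi ` GA \<union> fd ` GA" by (rule subsetD[OF K21_le assms(1)])
  then have "f \<in> val ` \<Union> classes_2_1"
  proof (rule UnE)
    assume "f \<in> fi ` GA"
    from subsetD[OF 1 this] show ?thesis
      by (rule UnE) (erule b, rule subsetD[OF image_mono[OF c(2)]])
  next
    assume "f \<in> fd ` GA"
    from subsetD[OF 2 this] show ?thesis
      by (rule UnE) (erule b, rule subsetD[OF image_mono[OF c(3)]])
  qed
  then show ?thesis by (rule imageE) (rule bexI, rule sym)
qed

subsection \<open>Counting elements, dimension and genericity\<close>

lemma num_ser: "num_resistors (M \<oplus> N) = num_resistors M + num_resistors N"
  "num_inductors (M \<oplus> N) = num_inductors M + num_inductors N"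
  "num_capacitors (M \<oplus> N) = num_capacitors M + num_capacitors N"
  by (auto simp: ser_def)
lemma num_par: "num_resistors (M \<parallel> N) = num_resistors M + num_resistors N"
  "num_inductors (M \<parallel> N) = num_inductors M + num_inductors N"
  "num_capacitors (M \<parallel> N) = num_capacitors M + num_capacitors N"
  by (auto simp: par_def)
lemma num_res: "num_resistors (res R) = (if R = 0 then 0 else 1)" "num_inductors (res R) = 0" "num_capacitors (res R) = 0"
  by (auto simp: res_def)
lemma num_cond: "num_resistors (cond R) = (if R = 0 then 0 else 1)" "num_inductors (cond R) = 0" "num_capacitors (cond R) = 0"
  by (auto simp: cond_def)
lemmas num_simps = num_ser num_par num_res num_cond num_storage_def num_elements_def

lemma num_inv: "num_resistors (inv_net N) = num_resistors N" "num_storage (inv_net N) = num_storage N"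
  by (induction N) (auto simp: num_storage_def)
lemma num_dual: "num_resistors (dual_net N) = num_resistors N" "num_storage (dual_net N) = num_storage N"
  by (induction N) (auto simp: num_storage_def)

lemma num_shapes: "M \<in> shapes \<Longrightarrow> num_storage M = 3" "M \<in> shapes \<Longrightarrow> num_elements M < 8"
  unfolding shapes_def
  by (auto simp: N10_def N11_def N12_def N13_def N14_def num_simps)

text \<open>
  The classes are grouped by the number of energy storage elements before genericity is shown. Taken
  alone, the classes \<open>N\<^sub>2\<^sub>5\<^sup>d\<close> and \<open>N\<^sub>2\<^sub>5\<^sup>i\<close> contain networks with seven elements; but all impedances of
  \<open>N\<^sub>2\<^sub>5\<close> have a pole at \<open>\<infinity>\<close>, so that the coefficient vectors of these two classes lie in
  hyperplanes and form sets of dimension at most seven.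
\<close>

definition U2 where "U2 = class2 \<union> class3"
definition U4 where "U4 = class4 \<union> class6 \<union> class7 \<union> class8 \<union> class9"
definition U3 where "U3 = dual_net ` \<Union> three_storage_classes \<union> inv_net ` \<Union> three_storage_classes"

lemma classes_2_1_eq: "\<Union> classes_2_1 = \<Union> {class1, U2, U4, U3}"
  unfolding classes_2_1_def base_classes_def U2_def U4_def U3_def
  by (simp only: Union_Un_distrib image_Union[symmetric] Union_insert Union_empty Un_empty_right Un_assoc)

lemma num_class1: "M \<in> class1 \<Longrightarrow> num_storage M = 0" "M \<in> class1 \<Longrightarrow> num_elements M < 2"
  unfolding class1_def by (auto simp: num_simps)
lemma num_U2: "M \<in> U2 \<Longrightarrow> num_storage M = 1" "M \<in> U2 \<Longrightarrow> num_elements M < 4"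
  unfolding U2_def class2_def class3_def by (auto simp: num_simps)
lemma num_U4: "M \<in> U4 \<Longrightarrow> num_storage M = 2" "M \<in> U4 \<Longrightarrow> num_elements M < 6"
  unfolding U4_def class4_def class6_def class7_def class8_def class9_def by (auto simp: num_simps)
lemma num_U3: assumes "M \<in> U3" shows "num_storage M = 3" "num_elements M < 8"
proof -
  note assms
  then obtain N where N: "N \<in> shapes" "M = dual_net N \<or> M = inv_net N"
    using three_storage_shapes unfolding U3_def by blast
  show "num_storage M = 3" using N(2) num_shapes(1)[OF N(1)] by (auto simp: num_inv num_dual)
  show "num_elements M < 8" using N(2) num_shapes(2)[OF N(1)] by (auto simp: num_elements_def num_inv num_dual)
qed

lemma sp_class1: "M \<in> class1 \<Longrightarrow> series_parallel M"
  unfolding class1_def by (auto intro: sp_intros)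
lemma sp_U2: "M \<in> U2 \<Longrightarrow> series_parallel M"
  unfolding U2_def class2_def class3_def by (auto intro!: sp_intros)
lemma sp_U4: "M \<in> U4 \<Longrightarrow> series_parallel M"
  unfolding U4_def class4_def class6_def class7_def class8_def class9_def by (auto intro!: sp_intros)
lemma sp_U3: "M \<in> U3 \<Longrightarrow> series_parallel M"
  unfolding U3_def using sp_three sp_dual sp_inv by blast

lemma generating_2_1: "generating_set 2 1 (\<Union> classes_2_1)"
  unfolding generating_set_def
proof (intro conjI ballI)
  fix N assume "N \<in> \<Union> classes_2_1"
  then have "N \<in> class1 \<or> N \<in> U2 \<or> N \<in> U4 \<or> N \<in> U3" unfolding classes_2_1_eq by blast
  then show "series_parallel N" "num_storage N \<le> 2 + 1"
    using sp_class1 sp_U2 sp_U4 sp_U3 num_class1(1) num_U2(1) num_U4(1) num_U3(1) by auto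
next
  fix Z assume "Z \<in> Z_set 2 1"
  then obtain N where N: "series_parallel N" "num_capacitors N \<le> 2" "num_inductors N \<le> 1" "impedance N = Some Z"
    unfolding Z_set_def by blast
  have "val N \<noteq> (\<lambda>s. top)"
  proof
    assume "val N = (\<lambda>s. top)"
    then have "impedance N = None" using rep_top[of "impedance N"] rep_impedance[OF N(1)] by simp
    then show False using N(4) by simp
  qed
  then obtain M where M: "M \<in> \<Union> classes_2_1" "val M = val N" using K21_nets[OF val_K21[OF N(2,3)]] by blast
  then have "M \<in> class1 \<or> M \<in> U2 \<or> M \<in> U4 \<or> M \<in> U3" unfolding classes_2_1_eq by blast
  then have "series_parallel M" using sp_class1 sp_U2 sp_U4 sp_U3 by blast
  then have "impedance M = Some Z" using impedance_cong[OF _ N(1) M(2)] N(4) by simp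
  then show "\<exists>N\<in>\<Union> classes_2_1. impedance N = Some Z" using M(1) by blast
qed

section \<open>Dimension of realizability sets\<close>

text \<open>Invariance of domain bounds the dimension by the number of coordinates.\<close>

lemma cube_embeds_le:
  fixes S :: "(nat \<Rightarrow> real) set"
  assumes S: "\<And>v k. v \<in> S \<Longrightarrow> k \<ge> CARD('n::finite) \<Longrightarrow> v k = 0" and e: "cube_embeds e S"
  shows "e \<le> CARD('n)"
proof (rule ccontr)
  let ?d = "CARD('n)"
  assume "\<not> e \<le> ?d"
  then have ed: "?d < e" by simp
  obtain \<phi> where im: "\<phi> ` open_cube e \<subseteq> S" and inj: "inj_on \<phi> (open_cube e)" and sm: "\<And>j. smooth_on_cube e (\<lambda>x. \<phi> x j)"
    using e unfolding cube_embeds_def by blast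
  have cont: "continuous_on (open_cube e) (\<lambda>x. \<phi> x j)" for j
    using sm[of j] unfolding smooth_on_cube_def by (auto dest: bspec[of _ _ "[]"])
  obtain h :: "'n \<Rightarrow> nat" where h: "bij_betw h UNIV {..<?d}"
    using ex_bij_betw_finite_nat[of "UNIV :: 'n set"] by (auto simp: atLeast0LessThan)
  define g where "g = inv_into UNIV h"
  have gh: "g (h i) = i" for i using h unfolding g_def bij_betw_def by simp
  have hd: "h i < ?d" for i using h unfolding bij_betw_def by blast
  have hg: "h (g k) = k" if "k < ?d" for k
    unfolding g_def using h that by (intro f_inv_into_f) (auto simp: bij_betw_def)
  \<comment> \<open>Embeds a unit ball of dimension d + 1 in the cube; the extra coordinate sits at
    index d, which is available because d < e.\<close>
  define E :: "real \<times> (real ^ 'n) \<Rightarrow> nat \<Rightarrow> real" where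
    "E z = (\<lambda>k. if k < ?d then snd z $ g k else if k = ?d then fst z else 0)" for z
  define U :: "(real \<times> (real ^ 'n)) set" where "U = ball 0 1"
  have EU: "E z \<in> open_cube e" if "z \<in> U" for z
  proof -
    have n: "norm z < 1" using that by (simp add: U_def)
    have "\<bar>fst z\<bar> < 1" using n norm_fst_le[of "fst z" "snd z"] by simp
    moreover have "\<bar>snd z $ i\<bar> < 1" for i
      using n norm_snd_le[of "snd z" "fst z"] component_le_norm_cart[of "snd z" i] by simp
    ultimately show ?thesis using ed unfolding open_cube_def E_def by (auto simp: abs_less_iff)
  qed
  have Econt: "continuous_on U E"
    unfolding E_def
  proof (intro continuous_on_coordinatewise_then_product)
    fix k
    show "continuous_on U (\<lambda>z. if k < ?d then snd z $ g k else if k = ?d then fst z else 0)"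
      by (cases "k < ?d"; cases "k = ?d") (auto intro!: continuous_intros)
  qed
  define F :: "real \<times> (real ^ 'n) \<Rightarrow> real ^ 'n" where "F z = (\<chi> i. \<phi> (E z) (h i))" for z
  have "continuous_on U F"
    unfolding F_def
  proof (intro continuous_on_vec_lambda)
    fix i
    show "continuous_on U (\<lambda>z. \<phi> (E z) (h i))"
      by (rule continuous_on_compose2[OF cont Econt]) (use EU in auto)
  qed
  moreover have "inj_on F U"
  proof (rule inj_onI)
    fix z w assume z: "z \<in> U" and w: "w \<in> U" and eq: "F z = F w"
    have "\<phi> (E z) = \<phi> (E w)"
    proof
      fix k
      show "\<phi> (E z) k = \<phi> (E w) k"
      proof (cases "k < ?d")
        case True
        have "F z $ g k = F w $ g k" using eq by simp
        then show ?thesis using hg[OF True] by (simp add: F_def)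
      next
        case False
        then show ?thesis using S[of "\<phi> (E z)" k] S[of "\<phi> (E w)" k] im EU[OF z] EU[OF w] by (auto simp: image_subset_iff)
      qed
    qed
    then have Eq: "E z = E w" using inj EU[OF z] EU[OF w] by (auto dest: inj_onD)
    have "fst z = fst w" using fun_cong[OF Eq, of ?d] by (simp add: E_def)
    moreover have "snd z = snd w"
    proof (rule vec_eq_iff[THEN iffD2], rule allI)
      fix i show "snd z $ i = snd w $ i" using fun_cong[OF Eq, of "h i"] hd[of i] by (simp add: E_def gh)
    qed
    ultimately show "z = w" by (rule prod_eqI)
  qed
  moreover have "open U" "U \<noteq> {}" unfolding U_def by auto
  ultimately have "DIM(real \<times> (real ^ 'n)) \<le> DIM(real ^ 'n)" by (intro invariance_of_dimension[of U F])
  then show False by simp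
qed

text \<open>Affine functions of one coordinate are closed under partial derivatives. A constant is
  written with the term \<open>0 * x j\<close> so that the induction stays within one form.\<close>

lemma smooth_affine: "smooth_on_cube d (\<lambda>x. c + a * x j)"
proof -
  have p: "partial_deriv i (\<lambda>x. c + a * x j) = (\<lambda>x. (if i = j then a else 0) + 0 * x j)" for i c a
  proof
    fix x :: "nat \<Rightarrow> real"
    have "((\<lambda>t. c + a * (x(i := t)) j) has_real_derivative (if i = j then a else 0)) (at (x i))"
      by (cases "i = j") (auto intro!: derivative_eq_intros)
    then show "partial_deriv i (\<lambda>x. c + a * x j) x = (if i = j then a else 0) + 0 * x j"
      unfolding partial_deriv_def by (simp add: DERIV_imp_deriv)
  qed
  have f: "\<exists>c' a'. foldr partial_deriv is (\<lambda>x. c + a * x j) = (\<lambda>x. c' + a' * x j)" for "is"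
  proof (induction "is")
    case (Cons i "is")
    then obtain c' a' where "foldr partial_deriv is (\<lambda>x. c + a * x j) = (\<lambda>x. c' + a' * x j)" by blast
    then have "foldr partial_deriv (i # is) (\<lambda>x. c + a * x j) = (\<lambda>x. (if i = j then a' else 0) + 0 * x j)"
      by (simp add: p)
    then show ?case by blast
  qed auto
  show ?thesis
    unfolding smooth_on_cube_def
  proof (intro ballI conjI allI impI)
    fix "is" assume "is \<in> lists {..<d}"
    obtain c' a' where e: "foldr partial_deriv is (\<lambda>x. c + a * x j) = (\<lambda>x. c' + a' * x j)" using f by blast
    show "continuous_on (open_cube d) (foldr partial_deriv is (\<lambda>x. c + a * x j))"
      unfolding e by (intro continuous_intros continuous_on_subset[OF continuous_on_product_coordinates subset_UNIV])
    fix i and x :: "nat \<Rightarrow> real"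
    show "(\<lambda>t. foldr partial_deriv is (\<lambda>x. c + a * x j) (x(i := t))) differentiable at (x i)"
      unfolding e by (cases "i = j") (auto intro!: derivative_intros)
  qed
qed

lemma cube_embeds_box:
  assumes "\<epsilon> > 0" and box: "\<And>v. (\<And>k. k < d \<Longrightarrow> \<bar>v k - ctr k\<bar> < \<epsilon>) \<Longrightarrow> (\<And>k. k \<ge> d \<Longrightarrow> v k = 0) \<Longrightarrow> v \<in> S"
  shows "cube_embeds d S"
  unfolding cube_embeds_def
proof (intro exI conjI allI)
  let ?f = "\<lambda>x k. if k < d then ctr k + \<epsilon> * x k else (0 :: real)"
  show "?f ` open_cube d \<subseteq> S"
  proof (rule image_subsetI)
    fix x assume x: "x \<in> open_cube d"
    show "?f x \<in> S"
    proof (rule box)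
      fix k assume "k < d"
      then have "\<bar>x k\<bar> < 1" using x by (auto simp: open_cube_def abs_less_iff)
      then have "\<epsilon> * \<bar>x k\<bar> < \<epsilon> * 1" using assms(1) by (intro mult_strict_left_mono)
      then show "\<bar>?f x k - ctr k\<bar> < \<epsilon>" using \<open>k < d\<close> assms(1) by (simp add: abs_mult)
    qed simp
  qed
  show "inj_on ?f (open_cube d)"
  proof (rule inj_onI)
    fix x y assume x: "x \<in> open_cube d" and y: "y \<in> open_cube d" and eq: "?f x = ?f y"
    show "x = y"
    proof
      fix k
      show "x k = y k"
      proof (cases "k < d")
        case True
        then show ?thesis using fun_cong[OF eq, of k] assms(1) by simp
      next
        case False
        then show ?thesis using x y by (simp add: open_cube_def)
      qed
    qed
  qed
  fix j
  show "smooth_on_cube d (\<lambda>x. ?f x j)"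
    using smooth_affine[of d "ctr j" \<epsilon> j] smooth_affine[of d 0 0 j] by (cases "j < d") auto
qed

text \<open>If no box around \<open>ctr\<close> fitted into \<open>S\<close>, points outside
  \<open>S\<close> would converge to \<open>ctr\<close>. Openness can thus be checked by limits of
  coefficients.\<close>

lemma cube_embeds_seq:
  assumes "\<And>V. (\<And>k. k < d \<Longrightarrow> (\<lambda>n. V n k) \<longlonglongrightarrow> ctr k) \<Longrightarrow> (\<And>n k. k \<ge> d \<Longrightarrow> V n k = 0) \<Longrightarrow> \<forall>\<^sub>F n in sequentially. V n \<in> S"
  shows "cube_embeds d S"
proof (rule ccontr)
  assume no: "\<not> cube_embeds d S"
  have "\<exists>v. (\<forall>k<d. \<bar>v k - ctr k\<bar> < 1 / real (Suc n)) \<and> (\<forall>k\<ge>d. v k = 0) \<and> v \<notin> S" for n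
    using cube_embeds_box[of "1 / real (Suc n)" d ctr S] no by auto
  then obtain V where V: "\<And>n. (\<forall>k<d. \<bar>V n k - ctr k\<bar> < 1 / real (Suc n)) \<and> (\<forall>k\<ge>d. V n k = 0) \<and> V n \<notin> S" by metis
  have "(\<lambda>n. V n k) \<longlonglongrightarrow> ctr k" if "k < d" for k
  proof (rule LIM_zero_cancel, rule tendsto_rabs_zero_cancel, rule tendsto_sandwich)
    show "\<forall>\<^sub>F n in sequentially. 0 \<le> \<bar>V n k - ctr k\<bar>" by simp
    show "\<forall>\<^sub>F n in sequentially. \<bar>V n k - ctr k\<bar> \<le> 1 / real (Suc n)" using V that by (auto intro!: always_eventually less_imp_le)
    show "(\<lambda>n. 1 / real (Suc n)) \<longlonglongrightarrow> 0" by (rule LIMSEQ_Suc[OF lim_1_over_n])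
  qed simp
  then have "\<forall>\<^sub>F n in sequentially. V n \<in> S" using V by (intro assms) auto
  then show False using V by (auto simp: eventually_sequentially)
qed

lemma realizability_memI:
  assumes ctr: "\<And>k. k \<ge> 2 * n + 2 \<Longrightarrow> v k = 0" and pos: "\<And>k. k < 2 * n + 2 \<Longrightarrow> v k > 0"
    and N: "N \<in> \<N>" "series_parallel N"
      "val N = (\<lambda>s. ennreal ((\<Sum>k\<le>n. v k * pos s ^ k) / (\<Sum>k\<le>n. v (n + 1 + k) * pos s ^ k)))"
  shows "v \<in> realizability_set n \<N>"
proof -
  define p q where "p = (\<Sum>k\<le>n. monom (v k) k)" and "q = (\<Sum>k\<le>n. monom (v (n + 1 + k)) k)"
  have pq: "poly p t = (\<Sum>k\<le>n. v k * t ^ k)" "poly q t = (\<Sum>k\<le>n. v (n + 1 + k) * t ^ k)" for t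
    by (simp_all add: p_def q_def poly_sum poly_monom)
  have pp: "\<forall>t>0. poly p t > 0" "\<forall>t>0. poly q t > 0"
    unfolding pq using pos by (auto intro!: sum_pos mult_pos_pos)
  have "impedance N = Some (Fract p q)"
    by (rule impedance_SomeI[OF N(2) pp(2,1)]) (simp add: N(3) pq)
  moreover have "q \<noteq> 0" by (rule pos_poly_nz[OF pp(2)])
  moreover have "v n \<noteq> 0" using pos[of n] by simp
  ultimately show ?thesis
    unfolding realizability_set_def Let_def using ctr N(1) by (auto simp: p_def q_def)
qed

text \<open>The number 2 n + 2 of coefficients bounds the dimension, and a neighbourhood of
  \<open>ctr\<close> attains it. The type \<open>'n\<close> only supplies a Euclidean space of that
  dimension.\<close>

lemma genericI:
  assumes d: "CARD('n::finite) = 2 * n + 2"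
    and num: "\<And>N. N \<in> \<N> \<Longrightarrow> num_storage N = n" "\<And>N. N \<in> \<N> \<Longrightarrow> num_elements N < 2 * n + 2"
    and sp: "\<And>N. N \<in> \<N> \<Longrightarrow> series_parallel N"
    and pos: "\<And>k. k < 2 * n + 2 \<Longrightarrow> ctr k > 0"
    and ev: "\<And>V. (\<And>k. k < 2 * n + 2 \<Longrightarrow> (\<lambda>i. V i k) \<longlonglongrightarrow> ctr k) \<Longrightarrow>
      \<forall>\<^sub>F i in sequentially. (\<forall>k<2 * n + 2. V i k > 0) \<longrightarrow>
         (\<exists>N\<in>\<N>. val N = (\<lambda>s. ennreal ((\<Sum>k\<le>n. V i k * pos s ^ k) / (\<Sum>k\<le>n. V i (n + 1 + k) * pos s ^ k))))"
  shows "generic \<N>"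
proof -
  let ?S = "realizability_set n \<N>"
  have "cube_embeds (2 * n + 2) ?S"
  proof (rule cube_embeds_seq[where ctr = ctr])
    fix V :: "nat \<Rightarrow> nat \<Rightarrow> real"
    assume l: "\<And>k. k < 2 * n + 2 \<Longrightarrow> (\<lambda>i. V i k) \<longlonglongrightarrow> ctr k" and z: "\<And>i k. k \<ge> 2 * n + 2 \<Longrightarrow> V i k = 0"
    have "\<forall>k\<in>{..<2 * n + 2}. \<forall>\<^sub>F i in sequentially. V i k > 0"
      using order_tendstoD(1)[OF l pos] by simp
    then have "\<forall>\<^sub>F i in sequentially. \<forall>k\<in>{..<2 * n + 2}. V i k > 0"
      by (intro eventually_ball_finite) auto
    moreover have "\<forall>\<^sub>F i in sequentially. (\<forall>k<2 * n + 2. V i k > 0) \<longrightarrow>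
         (\<exists>N\<in>\<N>. val N = (\<lambda>s. ennreal ((\<Sum>k\<le>n. V i k * pos s ^ k) / (\<Sum>k\<le>n. V i (n + 1 + k) * pos s ^ k))))"
      by (rule ev) (rule l)
    ultimately show "\<forall>\<^sub>F i in sequentially. V i \<in> ?S"
    proof eventually_elim
      case (elim i)
      then obtain N where "N \<in> \<N>" "val N = (\<lambda>s. ennreal ((\<Sum>k\<le>n. V i k * pos s ^ k) / (\<Sum>k\<le>n. V i (n + 1 + k) * pos s ^ k)))"
        by auto
      then show ?case using z elim(1) sp by (intro realizability_memI) auto
    qed
  qed
  moreover have "e \<le> 2 * n + 2" if "cube_embeds e ?S" for e
    using cube_embeds_le[where 'n = 'n, OF _ that] d by (auto simp: realizability_set_def)
  ultimately have "has_dimension ?S (2 * n + 2)" unfolding has_dimension_def by blast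
  then show ?thesis unfolding generic_def using num by blast
qed

section \<open>Genericity of the four groups of classes\<close>

lemma crit6_fam6: "crit6 a0 a1 a2 b0 b1 b2 \<Longrightarrow> \<exists>M\<in>fam6 full. val M = qfun a0 a1 a2 b0 b1 b2"
  using crit6_form6[of a0 a1 a2 b0 b1 b2] unfolding fam6_def qfun_def by fastforce

lemma crit6_eventually:
  assumes l: "A0 \<longlonglongrightarrow> a0" "A1 \<longlonglongrightarrow> a1" "A2 \<longlonglongrightarrow> a2" "B0 \<longlonglongrightarrow> b0" "B1 \<longlonglongrightarrow> b1" "B2 \<longlonglongrightarrow> b2"
    and cr: "crit6 a0 a1 a2 b0 b1 b2" "a0 > 0" "a2 * b0 - a0 * b2 > 0" "b1 * (a1 * b0 - a0 * b1) - b0 * (a2 * b0 - a0 * b2) > 0"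
  shows "\<forall>\<^sub>F n in sequentially. crit6 (A0 n) (A1 n) (A2 n) (B0 n) (B1 n) (B2 n)"
proof -
  note cr' = cr[unfolded crit6_def]
  have "\<forall>\<^sub>F n in sequentially. A0 n > 0" "\<forall>\<^sub>F n in sequentially. B0 n > 0" "\<forall>\<^sub>F n in sequentially. B2 n > 0"
    using order_tendstoD(1)[OF l(1), of 0] order_tendstoD(1)[OF l(4), of 0] order_tendstoD(1)[OF l(6), of 0] cr' by auto
  moreover have "\<forall>\<^sub>F n in sequentially. A1 n * B0 n - A0 n * B1 n > 0"
    by (rule order_tendstoD(1)[where y = "a1 * b0 - a0 * b1"]) (use cr' in \<open>auto intro!: tendsto_intros l\<close>)
  moreover have "\<forall>\<^sub>F n in sequentially. A2 n * B0 n - A0 n * B2 n > 0"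
    by (rule order_tendstoD(1)[where y = "a2 * b0 - a0 * b2"]) (use cr' in \<open>auto intro!: tendsto_intros l\<close>)
  moreover have "\<forall>\<^sub>F n in sequentially. B1 n * (A1 n * B0 n - A0 n * B1 n) - B0 n * (A2 n * B0 n - A0 n * B2 n) > 0"
    by (rule order_tendstoD(1)[where y = "b1 * (a1 * b0 - a0 * b1) - b0 * (a2 * b0 - a0 * b2)"]) (use cr' in \<open>auto intro!: tendsto_intros l\<close>)
  moreover have "\<forall>\<^sub>F n in sequentially. B2 n * (A1 n * B0 n - A0 n * B1 n)\<^sup>2 - (A2 n * B0 n - A0 n * B2 n) * (B1 n * (A1 n * B0 n - A0 n * B1 n) - B0 n * (A2 n * B0 n - A0 n * B2 n)) > 0"
    by (rule order_tendstoD(1)[where y = "b2 * (a1 * b0 - a0 * b1)\<^sup>2 - (a2 * b0 - a0 * b2) * (b1 * (a1 * b0 - a0 * b1) - b0 * (a2 * b0 - a0 * b2))"])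
      (use cr' in \<open>auto intro!: tendsto_intros l\<close>)
  ultimately show ?thesis by eventually_elim (simp add: crit6_def)
qed

lemma generic_class1: "generic class1"
proof (rule genericI[where 'n = 2 and n = 0 and ctr = "\<lambda>_. 1"])
  fix V :: "nat \<Rightarrow> nat \<Rightarrow> real"
  have "\<exists>N\<in>class1. val N = (\<lambda>s. ennreal (V i 0 / V i 1))" if "V i 0 > 0" "V i 1 > 0" for i
    using that unfolding class1_def by (auto simp: val_res intro!: exI[of _ "V i 0 / V i 1"])
  then show "\<forall>\<^sub>F i in sequentially. (\<forall>k<2 * 0 + 2. V i k > 0) \<longrightarrow>
         (\<exists>N\<in>class1. val N = (\<lambda>s. ennreal ((\<Sum>k\<le>0. V i k * pos s ^ k) / (\<Sum>k\<le>0. V i (0 + 1 + k) * pos s ^ k))))"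
    by (intro always_eventually) simp
qed (use num_class1 sp_class1 in \<open>auto simp: numeral_2_eq_2\<close>)

text \<open>The centre is (2 + s) / (1 + s), an instance of \<open>N2\<close> with all element
  values 1; \<open>N2\<close> covers its neighbourhood because p0 q1 > p1 q0 is an open
  condition.\<close>

lemma generic_U2: "generic U2"
proof (rule genericI[where 'n = 4 and n = 1 and ctr = "\<lambda>k. if k = 0 then 2 else 1"])
  fix V :: "nat \<Rightarrow> nat \<Rightarrow> real"
  assume l: "\<And>k. k < 2 * 1 + 2 \<Longrightarrow> (\<lambda>i. V i k) \<longlonglongrightarrow> (if k = 0 then 2 else 1)"
  have "(\<lambda>i. V i 0 * V i 3 - V i 1 * V i 2) \<longlonglongrightarrow> 2 * 1 - 1 * 1"
    using l[of 0] l[of 1] l[of 2] l[of 3] by (intro tendsto_intros) auto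
  then have "\<forall>\<^sub>F i in sequentially. V i 0 * V i 3 - V i 1 * V i 2 > 0" by (rule order_tendstoD) simp
  then show "\<forall>\<^sub>F i in sequentially. (\<forall>k<2 * 1 + 2. V i k > 0) \<longrightarrow>
         (\<exists>N\<in>U2. val N = (\<lambda>s. ennreal ((\<Sum>k\<le>1. V i k * pos s ^ k) / (\<Sum>k\<le>1. V i (1 + 1 + k) * pos s ^ k))))"
  proof (rule eventually_mono, intro impI)
    fix i assume D: "V i 0 * V i 3 - V i 1 * V i 2 > 0" and p: "\<forall>k<2 * 1 + 2. V i k > 0"
    define p0 p1 q0 q1 where "p0 = V i 0" and "p1 = V i 1" and "q0 = V i 2" and "q1 = V i 3"
    have v: "p0 > 0" "p1 > 0" "q0 > 0" "q1 > 0" "p0 * q1 - p1 * q0 > 0"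
      using p D by (auto simp: p0_def p1_def q0_def q1_def)
    define K where "K = p0 * q1 - p1 * q0"
    have K: "K > 0" using v by (simp add: K_def)
    have e: "(p0 + p1 * t) / (q0 + q1 * t) = p1 / q1 + 1 / (q0 * q1 / K + q1\<^sup>2 / K * t)" if t: "t > 0" for t
    proof -
      have q: "q0 + q1 * t > 0" using v t by (intro add_pos_pos) auto
      have "q0 * q1 / K + q1\<^sup>2 / K * t = q1 * (q0 + q1 * t) / K"
        by (simp add: add_divide_distrib[symmetric] algebra_simps power2_eq_square)
      then have "p1 / q1 + 1 / (q0 * q1 / K + q1\<^sup>2 / K * t) = (p1 * (q0 + q1 * t) + K) / (q1 * (q0 + q1 * t))"
        using v q by (simp add: add_divide_distrib)
      also have "p1 * (q0 + q1 * t) + K = q1 * (p0 + p1 * t)" by (simp add: K_def algebra_simps)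
      finally show ?thesis using v by simp
    qed
    have r: "p1 / q1 \<ge> 0" "q0 * q1 / K \<ge> 0" "q1\<^sup>2 / K > 0" using v K by auto
    then have "form2 (p1 / q1) (q0 * q1 / K) (q1\<^sup>2 / K) \<in> U2"
      unfolding U2_def class2_def form2_def by blast
    moreover have "val (form2 (p1 / q1) (q0 * q1 / K) (q1\<^sup>2 / K)) = (\<lambda>s. ennreal ((p0 + p1 * pos s) / (q0 + q1 * pos s)))"
      unfolding form2_val[OF r] by (simp add: e)
    moreover have "(\<Sum>k\<le>1. V i k * t ^ k) = p0 + p1 * t" "(\<Sum>k\<le>1. V i (1 + 1 + k) * t ^ k) = q0 + q1 * t" for t
      by (simp_all add: p0_def p1_def q0_def q1_def numeral_2_eq_2 numeral_3_eq_3)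
    ultimately show "\<exists>N\<in>U2. val N = (\<lambda>s. ennreal ((\<Sum>k\<le>1. V i k * pos s ^ k) / (\<Sum>k\<le>1. V i (1 + 1 + k) * pos s ^ k)))"
      by auto
  qed
qed (use num_U2 sp_U2 in auto)

text \<open>The centre is the impedance of \<open>N6\<close> with all five element values 1. There
  c1 = 4, c2 = 2, E = 4 and H = 8, so that all conditions are strict.\<close>

lemma generic_U4: "generic U4"
proof (rule genericI[where 'n = 6 and n = 2 and ctr = "(!) [2, 4, 2, 2, 2, 1]"])
  fix V :: "nat \<Rightarrow> nat \<Rightarrow> real"
  assume l: "\<And>k. k < 2 * 2 + 2 \<Longrightarrow> (\<lambda>i. V i k) \<longlonglongrightarrow> [2, 4, 2, 2, 2, 1] ! k"
  have "(\<lambda>i. V i 0) \<longlonglongrightarrow> 2" "(\<lambda>i. V i 1) \<longlonglongrightarrow> 4" "(\<lambda>i. V i 2) \<longlonglongrightarrow> 2" "(\<lambda>i. V i 3) \<longlonglongrightarrow> 2" "(\<lambda>i. V i 4) \<longlonglongrightarrow> 2" "(\<lambda>i. V i 5) \<longlonglongrightarrow> 1"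
    using l[of 0] l[of 1] l[of 2] l[of 3] l[of 4] l[of 5] by simp_all
  then have "\<forall>\<^sub>F i in sequentially. crit6 (V i 0) (V i 1) (V i 2) (V i 3) (V i 4) (V i 5)"
    by (rule crit6_eventually) (simp_all add: crit6_def)
  then show "\<forall>\<^sub>F i in sequentially. (\<forall>k<2 * 2 + 2. V i k > 0) \<longrightarrow>
         (\<exists>N\<in>U4. val N = (\<lambda>s. ennreal ((\<Sum>k\<le>2. V i k * pos s ^ k) / (\<Sum>k\<le>2. V i (2 + 1 + k) * pos s ^ k))))"
  proof (rule eventually_mono, intro impI)
    fix i assume "crit6 (V i 0) (V i 1) (V i 2) (V i 3) (V i 4) (V i 5)"
    then obtain M where M: "M \<in> fam6 full" "val M = qfun (V i 0) (V i 1) (V i 2) (V i 3) (V i 4) (V i 5)"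
      using crit6_fam6 by blast
    have "(\<Sum>k\<le>2. V i k * t ^ k) = quad (V i 0) (V i 1) (V i 2) t"
      "(\<Sum>k\<le>2. V i (2 + 1 + k) * t ^ k) = quad (V i 3) (V i 4) (V i 5) t" for t
      by (simp_all add: quad_def numeral_eq_Suc)
    then show "\<exists>N\<in>U4. val N = (\<lambda>s. ennreal ((\<Sum>k\<le>2. V i k * pos s ^ k) / (\<Sum>k\<le>2. V i (2 + 1 + k) * pos s ^ k)))"
      using M unfolding qfun_def fam_class U4_def by auto
  qed
next
  fix k :: nat assume "k < 2 * 2 + 2"
  then have "k \<in> {0, 1, 2, 3, 4, 5}" by auto
  then show "0 < [2, 4, 2, 2, 2, 1 :: real] ! k" by auto
qed (use num_U4 sp_U4 in auto)

text \<open>The centre is the admittance of the \<open>class18\<close> network whose element values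
  are all 1, with R5 = 0. Nearby vectors are realized by splitting off a series resistor and an
  inductor; the remaining biquadratic is close to the centre of \<open>generic_U4\<close>.\<close>

lemma generic_U3: "generic U3"
proof (rule genericI[where 'n = 8 and n = 3 and ctr = "(!) [2, 6, 4, 1, 2, 8, 8, 3]"])
  fix V :: "nat \<Rightarrow> nat \<Rightarrow> real"
  assume l: "\<And>k. k < 2 * 3 + 2 \<Longrightarrow> (\<lambda>i. V i k) \<longlonglongrightarrow> [2, 6, 4, 1, 2, 8, 8, 3] ! k"
  \<comment> \<open>The networks are duals, so the first four entries, the numerator of 1/Z, form
    the denominator q of Z.\<close>
  define p q where "p k = (\<lambda>i. V i (4 + k))" and "q k = (\<lambda>i. V i k)" for k
  have lq: "q 0 \<longlonglongrightarrow> 2" "q 1 \<longlonglongrightarrow> 6" "q 2 \<longlonglongrightarrow> 4" "q 3 \<longlonglongrightarrow> 1"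
    unfolding q_def using l[of 0] l[of 1] l[of 2] l[of 3] by simp_all
  have lp: "p 0 \<longlonglongrightarrow> 2" "p 1 \<longlonglongrightarrow> 8" "p 2 \<longlonglongrightarrow> 8" "p 3 \<longlonglongrightarrow> 3"
    unfolding p_def using l[of 4] l[of 5] l[of 6] l[of 7] by simp_all
  \<comment> \<open>These are the quantities of \<open>cub_split\<close> for x = 0, since R5 = 0: D
    is the value of Z at s = 0, and 1 / K is the inductance.\<close>
  define D where "D = (\<lambda>i. p 0 i / q 0 i)"
  define A0 where "A0 = (\<lambda>i. p 1 i - D i * q 1 i)"
  define A1 where "A1 = (\<lambda>i. p 2 i - D i * q 2 i)"
  define A2 where "A2 = (\<lambda>i. p 3 i - D i * q 3 i)"
  define K where "K = (\<lambda>i. q 0 i / A0 i)"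
  define B0 where "B0 = (\<lambda>i. q 1 i - K i * A1 i)"
  define B1 where "B1 = (\<lambda>i. q 2 i - K i * A2 i)"
  have "D \<longlonglongrightarrow> 2 / 2" unfolding D_def by (intro tendsto_divide lp lq) simp
  then have D: "D \<longlonglongrightarrow> 1" by simp
  have "A0 \<longlonglongrightarrow> 8 - 1 * 6" "A1 \<longlonglongrightarrow> 8 - 1 * 4" "A2 \<longlonglongrightarrow> 3 - 1 * 1"
    unfolding A0_def A1_def A2_def by (intro tendsto_intros lp lq D)+
  then have A: "A0 \<longlonglongrightarrow> 2" "A1 \<longlonglongrightarrow> 4" "A2 \<longlonglongrightarrow> 2" by simp_all
  have "K \<longlonglongrightarrow> 2 / 2" unfolding K_def by (intro tendsto_divide lq A) simp
  then have K: "K \<longlonglongrightarrow> 1" by simp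
  have "B0 \<longlonglongrightarrow> 6 - 1 * 4" "B1 \<longlonglongrightarrow> 4 - 1 * 2" unfolding B0_def B1_def by (intro tendsto_intros lq A K)+
  then have B: "B0 \<longlonglongrightarrow> 2" "B1 \<longlonglongrightarrow> 2" by simp_all
  have "\<forall>\<^sub>F i in sequentially. crit6 (A0 i) (A1 i) (A2 i) (B0 i) (B1 i) (q 3 i)"
    by (rule crit6_eventually[OF A B lq(4)]) (simp_all add: crit6_def)
  moreover have "\<forall>\<^sub>F i in sequentially. A0 i > 0" using A(1) by (rule order_tendstoD) simp
  ultimately show "\<forall>\<^sub>F i in sequentially. (\<forall>k<2 * 3 + 2. V i k > 0) \<longrightarrow>
         (\<exists>N\<in>U3. val N = (\<lambda>s. ennreal ((\<Sum>k\<le>3. V i k * pos s ^ k) / (\<Sum>k\<le>3. V i (3 + 1 + k) * pos s ^ k))))"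
  proof (eventually_elim, intro impI)
    fix i assume cr: "crit6 (A0 i) (A1 i) (A2 i) (B0 i) (B1 i) (q 3 i)" and A0: "A0 i > 0" and v: "\<forall>k<2 * 3 + 2. V i k > 0"
    have pos: "q 0 i > 0" "q 1 i > 0" "q 2 i > 0" "q 3 i > 0" "p 0 i > 0" "p 1 i > 0" "p 2 i > 0" "p 3 i > 0"
      unfolding p_def q_def using v by simp_all
    then have DK: "D i > 0" "K i > 0" using A0 by (simp_all add: D_def K_def)
    obtain M where M: "M \<in> fam6 full" "val M = qfun (A0 i) (A1 i) (A2 i) (B0 i) (B1 i) (q 3 i)"
      using crit6_fam6[OF cr] by blast
    let ?N = "res (D i) \<oplus> ((res 0 \<oplus> ind (1 / K i)) \<parallel> M)"
    have "?N \<in> nets {0} (fam6 full)" unfolding nets_def using DK M(1)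
      by (intro CollectI exI[of _ "D i"] exI[of _ 0] exI[of _ "1 / K i"] exI[of _ M]) auto
    then have N: "?N \<in> class18" using nets_class18 by blast
    then have N3: "?N \<in> \<Union> three_storage_classes" unfolding three_storage_classes_def by blast
    define P Q where "P = cub (p 0 i) (p 1 i) (p 2 i) (p 3 i)" and "Q = cub (q 0 i) (q 1 i) (q 2 i) (q 3 i)"
    have PQ: "P t > 0" "Q t > 0" if "t > 0" for t
      unfolding P_def Q_def cub_def using pos that by (auto intro!: add_pos_pos)
    have "val ?N = (\<lambda>s. ennreal (P (pos s) / Q (pos s)))"
    proof
      fix s
      define t where "t = pos s"
      have t: "t > 0" by (simp add: t_def)
      have q: "quad (A0 i) (A1 i) (A2 i) t > 0" "quad (B0 i) (B1 i) (q 3 i) t > 0" using crit6_pos[OF cr t] by auto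
      have "P t / Q t = D i + 1 / (K i / (t + 0) + quad (B0 i) (B1 i) (q 3 i) t / quad (A0 i) (A1 i) (A2 i) t)"
        using cub_split[of "p 0 i" "p 1 i" "p 2 i" "p 3 i" 0 "D i" "q 0 i" "q 1 i" "q 2 i" "q 3 i" "K i" t] pos A0 PQ(2)[OF t] q t
        unfolding P_def Q_def by (simp add: cub_def quad_def A0_def A1_def A2_def B0_def B1_def D_def K_def)
      then have e: "P t / Q t = D i + 1 / (1 / (1 / K i * t) + 1 / (quad (A0 i) (A1 i) (A2 i) t / quad (B0 i) (B1 i) (q 3 i) t))"
        using DK by simp
      have k: "1 / K i * t > 0" "quad (A0 i) (A1 i) (A2 i) t / quad (B0 i) (B1 i) (q 3 i) t > 0" using DK t q by auto
      have "val ?N s = ennreal (D i) + prl (ennreal (1 / K i) * ennreal t) (ennreal (quad (A0 i) (A1 i) (A2 i) t / quad (B0 i) (B1 i) (q 3 i) t))"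
        by (simp add: val_ser val_par val_res M(2) qfun_def t_def)
      also have "ennreal (1 / K i) * ennreal t = ennreal (1 / K i * t)" using DK t by (intro ennreal_mult[symmetric]) auto
      also have "prl (ennreal (1 / K i * t)) (ennreal (quad (A0 i) (A1 i) (A2 i) t / quad (B0 i) (B1 i) (q 3 i) t)) =
          ennreal (1 / (1 / (1 / K i * t) + 1 / (quad (A0 i) (A1 i) (A2 i) t / quad (B0 i) (B1 i) (q 3 i) t)))" by (rule prl_ennreal[OF k])
      also have "ennreal (D i) + \<dots> = ennreal (P t / Q t)"
        unfolding e using DK(1) by (intro ennreal_plus[symmetric] less_imp_le[OF divide_pos_pos] add_pos_pos divide_pos_pos zero_less_one k) simp
      finally show "val ?N s = ennreal (P (pos s) / Q (pos s))" by (simp add: t_def)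
    qed
    then have "val (dual_net ?N) = (\<lambda>s. ennreal (Q (pos s) / P (pos s)))"
      using val_dual[OF sp_three[OF N3]] PQ by (simp add: fd_def inverse_ennreal)
    moreover have "dual_net ?N \<in> U3" unfolding U3_def using N3 by blast
    moreover have "(\<Sum>k\<le>3. V i k * t ^ k) = Q t" "(\<Sum>k\<le>3. V i (3 + 1 + k) * t ^ k) = P t" for t
      by (simp_all add: P_def Q_def p_def q_def cub_def numeral_eq_Suc)
    ultimately show "\<exists>N\<in>U3. val N = (\<lambda>s. ennreal ((\<Sum>k\<le>3. V i k * pos s ^ k) / (\<Sum>k\<le>3. V i (3 + 1 + k) * pos s ^ k)))"
      by auto
  qed
next
  fix k :: nat assume "k < 2 * 3 + 2"
  then have "k \<in> {0, 1, 2, 3, 4, 5, 6, 7}" by auto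
  then show "0 < [2, 6, 4, 1, 2, 8, 8, 3 :: real] ! k" by auto
qed (use num_U3 sp_U3 in auto)

theorem theorem21:
  shows "minimal_generating_set 2 1 (\<Union> classes_2_1)"
  unfolding minimal_generating_set_def
proof (intro conjI exI[of _ "{class1, U2, U4, U3}"])
  show "generating_set 2 1 (\<Union> classes_2_1)" by (rule generating_2_1)
  show "\<forall>\<N>\<in>{class1, U2, U4, U3}. generic \<N>"
    using generic_class1 generic_U2 generic_U4 generic_U3 by simp
  show "\<Union> classes_2_1 = \<Union> {class1, U2, U4, U3}" by (rule classes_2_1_eq)
qed

end
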